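(* Let $S$ and $\Sigma$ be two measurable subsets of $\mathbb{R}$. The following assertions are equivalent: (a) $(S,\Sigma)$ is a strong annihilating pair; (b) $1+i\notin\overline{W(P_S+iP_\Sigma)}$; (c) $\mathrm{Ran}(P_S)\cap\mathrm{Ran}(P_\Sigma)=\{0\}$ and $\cos(\mathrm{Ran}(P_S),\mathrm{Ran}(P_\Sigma))<1$; (d) $\|P_SP_\Sigma\|<1$; (e) $r(P_SP_\Sigma)<1$; (f) $1\notin\sigma(P_SP_\Sigma)$; (g) $1\notin\overline{W(P_SP_\Sigma)}$; (h) $\omega(P_SP_\Sigma)<1$; (i) for all $\alpha\in[0,\frac{\pi}{3}]$, $\omega(\mathrm{Re}(e^{-i\alpha}P_SP_\Sigma))<\cos(\alpha)$; (j) there exists $\alpha\in[0,\frac{\pi}{3}]$ such that $\omega(\mathrm{Re}(e^{-i\alpha}P_SP_\Sigma))<\cos(\alpha)$; (k) there exists $\theta<\frac{\pi}{6}$ such that $W(P_SP_\Sigma)\subset\{z\in\mathbb{C}: |\arg(1-z)|\le\theta\}\setminus\{1\}$.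
   Context: Let $\mathcal{F}$ be the (unitary) Fourier transform on $L_2(\mathbb{R})$. For $g\in L_\infty(\mathbb{R})$, $M_g$ is the operator of multiplication by $g$ on $L_2(\mathbb{R})$, and $\mathbf{1}_S$ is the indicator function of $S$. Set $P_S=M_{\mathbf{1}_S}$ and $P_\Sigma=\mathcal{F}^*M_{\mathbf{1}_\Sigma}\mathcal{F}$, which are orthogonal projections on $L_2(\mathbb{R})$. The pair $(S,\Sigma)$ is a strong annihilating pair if there exists a constant $c>0$ (depending on $S,\Sigma$) such that $\|f\|^2\le c\left(\|(I-P_S)f\|^2+\|(I-P_\Sigma)f\|^2\right)$ for all $f\in L_2(\mathbb{R})$. For a bounded operator $T$: $\sigma(T)$ is its spectrum, $r(T)$ its spectral radius, $\mathrm{Ran}(T)$ its range, $W(T)=\{\langle Tx,x\rangle : \|x\|=1\}$ its numerical range, $\omega(T)=\sup\{|z|: z\in W(T)\}$ its numerical radius, and $\mathrm{Re}(T)=\frac12(T+T^* )$. For closed subspaces $M_1,M_2$ with $M=M_1\cap M_2$, $\cos(M_1,M_2)=\sup\{|\langle x,y\rangle| : x\in M_1\cap M^\perp,\ y\in M_2\cap M^\perp,\ \|x\|=\|y\|=1\}$ (supremum of the empty set equal to $0$). $\arg$ is the principal argument in $(-\pi,\pi]$. *)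

theory Defs
  imports "HOL-Analysis.Analysis"
begin

section \<open>The complex Hilbert space \<open>L\<^sub>2(\<real>)\<close>\<close>

definition square_integrable :: "(real \<Rightarrow> complex) \<Rightarrow> bool" where
  "square_integrable f \<longleftrightarrow>
     f \<in> borel_measurable lebesgue \<and> integrable lebesgue (\<lambda>x. (cmod (f x))\<^sup>2)"

definition l2_rel :: "(real \<Rightarrow> complex) \<Rightarrow> (real \<Rightarrow> complex) \<Rightarrow> bool" where
  "l2_rel f g \<longleftrightarrow>
     square_integrable f \<and> square_integrable g \<and> (AE x in lebesgue. f x = g x)"

lemma square_integrable_zero [simp]: "square_integrable (\<lambda>x. 0)"
  by (simp add: square_integrable_def)

lemma square_integrable_mult_const:
  assumes "square_integrable f"
  shows "square_integrable (\<lambda>x. c * f x)"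
proof -
  have [measurable]: "f \<in> borel_measurable lebesgue"
    using assms by (simp add: square_integrable_def)
  have "(\<lambda>x. c * f x) \<in> borel_measurable lebesgue"
    by measurable
  then show ?thesis
    using assms by (simp add: square_integrable_def norm_mult power_mult_distrib)
qed

lemma square_integrable_add:
  assumes f: "square_integrable f" and g: "square_integrable g"
  shows "square_integrable (\<lambda>x. f x + g x)"
proof -
  have [measurable]: "f \<in> borel_measurable lebesgue" "g \<in> borel_measurable lebesgue"
    using f g by (auto simp: square_integrable_def)
  have "integrable lebesgue (\<lambda>x. 2 * (cmod (f x))\<^sup>2 + 2 * (cmod (g x))\<^sup>2)"
    using f g by (auto simp: square_integrable_def)
  then have "integrable lebesgue (\<lambda>x. (cmod (f x + g x))\<^sup>2)"
  proof (rule Bochner_Integration.integrable_bound)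
    show "AE x in lebesgue. norm ((cmod (f x + g x))\<^sup>2)
            \<le> norm (2 * (cmod (f x))\<^sup>2 + 2 * (cmod (g x))\<^sup>2)"
    proof (rule AE_I2)
      fix x
      have "(cmod (f x + g x))\<^sup>2 \<le> (cmod (f x) + cmod (g x))\<^sup>2"
        by (intro power_mono norm_triangle_ineq) simp
      also have "\<dots> \<le> 2 * (cmod (f x))\<^sup>2 + 2 * (cmod (g x))\<^sup>2"
        using sum_squares_bound[of "cmod (f x)" "cmod (g x)"] by (simp add: power2_sum)
      finally show "norm ((cmod (f x + g x))\<^sup>2)
            \<le> norm (2 * (cmod (f x))\<^sup>2 + 2 * (cmod (g x))\<^sup>2)"
        by simp
    qed
  qed measurable
  then show ?thesis
    by (simp add: square_integrable_def)
qed

lemma square_integrable_mult_cnj: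
  assumes f: "square_integrable f" and g: "square_integrable g"
  shows "integrable lebesgue (\<lambda>x. f x * cnj (g x))"
proof -
  have m [measurable]: "f \<in> borel_measurable lebesgue" "g \<in> borel_measurable lebesgue"
    using f g by (auto simp: square_integrable_def)
  have "cnj \<in> borel_measurable borel"
    by (intro borel_measurable_continuous_onI continuous_intros)
  then have [measurable]: "(\<lambda>x. cnj (g x)) \<in> borel_measurable lebesgue"
    by (rule measurable_compose[OF m(2)])
  have "integrable lebesgue (\<lambda>x. (cmod (f x))\<^sup>2 + (cmod (g x))\<^sup>2)"
    using f g by (auto simp: square_integrable_def)
  then show ?thesis
  proof (rule Bochner_Integration.integrable_bound)
    show "AE x in lebesgue. norm (f x * cnj (g x))
            \<le> norm ((cmod (f x))\<^sup>2 + (cmod (g x))\<^sup>2)"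
    proof (rule AE_I2)
      fix x
      have "2 * (cmod (f x) * cmod (g x)) \<le> (cmod (f x))\<^sup>2 + (cmod (g x))\<^sup>2"
        using sum_squares_bound[of "cmod (f x)" "cmod (g x)"] by (simp add: mult.assoc)
      moreover have "0 \<le> cmod (f x) * cmod (g x)"
        by (rule mult_nonneg_nonneg) simp_all
      ultimately have "cmod (f x) * cmod (g x) \<le> (cmod (f x))\<^sup>2 + (cmod (g x))\<^sup>2"
        by linarith
      then show "norm (f x * cnj (g x)) \<le> norm ((cmod (f x))\<^sup>2 + (cmod (g x))\<^sup>2)"
        by (simp add: norm_mult)
    qed
  qed measurable
qed

quotient_type l2 = "real \<Rightarrow> complex" / partial: l2_rel
  morphisms rep_l2 abs_l2
proof (rule part_equivpI)
  show "\<exists>f. l2_rel f f"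
    by (rule exI[of _ "\<lambda>x. 0"]) (simp add: l2_rel_def)
  show "symp l2_rel"
    by (rule sympI) (auto simp: l2_rel_def eq_commute)
  show "transp l2_rel"
    by (rule transpI) (auto simp: l2_rel_def elim: AE_mp)
qed

instantiation l2 :: real_vector
begin

lift_definition zero_l2 :: l2 is "\<lambda>x. 0"
  by (simp add: l2_rel_def)

lift_definition plus_l2 :: "l2 \<Rightarrow> l2 \<Rightarrow> l2" is "\<lambda>f g x. f x + g x"
  by (auto simp: l2_rel_def square_integrable_add)

lift_definition uminus_l2 :: "l2 \<Rightarrow> l2" is "\<lambda>f x. - f x"
  using square_integrable_mult_const[of _ "-1"] by (auto simp: l2_rel_def)

definition minus_l2 :: "l2 \<Rightarrow> l2 \<Rightarrow> l2" where
  "minus_l2 f g = f + (- g)"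

lift_definition scaleR_l2 :: "real \<Rightarrow> l2 \<Rightarrow> l2" is "\<lambda>r f x. complex_of_real r * f x"
  by (auto simp: l2_rel_def square_integrable_mult_const)

instance
proof
  fix a b c :: l2 and r s :: real
  show "a + b + c = a + (b + c)"
    by transfer (auto simp: l2_rel_def square_integrable_add add.assoc)
  show "a + b = b + a"
    by transfer (auto simp: l2_rel_def square_integrable_add add.commute)
  show "0 + a = a"
    by transfer (auto simp: l2_rel_def)
  show "- a + a = 0"
    by transfer (auto simp: l2_rel_def)
  show "a - b = a + - b"
    by (simp add: minus_l2_def)
  show "r *\<^sub>R (a + b) = r *\<^sub>R a + r *\<^sub>R b"
    by transfer (auto simp: l2_rel_def square_integrable_add square_integrable_mult_const
        distrib_left)
  show "(r + s) *\<^sub>R a = r *\<^sub>R a + s *\<^sub>R a"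
    by transfer (auto simp: l2_rel_def square_integrable_add square_integrable_mult_const
        distrib_right)
  show "r *\<^sub>R s *\<^sub>R a = (r * s) *\<^sub>R a"
    by transfer (auto simp: l2_rel_def square_integrable_mult_const mult.assoc)
  show "1 *\<^sub>R a = a"
    by transfer (auto simp: l2_rel_def)
qed

end

lift_definition scaleC :: "complex \<Rightarrow> l2 \<Rightarrow> l2" (infixr "*\<^sub>C" 75) is "\<lambda>c f x. c * f x"
  by (auto simp: l2_rel_def square_integrable_mult_const)

text \<open>The inner product is linear in the first argument.\<close>

lift_definition cinner :: "l2 \<Rightarrow> l2 \<Rightarrow> complex"
  is "\<lambda>f g. integral\<^sup>L lebesgue (\<lambda>x. f x * cnj (g x))"
proof -
  fix f f' g g' :: "real \<Rightarrow> complex"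
  assume f: "l2_rel f f'" and g: "l2_rel g g'"
  have "AE x in lebesgue. f x * cnj (g x) = f' x * cnj (g' x)"
    using f g by (auto simp: l2_rel_def)
  moreover have "integrable lebesgue (\<lambda>x. f x * cnj (g x))"
    "integrable lebesgue (\<lambda>x. f' x * cnj (g' x))"
    using f g by (auto simp: l2_rel_def intro: square_integrable_mult_cnj)
  ultimately show "integral\<^sup>L lebesgue (\<lambda>x. f x * cnj (g x)) =
      integral\<^sup>L lebesgue (\<lambda>x. f' x * cnj (g' x))"
    by (intro integral_cong_AE) auto
qed

text \<open>The real inner product \<^term>\<open>Re (cinner f g)\<close> induces the usual \<open>L\<^sub>2\<close> norm
  and makes the topological and operator-norm notions of the library available.\<close>

instantiation l2 :: real_inner
begin

definition inner_l2 :: "l2 \<Rightarrow> l2 \<Rightarrow> real" where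
  "inner_l2 f g = Re (cinner f g)"

definition norm_l2 :: "l2 \<Rightarrow> real" where
  "norm_l2 f = sqrt (Re (cinner f f))"

definition sgn_l2 :: "l2 \<Rightarrow> l2" where
  "sgn_l2 f = f /\<^sub>R norm f"

definition dist_l2 :: "l2 \<Rightarrow> l2 \<Rightarrow> real" where
  "dist_l2 f g = norm (f - g)"

definition uniformity_l2 :: "(l2 \<times> l2) filter" where
  "uniformity_l2 = (INF e\<in>{0<..}. principal {(f, g). dist f g < e})"

definition open_l2 :: "l2 set \<Rightarrow> bool" where
  "open_l2 U \<longleftrightarrow> (\<forall>f\<in>U. eventually (\<lambda>(f', g). f' = f \<longrightarrow> g \<in> U) uniformity)"

instance
proof
  fix x y z :: l2 and r :: real
  show "dist x y = norm (x - y)" by (rule dist_l2_def)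
  show "sgn x = x /\<^sub>R norm x" by (rule sgn_l2_def)
  show "uniformity = (INF e\<in>{0<..}. principal {(x, y). dist (x::l2) y < e})"
    by (rule uniformity_l2_def)
  show "norm x = sqrt (inner x x)" by (simp add: norm_l2_def inner_l2_def)
  show "open U \<longleftrightarrow> (\<forall>x\<in>U. eventually (\<lambda>(x', y). x' = x \<longrightarrow> y \<in> U) uniformity)"
    for U :: "l2 set"
    by (rule open_l2_def)
  show "inner x y = inner y x"
    unfolding inner_l2_def
  proof transfer
    fix f g :: "real \<Rightarrow> complex"
    have "integral\<^sup>L lebesgue (\<lambda>x. g x * cnj (f x)) =
        integral\<^sup>L lebesgue (\<lambda>x. cnj (f x * cnj (g x)))"
      by (simp add: mult.commute)
    also have "\<dots> = cnj (integral\<^sup>L lebesgue (\<lambda>x. f x * cnj (g x)))"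
      by (rule Bochner_Integration.integral_cnj)
    finally show "Re (integral\<^sup>L lebesgue (\<lambda>x. f x * cnj (g x))) =
        Re (integral\<^sup>L lebesgue (\<lambda>x. g x * cnj (f x)))"
      by simp
  qed
  show "inner (x + y) z = inner x z + inner y z"
    unfolding inner_l2_def
    by transfer
      (simp add: l2_rel_def distrib_right square_integrable_mult_cnj Bochner_Integration.integral_add)
  show "inner (r *\<^sub>R x) y = r * inner x y"
    unfolding inner_l2_def
    by transfer (simp add: mult.assoc)
  have *: "integral\<^sup>L lebesgue (\<lambda>x. f x * cnj (f x)) =
      of_real (integral\<^sup>L lebesgue (\<lambda>x. (cmod (f x))\<^sup>2))" for f :: "real \<Rightarrow> complex"
    by (simp only: complex_norm_square[symmetric] integral_complex_of_real)
  show "0 \<le> inner x x"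
    unfolding inner_l2_def by transfer (simp add: *)
  show "inner x x = 0 \<longleftrightarrow> x = 0"
    unfolding inner_l2_def
    by transfer
      (auto simp: * l2_rel_def square_integrable_def integral_nonneg_eq_0_iff_AE)
qed

end

lemma norm_l2_eq: "norm f = sqrt (integral\<^sup>L lebesgue (\<lambda>x. (cmod (rep_l2 f x))\<^sup>2))"
proof -
  have "cinner f f = integral\<^sup>L lebesgue (\<lambda>x. complex_of_real ((cmod (rep_l2 f x))\<^sup>2))"
    by (simp only: cinner.rep_eq complex_norm_square)
  then show ?thesis
    by (simp only: norm_l2_def integral_complex_of_real Re_complex_of_real)
qed


section \<open>Operators on \<open>L\<^sub>2(\<real>)\<close>\<close>

definition bounded_clinear :: "(l2 \<Rightarrow> l2) \<Rightarrow> bool" where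
  "bounded_clinear T \<longleftrightarrow> bounded_linear T \<and> (\<forall>c f. T (c *\<^sub>C f) = c *\<^sub>C T f)"

definition cadjoint :: "(l2 \<Rightarrow> l2) \<Rightarrow> l2 \<Rightarrow> l2" where
  "cadjoint T = (THE T'. \<forall>f g. cinner (T f) g = cinner f (T' g))"

definition re_op :: "(l2 \<Rightarrow> l2) \<Rightarrow> l2 \<Rightarrow> l2" where
  "re_op T = (\<lambda>f. (1/2) *\<^sub>C (T f + cadjoint T f))"

definition spectrum :: "(l2 \<Rightarrow> l2) \<Rightarrow> complex set" where
  "spectrum T = {z. \<not> (\<exists>R. bounded_clinear R \<and>
     (\<forall>f. R (T f - z *\<^sub>C f) = f) \<and> (\<forall>f. T (R f) - z *\<^sub>C R f = f))}"

definition spectral_radius :: "(l2 \<Rightarrow> l2) \<Rightarrow> real" where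
  "spectral_radius T = (SUP z\<in>spectrum T. cmod z)"

definition numerical_range :: "(l2 \<Rightarrow> l2) \<Rightarrow> complex set" where
  "numerical_range T = {cinner (T f) f | f. norm f = 1}"

definition numerical_radius :: "(l2 \<Rightarrow> l2) \<Rightarrow> real" where
  "numerical_radius T = (SUP z\<in>numerical_range T. cmod z)"

definition ortho :: "l2 set \<Rightarrow> l2 set" where
  "ortho M = {f. \<forall>g\<in>M. cinner f g = 0}"

text \<open>Cosine of the (Friedrichs) angle. The library's supremum of the empty set of reals is
  unspecified, hence the case distinction.\<close>

definition cos_angle :: "l2 set \<Rightarrow> l2 set \<Rightarrow> real" where
  "cos_angle M1 M2 =
     (let M = M1 \<inter> M2;
          A = {cmod (cinner f g) | f g.
                 f \<in> M1 \<inter> ortho M \<and> g \<in> M2 \<inter> ortho M \<and> norm f = 1 \<and> norm g = 1}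
      in if A = {} then 0 else Sup A)"


section \<open>Time and frequency projections\<close>

text \<open>Multiplication by an essentially bounded measurable \<open>g\<close>; the value is unspecified for
  symbols that do not map square-integrable functions to square-integrable functions.\<close>

definition mult_op :: "(real \<Rightarrow> complex) \<Rightarrow> l2 \<Rightarrow> l2" where
  "mult_op g f = abs_l2 (\<lambda>x. g x * rep_l2 f x)"

definition fourier_integral :: "(real \<Rightarrow> complex) \<Rightarrow> real \<Rightarrow> complex" where
  "fourier_integral f \<xi> =
     complex_of_real (1 / sqrt (2 * pi)) *
       integral\<^sup>L lebesgue (\<lambda>x. f x * exp (- \<i> * complex_of_real (x * \<xi>)))"

text \<open>The Fourier transform on \<open>L\<^sub>2\<close> is the unique bounded operator given by the Fourier integral
  on \<open>L\<^sub>1 \<inter> L\<^sub>2\<close>; with the above normalisation it is unitary (Plancherel).\<close>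

definition fourier :: "l2 \<Rightarrow> l2" where
  "fourier = (THE F. bounded_clinear F \<and>
     (\<forall>f. integrable lebesgue (rep_l2 f) \<longrightarrow>
        (AE \<xi> in lebesgue. rep_l2 (F f) \<xi> = fourier_integral (rep_l2 f) \<xi>)))"

definition time_proj :: "real set \<Rightarrow> l2 \<Rightarrow> l2" where
  "time_proj S = mult_op (indicator S)"

definition freq_proj :: "real set \<Rightarrow> l2 \<Rightarrow> l2" where
  "freq_proj \<Sigma> = cadjoint fourier \<circ> mult_op (indicator \<Sigma>) \<circ> fourier"

definition strong_annihilating_pair :: "real set \<Rightarrow> real set \<Rightarrow> bool" where
  "strong_annihilating_pair S \<Sigma> \<longleftrightarrow>
     (\<exists>c>0. \<forall>f. (norm f)\<^sup>2 \<le>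
        c * ((norm (f - time_proj S f))\<^sup>2 + (norm (f - freq_proj \<Sigma> f))\<^sup>2))"

text \<open>``The following assertions are equivalent''.\<close>

definition all_equivalent :: "bool list \<Rightarrow> bool" where
  "all_equivalent Ps \<longleftrightarrow> (\<forall>P\<in>set Ps. \<forall>Q\<in>set Ps. P \<longleftrightarrow> Q)"

end

theory Submission
  imports Defs "HOL-Probability.Levy"
begin

text \<open>The time projection \<open>P\<close> and the frequency projection \<open>Q\<close> enter only as two orthogonal projections
  on a complete complex Hilbert space. Each assertion is shown to be equivalent to \<open>\<parallel>P Q\<parallel> < 1\<close>.

  If \<open>\<parallel>P Q\<parallel> = 1\<close>, there are unit vectors that both projections almost fix (\<open>almost_fixed\<close>). On such
  vectors \<open>\<langle>P Q x, x\<rangle>\<close> is close to \<open>1\<close> and \<open>P Q x - x\<close> is close to \<open>0\<close>. This contradicts the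
  annihilation inequality and each of the conditions on the spectrum, the numerical range, and the
  real parts of the rotated operators. The condition on the angle of the ranges is a reformulation of
  the bound on the norm.

  If \<open>c = \<parallel>P Q\<parallel> < 1\<close>, the conditions on spectrum and numerical range follow from norm bounds; the
  resolvent comes from Banach's fixed point theorem. The rotated real parts and the sector both rest
  on the sharper fact that the numerical range lies in the sector \<open>\<bar>Im w\<bar> \<le> k (1 - Re w)\<close> with
  \<open>k = c / \<surd>(4 - c\<^sup>2) < 1 / \<surd>3 = tan (\<pi>/6)\<close> (\<open>numerical_range_sector\<close>). Writing
  \<open>\<langle>Q x, P x\<rangle> = \<parallel>P x\<parallel> \<parallel>Q x\<parallel> z\<close> with \<open>\<bar>z\<bar> \<le> c\<close>, it is a consequence of Cauchy--Schwarz for the parts of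
  \<open>P x\<close> and \<open>Q x\<close> orthogonal to \<open>x\<close>.

  The implication from the sector to the norm is the subtle one, because \<open>1\<close> may lie in the closure of
  the numerical range without being attained. For \<open>y\<close> in the range of \<open>Q\<close> let
  \<open>b = \<parallel>y\<parallel>\<^sup>2 - \<parallel>P y\<parallel>\<^sup>2\<close> and \<open>a = \<parallel>P y\<parallel>\<^sup>2 - \<parallel>Q P y\<parallel>\<^sup>2\<close>. Testing the sector on
  \<open>y + exp (\<i>\<pi>/3) (1 - Q) P y\<close> yields \<open>a \<le> \<rho> b\<close> with \<open>\<rho> < 1\<close>, precisely because the half-angle is
  smaller than \<open>\<pi>/6\<close> (\<open>sector_defect\<close>). Alternating projections then lose length at a geometric rate
  and converge to a common fixed vector, which is zero. Hence \<open>\<parallel>y\<parallel>\<^sup>2\<close> is the sum of all losses and is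
  bounded by a multiple of the first one, \<open>b\<close> (\<open>norm_le_defect\<close>); this is a bound \<open>\<parallel>P y\<parallel> \<le> q \<parallel>y\<parallel>\<close> with
  \<open>q < 1\<close>.

  That the frequency projection is an orthogonal projection is Plancherel's theorem. The space is
  complete (Riesz--Fischer), and step functions are dense in it (\<open>l2_induct\<close>). On indicators of
  intervals the isometry is Levy's inversion formula for uniform distributions (\<open>ft_Ioc_inner\<close>). By
  Fubini, the adjoint of the Fourier integral is its reflection; duality against step functions makes
  the Fourier integral a contraction on \<open>L\<^sub>1 \<inter> L\<^sub>2\<close>, and density extends it to \<open>L\<^sub>2\<close>. The reflection
  commutes with the transform, so the isometric transform is unitary.\<close>

section \<open>Hilbert space calculus\<close>

lemma cinner_add_left: "cinner (f + g) h = cinner f h + cinner g h"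
  by transfer (simp add: l2_rel_def distrib_right square_integrable_mult_cnj
      Bochner_Integration.integral_add)

lemma cinner_scaleC_left: "cinner (c *\<^sub>C f) g = c * cinner f g"
  by transfer (simp add: mult.assoc)

lemma cinner_commute: "cinner f g = cnj (cinner g f)"
proof transfer
  fix f g :: "real \<Rightarrow> complex"
  have "integral\<^sup>L lebesgue (\<lambda>x. f x * cnj (g x)) =
      integral\<^sup>L lebesgue (\<lambda>x. cnj (g x * cnj (f x)))"
    by (simp add: mult.commute)
  also have "\<dots> = cnj (integral\<^sup>L lebesgue (\<lambda>x. g x * cnj (f x)))"
    by (rule Bochner_Integration.integral_cnj)
  finally show "integral\<^sup>L lebesgue (\<lambda>x. f x * cnj (g x)) =
      cnj (integral\<^sup>L lebesgue (\<lambda>x. g x * cnj (f x)))" .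
qed

lemma scaleC_add_right: "c *\<^sub>C (f + g) = c *\<^sub>C f + c *\<^sub>C g"
  by transfer (auto simp: l2_rel_def square_integrable_add square_integrable_mult_const
      distrib_left)

lemma scaleC_scaleC [simp]: "c *\<^sub>C d *\<^sub>C f = (c * d) *\<^sub>C f"
  by transfer (auto simp: l2_rel_def square_integrable_mult_const mult.assoc)

lemma scaleC_of_real: "complex_of_real r *\<^sub>C f = r *\<^sub>R f"
  by transfer (auto simp: l2_rel_def square_integrable_mult_const)

lemma scaleC_one [simp]: "1 *\<^sub>C f = f"
  using scaleC_of_real[of 1 f] by simp

lemma scaleC_zero_left [simp]: "0 *\<^sub>C f = 0"
  using scaleC_of_real[of 0 f] by simp

lemma scaleC_minus_one: "(-1) *\<^sub>C f = - f"
  using scaleC_of_real[of "-1" f] by simp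

lemma scaleC_zero_right [simp]: "c *\<^sub>C 0 = 0"
  using scaleC_add_right[of c 0 0] by simp

lemma scaleC_minus_right: "c *\<^sub>C (- f) = - (c *\<^sub>C f)"
  using scaleC_add_right[of c f "- f"] by (simp add: eq_neg_iff_add_eq_0 add.commute)

lemma scaleC_diff_right: "c *\<^sub>C (f - g) = c *\<^sub>C f - c *\<^sub>C g"
  using scaleC_add_right[of c f "- g"] by (simp add: scaleC_minus_right)

lemma cinner_add_right: "cinner h (f + g) = cinner h f + cinner h g"
  by (subst (1 2 3) cinner_commute) (simp add: cinner_add_left)

lemma cinner_scaleC_right: "cinner f (c *\<^sub>C g) = cnj c * cinner f g"
  by (subst (1 2) cinner_commute) (simp add: cinner_scaleC_left)

lemma cinner_minus_left: "cinner (- f) g = - cinner f g"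
  using cinner_scaleC_left[of "-1" f g] by (simp add: scaleC_minus_one)

lemma cinner_minus_right: "cinner f (- g) = - cinner f g"
  using cinner_scaleC_right[of f "-1" g] by (simp add: scaleC_minus_one)

lemma cinner_diff_left: "cinner (f - g) h = cinner f h - cinner g h"
  using cinner_add_left[of f "- g" h] by (simp add: cinner_minus_left)

lemma cinner_diff_right: "cinner h (f - g) = cinner h f - cinner h g"
  using cinner_add_right[of h f "- g"] by (simp add: cinner_minus_right)

lemma cinner_scaleR_left: "cinner (r *\<^sub>R f) g = of_real r * cinner f g"
  by (simp add: cinner_scaleC_left flip: scaleC_of_real)

lemma cinner_scaleR_right: "cinner f (r *\<^sub>R g) = of_real r * cinner f g"
  by (simp add: cinner_scaleC_right flip: scaleC_of_real)

lemma cinner_zero_left [simp]: "cinner 0 g = 0"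
  using cinner_scaleC_left[of 0 0 g] by simp

lemma cinner_zero_right [simp]: "cinner f 0 = 0"
  using cinner_scaleC_right[of f 0 0] by simp

lemmas cinner_simps = cinner_add_left cinner_add_right cinner_diff_left cinner_diff_right
  cinner_scaleC_left cinner_scaleC_right

lemma cinner_self: "cinner f f = complex_of_real ((norm f)\<^sup>2)"
proof -
  have "Im (cinner f f) = 0"
    using cinner_commute[of f f] by (metis cnj.sel(2) equal_neg_zero)
  moreover have "Re (cinner f f) = (norm f)\<^sup>2"
    by (simp add: power2_norm_eq_inner inner_l2_def)
  ultimately show ?thesis
    by (simp add: complex_eq_iff)
qed

lemma Re_cinner: "Re (cinner f g) = inner f g"
  by (simp add: inner_l2_def)

lemma norm_scaleC [simp]: "norm (c *\<^sub>C f) = cmod c * norm f"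
proof -
  have "complex_of_real ((norm (c *\<^sub>C f))\<^sup>2) = complex_of_real ((cmod c * norm f)\<^sup>2)"
    unfolding cinner_self[symmetric] cinner_scaleC_left cinner_scaleC_right
    by (simp add: cinner_self power_mult_distrib complex_norm_square del: of_real_power)
  then show ?thesis
    by (metis norm_ge_zero mult_nonneg_nonneg of_real_eq_iff power2_eq_iff_nonneg)
qed

lemma norm_add_sq: "(norm (f + g :: l2))\<^sup>2 = (norm f)\<^sup>2 + 2 * Re (cinner f g) + (norm g)\<^sup>2"
  by (simp add: power2_norm_eq_inner Re_cinner inner_simps inner_commute)

lemma norm_diff_sq: "(norm (f - g :: l2))\<^sup>2 = (norm f)\<^sup>2 - 2 * Re (cinner f g) + (norm g)\<^sup>2"
  by (simp add: power2_norm_eq_inner Re_cinner inner_simps inner_commute)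

text \<open>Rotating \<open>f\<close> by a phase makes the complex inner product real, which reduces the
  inequality to the one for the real inner product.\<close>

lemma cinner_Cauchy_Schwarz: "cmod (cinner f g) \<le> norm f * norm g"
proof (cases "cinner f g = 0")
  case False
  define u where "u = cnj (cinner f g) / of_real (cmod (cinner f g))"
  have u: "cmod u = 1"
    using False by (simp add: u_def norm_divide)
  have "u * cinner f g = complex_of_real ((cmod (cinner f g))\<^sup>2) / of_real (cmod (cinner f g))"
    unfolding complex_norm_square u_def by (simp add: mult.commute)
  also have "\<dots> = of_real (cmod (cinner f g))"
    by (simp add: power2_eq_square)
  finally have "u * cinner f g = of_real (cmod (cinner f g))" .
  then have "cmod (cinner f g) = inner (u *\<^sub>C f) g"
    by (metis Re_cinner Re_complex_of_real cinner_scaleC_left)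
  also have "\<dots> \<le> norm (u *\<^sub>C f) * norm g"
    by (rule norm_cauchy_schwarz)
  finally show ?thesis
    by (simp add: u)
qed simp

lemma cinner_nondegenerate:
  assumes "\<And>g. cinner g f = cinner g h"
  shows "f = h"
proof -
  have "cinner (f - h) (f - h) = 0"
    using assms by (simp add: cinner_diff_right)
  then show ?thesis
    by (simp add: cinner_self)
qed

lemma bounded_clinear_linear: "bounded_clinear T \<Longrightarrow> bounded_linear T"
  by (simp add: bounded_clinear_def)

lemma bounded_clinear_scaleC: "bounded_clinear T \<Longrightarrow> T (c *\<^sub>C f) = c *\<^sub>C T f"
  by (simp add: bounded_clinear_def)

lemma bounded_clinearI:
  assumes "\<And>f g. T (f + g) = T f + T g" "\<And>c f. T (c *\<^sub>C f) = c *\<^sub>C T f"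
    "\<And>f. norm (T f) \<le> K * norm f"
  shows "bounded_clinear T"
  unfolding bounded_clinear_def
proof (intro conjI allI)
  show "bounded_linear T"
    by (rule bounded_linear_intro[where K = K])
      (auto simp: assms(1,2) mult.commute simp flip: scaleC_of_real intro: assms(3)[THEN order_trans])
qed (rule assms)

lemma bounded_clinear_compose:
  assumes "bounded_clinear T" "bounded_clinear U"
  shows "bounded_clinear (T \<circ> U)"
  using assms bounded_linear_compose[of T U] by (auto simp: bounded_clinear_def o_def)

lemma bounded_clinear_cscale: "bounded_clinear (\<lambda>f. c *\<^sub>C f)"
  by (rule bounded_clinearI[where K = "cmod c"]) (auto simp: scaleC_add_right mult.commute)

lemma bounded_linear_cinner_left: "bounded_linear (\<lambda>f. cinner f g)"
  by (rule bounded_linear_intro[where K = "norm g"])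
    (auto simp: cinner_add_left cinner_Cauchy_Schwarz cinner_scaleR_left scaleR_conv_of_real)

lemma bounded_linear_cinner_right: "bounded_linear (\<lambda>f. cinner g f)"
  by (rule bounded_linear_intro[where K = "norm g"])
    (auto simp: cinner_add_right cinner_Cauchy_Schwarz cinner_scaleR_right scaleR_conv_of_real
      mult.commute[of _ "norm g"])

lemmas tendsto_cinner_left = bounded_linear.tendsto[OF bounded_linear_cinner_left]
lemmas tendsto_cinner_right = bounded_linear.tendsto[OF bounded_linear_cinner_right]

lemma cadjoint_eqI:
  assumes "\<And>f g. cinner (T f) g = cinner f (T' g)"
  shows "cadjoint T = T'"
  unfolding cadjoint_def
proof (rule the_equality)
  show "\<forall>f g. cinner (T f) g = cinner f (T' g)"
    using assms by blast
  fix U assume "\<forall>f g. cinner (T f) g = cinner f (U g)"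
  then show "U = T'"
    using assms by (intro ext cinner_nondegenerate) metis
qed

section \<open>Representatives and completeness\<close>

lemma l2_rel_rep: "l2_rel (rep_l2 f) (rep_l2 f)"
  by (rule Quotient3_rep_reflp[OF Quotient3_l2])

lemma square_integrable_rep: "square_integrable (rep_l2 f)"
  using l2_rel_rep[of f] by (simp add: l2_rel_def)

lemma measurable_rep [measurable]: "rep_l2 f \<in> borel_measurable lebesgue"
  using square_integrable_rep[of f] by (simp add: square_integrable_def)

lemma rep_abs:
  assumes "square_integrable f"
  shows "AE x in lebesgue. rep_l2 (abs_l2 f) x = f x"
proof -
  have "l2_rel f f" using assms by (simp add: l2_rel_def)
  then have "l2_rel (rep_l2 (abs_l2 f)) f"
    by (rule rep_abs_rsp_left[OF Quotient3_l2])
  then show ?thesis by (simp add: l2_rel_def)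
qed

lemma abs_rep [simp]: "abs_l2 (rep_l2 f) = f"
  by (rule Quotient3_abs_rep[OF Quotient3_l2])

lemma abs_l2_eqI:
  assumes "square_integrable f" "square_integrable g" "AE x in lebesgue. f x = g x"
  shows "abs_l2 f = abs_l2 g"
  by (rule Quotient3_rel_abs[OF Quotient3_l2]) (use assms in \<open>simp add: l2_rel_def\<close>)

lemma l2_eqI:
  assumes "AE x in lebesgue. rep_l2 f x = rep_l2 g x"
  shows "f = g"
  using abs_l2_eqI[OF square_integrable_rep square_integrable_rep assms] by simp

lemma abs_l2_add:
  assumes "square_integrable f" "square_integrable g"
  shows "abs_l2 f + abs_l2 g = abs_l2 (\<lambda>x. f x + g x)"
  using assms by (simp add: plus_l2.abs_eq l2_rel_def)

lemma abs_l2_scaleC: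
  assumes "square_integrable f"
  shows "c *\<^sub>C abs_l2 f = abs_l2 (\<lambda>x. c * f x)"
  using assms by (simp add: scaleC.abs_eq l2_rel_def)

lemma cinner_abs:
  assumes "square_integrable f" "square_integrable g"
  shows "cinner (abs_l2 f) (abs_l2 g) = integral\<^sup>L lebesgue (\<lambda>x. f x * cnj (g x))"
  using assms by (simp add: cinner.abs_eq l2_rel_def)

lemma norm_abs:
  assumes "square_integrable f"
  shows "(norm (abs_l2 f))\<^sup>2 = integral\<^sup>L lebesgue (\<lambda>x. (cmod (f x))\<^sup>2)"
proof -
  have "complex_of_real ((norm (abs_l2 f))\<^sup>2)
      = integral\<^sup>L lebesgue (\<lambda>x. complex_of_real ((cmod (f x))\<^sup>2))"
    unfolding cinner_self[symmetric] cinner_abs[OF assms assms] by (simp only: complex_norm_square)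
  then show ?thesis
    by (metis integral_complex_of_real of_real_eq_iff)
qed

lemma norm_rep: "(norm f)\<^sup>2 = integral\<^sup>L lebesgue (\<lambda>x. (cmod (rep_l2 f x))\<^sup>2)"
  using norm_abs[OF square_integrable_rep[of f]] by simp

lemma cinner_rep: "cinner f g = integral\<^sup>L lebesgue (\<lambda>x. rep_l2 f x * cnj (rep_l2 g x))"
  by (rule cinner.rep_eq)

lemma rep_add: "AE x in lebesgue. rep_l2 (f + g) x = rep_l2 f x + rep_l2 g x"
  using rep_abs[OF square_integrable_add[OF square_integrable_rep square_integrable_rep], of f g]
  by (simp flip: abs_l2_add[OF square_integrable_rep square_integrable_rep])

lemma rep_scaleC: "AE x in lebesgue. rep_l2 (c *\<^sub>C f) x = c * rep_l2 f x"
  using rep_abs[OF square_integrable_mult_const[OF square_integrable_rep], of c f]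
  by (simp flip: abs_l2_scaleC[OF square_integrable_rep])

lemma rep_diff: "AE x in lebesgue. rep_l2 (f - g) x = rep_l2 f x - rep_l2 g x"
  using rep_add[of f "(-1) *\<^sub>C g"] rep_scaleC[of "-1" g]
  by eventually_elim (simp add: scaleC_minus_one)

lemma integrable_cmod_rep: "integrable lebesgue (\<lambda>x. (cmod (rep_l2 f x))\<^sup>2)"
  using square_integrable_rep[of f] by (simp add: square_integrable_def)

lemma nn_integral_rep: "(\<integral>\<^sup>+x. ennreal ((cmod (rep_l2 f x))\<^sup>2) \<partial>lebesgue) = ennreal ((norm f)\<^sup>2)"
  by (subst nn_integral_eq_integral[OF integrable_cmod_rep]) (auto simp: norm_rep)

text \<open>Fatou's lemma: norm bounds survive pointwise limits.\<close>

lemma square_integrable_limit: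
  fixes u :: "nat \<Rightarrow> l2"
  assumes meas: "f \<in> borel_measurable lebesgue"
    and lim: "AE x in lebesgue. (\<lambda>n. rep_l2 (u n) x) \<longlonglongrightarrow> f x"
    and bound: "eventually (\<lambda>n. norm (u n) \<le> K) sequentially"
  shows "square_integrable f \<and> norm (abs_l2 f) \<le> K"
proof -
  note [measurable] = meas
  have "0 \<le> K"
    using eventually_happens'[OF _ bound] norm_ge_zero order_trans by (metis sequentially_bot)
  have "(\<integral>\<^sup>+x. ennreal ((cmod (f x))\<^sup>2) \<partial>lebesgue)
      = (\<integral>\<^sup>+x. liminf (\<lambda>n. ennreal ((cmod (rep_l2 (u n) x))\<^sup>2)) \<partial>lebesgue)"
  proof (rule nn_integral_cong_AE)
    show "AE x in lebesgue. ennreal ((cmod (f x))\<^sup>2)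
        = liminf (\<lambda>n. ennreal ((cmod (rep_l2 (u n) x))\<^sup>2))"
      using lim
    proof eventually_elim
      case (elim x)
      then have "(\<lambda>n. ennreal ((cmod (rep_l2 (u n) x))\<^sup>2)) \<longlonglongrightarrow> ennreal ((cmod (f x))\<^sup>2)"
        by (intro tendsto_ennrealI tendsto_intros)
      then show ?case
        by (rule lim_imp_Liminf[OF trivial_limit_sequentially, symmetric])
    qed
  qed
  also have "\<dots> \<le> liminf (\<lambda>n. \<integral>\<^sup>+x. ennreal ((cmod (rep_l2 (u n) x))\<^sup>2) \<partial>lebesgue)"
    by (rule nn_integral_liminf) simp
  also have "\<dots> = liminf (\<lambda>n. ennreal ((norm (u n))\<^sup>2))"
    by (simp add: nn_integral_rep)
  also have "\<dots> \<le> ennreal (K\<^sup>2)"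
  proof -
    have "liminf (\<lambda>n. ennreal ((norm (u n))\<^sup>2)) \<le> liminf (\<lambda>n. ennreal (K\<^sup>2))"
      by (rule Liminf_mono) (use bound in \<open>eventually_elim, auto intro!: ennreal_leI power_mono\<close>)
    then show ?thesis
      by (simp add: Liminf_const)
  qed
  finally have le: "(\<integral>\<^sup>+x. ennreal ((cmod (f x))\<^sup>2) \<partial>lebesgue) \<le> ennreal (K\<^sup>2)" .
  have "integrable lebesgue (\<lambda>x. (cmod (f x))\<^sup>2)"
    by (rule integrableI_nonneg) (auto intro: le_less_trans[OF le])
  then have sq: "square_integrable f"
    by (simp add: square_integrable_def)
  have "ennreal ((norm (abs_l2 f))\<^sup>2) \<le> ennreal (K\<^sup>2)"
    using le unfolding norm_abs[OF sq]
    by (subst (asm) nn_integral_eq_integral) (use sq in \<open>auto simp: square_integrable_def\<close>)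
  then have "(norm (abs_l2 f))\<^sup>2 \<le> K\<^sup>2"
    by simp
  with sq \<open>0 \<le> K\<close> show ?thesis
    by (simp add: power2_le_iff_abs_le)
qed

lemma integrable_inverse_one_plus_square: "integrable lebesgue (\<lambda>x::real. inverse (1 + x\<^sup>2))"
proof -
  have "integrable lborel (\<lambda>x::real. inverse (1 + x\<^sup>2))"
    using integrable_inverse_1_plus_square by (simp add: set_integrable_def einterval_def)
  then show ?thesis
    by (intro integrable_completion[THEN iffD2]) auto
qed

text \<open>The weight \<open>1 / (1 + x\<^sup>2)\<close> turns \<open>L\<^sub>2\<close> bounds into \<open>L\<^sub>1\<close> bounds over the whole line, so an
  absolutely convergent series in \<open>L\<^sub>2\<close> converges absolutely almost everywhere.\<close>

lemma AE_summable_rep: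
  fixes u :: "nat \<Rightarrow> l2"
  assumes "summable (\<lambda>n. norm (u n))"
  shows "AE x in lebesgue. summable (\<lambda>n. rep_l2 (u n) x)"
proof -
  define w where "w = (\<lambda>x::real. inverse (1 + x\<^sup>2))"
  have [measurable]: "w \<in> borel_measurable lebesgue"
    unfolding w_def by (rule measurable_completion) measurable
  have wpos: "0 < w x" and wle: "w x \<le> 1" for x
    unfolding w_def by (auto simp: add_pos_nonneg inverse_le_1_iff)
  have wsq: "square_integrable (\<lambda>x. complex_of_real (w x))"
    unfolding square_integrable_def
  proof
    show "integrable lebesgue (\<lambda>x. (cmod (complex_of_real (w x)))\<^sup>2)"
    proof (rule Bochner_Integration.integrable_bound[OF integrable_inverse_one_plus_square])
      show "AE x in lebesgue. norm ((cmod (complex_of_real (w x)))\<^sup>2) \<le> norm (inverse (1 + x\<^sup>2))"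
      proof (rule AE_I2)
        fix x
        have "(w x)\<^sup>2 \<le> w x"
          using wpos[of x] wle[of x] by (simp add: power2_eq_square mult_left_le)
        then have "norm ((cmod (complex_of_real (w x)))\<^sup>2) \<le> w x"
          by simp
        also have "\<dots> \<le> norm (inverse (1 + x\<^sup>2))"
          unfolding w_def real_norm_def by (rule abs_ge_self)
        finally show "norm ((cmod (complex_of_real (w x)))\<^sup>2) \<le> norm (inverse (1 + x\<^sup>2))" .
      qed
    qed measurable
  qed measurable
  have csq: "square_integrable (\<lambda>x. complex_of_real (cmod (rep_l2 f x)))" for f
    using square_integrable_rep[of f] by (simp add: square_integrable_def)
  let ?W = "abs_l2 (\<lambda>x. complex_of_real (w x))"
  have bd: "(\<integral>\<^sup>+x. ennreal (w x * cmod (rep_l2 f x)) \<partial>lebesgue) \<le> ennreal (norm ?W * norm f)" for f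
  proof -
    let ?g = "abs_l2 (\<lambda>x. complex_of_real (cmod (rep_l2 f x)))"
    have "norm ?g = norm f"
    proof -
      have "(norm ?g)\<^sup>2 = (norm f)\<^sup>2"
        unfolding norm_abs[OF csq] norm_rep[of f] by simp
      then show ?thesis by simp
    qed
    have int: "integrable lebesgue (\<lambda>x. complex_of_real (w x * cmod (rep_l2 f x)))"
      using square_integrable_mult_cnj[OF wsq csq[of f]] by simp
    have "cinner ?W ?g = integral\<^sup>L lebesgue (\<lambda>x. complex_of_real (w x * cmod (rep_l2 f x)))"
      unfolding cinner_abs[OF wsq csq] by simp
    then have "integral\<^sup>L lebesgue (\<lambda>x. w x * cmod (rep_l2 f x)) = Re (cinner ?W ?g)"
      by (simp only: integral_complex_of_real Re_complex_of_real)
    also have "\<dots> \<le> norm ?W * norm f"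
      using cinner_Cauchy_Schwarz[of ?W ?g] \<open>norm ?g = norm f\<close> complex_Re_le_cmod order_trans by metis
    finally have *: "integral\<^sup>L lebesgue (\<lambda>x. w x * cmod (rep_l2 f x)) \<le> norm ?W * norm f" .
    have "integrable lebesgue (\<lambda>x. w x * cmod (rep_l2 f x))"
      using int by (simp only: complex_of_real_integrable_eq)
    then have "(\<integral>\<^sup>+x. ennreal (w x * cmod (rep_l2 f x)) \<partial>lebesgue)
        = ennreal (integral\<^sup>L lebesgue (\<lambda>x. w x * cmod (rep_l2 f x)))"
      by (rule nn_integral_eq_integral) (use wpos in \<open>auto simp: less_imp_le\<close>)
    then show ?thesis
      using * by (simp add: ennreal_leI)
  qed
  have "(\<integral>\<^sup>+x. (\<Sum>n. ennreal (w x * cmod (rep_l2 (u n) x))) \<partial>lebesgue)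
      = (\<Sum>n. \<integral>\<^sup>+x. ennreal (w x * cmod (rep_l2 (u n) x)) \<partial>lebesgue)"
    by (rule nn_integral_suminf) measurable
  also have "\<dots> \<le> (\<Sum>n. ennreal (norm ?W * norm (u n)))"
    by (intro suminf_le bd) auto
  also have "\<dots> = ennreal (\<Sum>n. norm ?W * norm (u n))"
    by (rule suminf_ennreal2) (auto intro: summable_mult assms)
  also have "\<dots> < \<infinity>" by simp
  finally have "AE x in lebesgue. (\<Sum>n. ennreal (w x * cmod (rep_l2 (u n) x))) \<noteq> \<infinity>"
    by (intro nn_integral_noteq_infinite) auto
  then show ?thesis
  proof eventually_elim
    case (elim x)
    have "summable (\<lambda>n. w x * cmod (rep_l2 (u n) x))"
      by (rule summable_suminf_not_top) (use elim wpos[of x] in auto)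
    then have "summable (\<lambda>n. inverse (w x) * (w x * cmod (rep_l2 (u n) x)))"
      by (rule summable_mult)
    then have "summable (\<lambda>n. cmod (rep_l2 (u n) x))"
      using wpos[of x] by (simp add: mult.assoc[symmetric])
    then show ?case
      by (rule summable_norm_cancel)
  qed
qed

lemma Cauchy_fast_subseq:
  fixes X :: "nat \<Rightarrow> 'a::metric_space"
  assumes "Cauchy X"
  obtains r where "strict_mono r" "\<And>m n. m \<le> n \<Longrightarrow> dist (X (r m)) (X (r n)) < (1/2) ^ m"
proof -
  have "\<exists>M. \<forall>i\<ge>M. \<forall>j\<ge>M. dist (X i) (X j) < (1/2) ^ n" for n :: nat
    using metric_CauchyD[OF assms, of "(1/2) ^ n"] by auto
  then obtain M where M: "\<And>n i j. i \<ge> M n \<Longrightarrow> j \<ge> M n \<Longrightarrow> dist (X i) (X j) < (1/2) ^ n"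
    by metis
  define r where "r n = (\<Sum>k\<le>n. M k) + n" for n
  have r: "M n \<le> r n" for n
    unfolding r_def by (intro trans_le_add1 member_le_sum) auto
  have sm: "strict_mono r"
    unfolding strict_mono_Suc_iff r_def by simp
  show thesis
  proof (rule that[OF sm])
    fix m n :: nat assume "m \<le> n"
    then have "r m \<le> r n"
      using sm by (simp add: strict_mono_less_eq)
    then show "dist (X (r m)) (X (r n)) < (1/2) ^ m"
      using r[of m] by (intro M) auto
  qed
qed

text \<open>Riesz--Fischer: a rapidly Cauchy subsequence converges almost everywhere, and the almost
  everywhere limit is the \<open>L\<^sub>2\<close> limit by Fatou's lemma.\<close>

instance l2 :: banach
proof
  fix X :: "nat \<Rightarrow> l2" assume "Cauchy X"
  then obtain r where r: "strict_mono r"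
    and fast: "\<And>m n. m \<le> n \<Longrightarrow> dist (X (r m)) (X (r n)) < (1/2) ^ m"
    by (rule Cauchy_fast_subseq) blast
  define Y where "Y n = X (r n)" for n
  have fast': "norm (Y n - Y m) \<le> (1/2) ^ m" if "m \<le> n" for m n
    using fast[OF that] by (simp add: Y_def dist_norm norm_minus_commute)
  have "summable (\<lambda>n. norm (Y (Suc n) - Y n))"
  proof (rule summable_comparison_test')
    show "summable (\<lambda>n. (1/2::real) ^ n)" by (simp add: summable_geometric)
  qed (use fast' in auto)
  then have "AE x in lebesgue. summable (\<lambda>n. rep_l2 (Y (Suc n) - Y n) x)"
    by (rule AE_summable_rep)
  moreover have "AE x in lebesgue. \<forall>n. rep_l2 (Y (Suc n) - Y n) x = rep_l2 (Y (Suc n)) x - rep_l2 (Y n) x"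
    unfolding AE_all_countable using rep_diff by blast
  ultimately have conv: "AE x in lebesgue. (\<lambda>n. rep_l2 (Y n) x) \<longlonglongrightarrow> lim (\<lambda>n. rep_l2 (Y n) x)"
  proof eventually_elim
    case (elim x)
    then have "summable (\<lambda>n. rep_l2 (Y (Suc n)) x - rep_l2 (Y n) x)"
      by simp
    then have "convergent (\<lambda>n. \<Sum>k<n. rep_l2 (Y (Suc k)) x - rep_l2 (Y k) x)"
      by (simp add: summable_iff_convergent)
    then have "convergent (\<lambda>n. rep_l2 (Y n) x - rep_l2 (Y 0) x)"
      by (simp only: sum_lessThan_telescope[of "\<lambda>k. rep_l2 (Y k) x"])
    then have "convergent (\<lambda>n. rep_l2 (Y n) x)"
      by (simp add: convergent_diff_const_right_iff)
    then show ?case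
      by (simp add: convergent_LIMSEQ_iff)
  qed
  define f where "f = (\<lambda>x. lim (\<lambda>n. rep_l2 (Y n) x))"
  have fm [measurable]: "f \<in> borel_measurable lebesgue"
    unfolding f_def by measurable
  have close: "square_integrable (\<lambda>x. f x - rep_l2 (Y m) x) \<and>
      norm (abs_l2 (\<lambda>x. f x - rep_l2 (Y m) x)) \<le> (1/2) ^ m" for m
  proof (rule square_integrable_limit[where u = "\<lambda>n. Y n - Y m"])
    have "AE x in lebesgue. \<forall>n. rep_l2 (Y n - Y m) x = rep_l2 (Y n) x - rep_l2 (Y m) x"
      unfolding AE_all_countable using rep_diff by blast
    with conv show "AE x in lebesgue. (\<lambda>n. rep_l2 (Y n - Y m) x) \<longlonglongrightarrow> f x - rep_l2 (Y m) x"
      by eventually_elim (auto simp: f_def intro: tendsto_diff)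
    show "\<forall>\<^sub>F n in sequentially. norm (Y n - Y m) \<le> (1/2) ^ m"
      using fast' by (auto simp: eventually_sequentially)
  qed measurable
  have "square_integrable (\<lambda>x. (f x - rep_l2 (Y 0) x) + rep_l2 (Y 0) x)"
    using close square_integrable_rep by (intro square_integrable_add) auto
  then have fsq: "square_integrable f" by simp
  define g where "g = abs_l2 f"
  have "norm (Y m - g) \<le> (1/2) ^ m" for m
  proof -
    have "g = abs_l2 (\<lambda>x. f x - rep_l2 (Y m) x) + abs_l2 (rep_l2 (Y m))"
      unfolding g_def by (subst abs_l2_add) (use close square_integrable_rep in auto)
    then have "norm (g - Y m) \<le> (1/2) ^ m"
      using close[of m] by simp
    then show ?thesis by (simp add: norm_minus_commute)
  qed
  then have "(\<lambda>m. Y m - g) \<longlonglongrightarrow> 0"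
    by (intro Lim_null_comparison[OF always_eventually LIMSEQ_realpow_zero[of "1/2"]]) auto
  then have "(X \<circ> r) \<longlonglongrightarrow> g"
    unfolding Y_def o_def by (rule LIM_zero_cancel)
  with \<open>Cauchy X\<close> r have "X \<longlonglongrightarrow> g"
    by (rule Cauchy_converges_subseq)
  then show "convergent X"
    by (rule convergentI)
qed

section \<open>Spectrum, numerical range and orthogonal projections\<close>

text \<open>Since \<open>L\<^sub>2(\<real>)\<close> is not trivial, the suprema that define the numerical radius range over
  nonempty sets.\<close>

lemma exists_unit: "\<exists>e::l2. norm e = 1"
proof -
  let ?f = "\<lambda>x::real. indicator {0..1} x :: complex"
  have int: "integrable lebesgue (\<lambda>x::real. indicator {0..1} x :: real)"
    by (intro integrable_completion[THEN iffD2] integrable_real_indicator) auto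
  have eq: "(cmod (?f x))\<^sup>2 = indicator {0..1} x" for x
    by (simp add: indicator_def)
  have "?f \<in> borel_measurable lebesgue"
    by (rule measurable_completion) simp
  then have "square_integrable ?f"
    unfolding square_integrable_def eq using int by simp
  then have "(norm (abs_l2 ?f))\<^sup>2 = 1"
    using norm_abs[of ?f] by (simp add: eq)
  then show ?thesis
    by (metis norm_ge_zero power2_eq_1_iff zero_le_one le_minus_one_simps(3))
qed

lemma numerical_range_nonempty: "numerical_range T \<noteq> {}"
  using exists_unit by (auto simp: numerical_range_def)

lemma numerical_radius_le:
  assumes "\<And>f. norm f = 1 \<Longrightarrow> cmod (cinner (T f) f) \<le> K"
  shows "numerical_radius T \<le> K"
  unfolding numerical_radius_def
  by (rule cSUP_least[OF numerical_range_nonempty]) (use assms in \<open>auto simp: numerical_range_def\<close>)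

lemma numerical_radius_upper:
  assumes "\<And>f. norm f = 1 \<Longrightarrow> cmod (cinner (T f) f) \<le> K" "norm f = 1"
  shows "cmod (cinner (T f) f) \<le> numerical_radius T"
  unfolding numerical_radius_def
  by (rule cSUP_upper) (use assms in \<open>auto simp: numerical_range_def bdd_above_def\<close>)

text \<open>Solving \<open>T f - z f = g\<close> is a fixed point problem for the contraction
  \<open>f \<mapsto> (T f - g) / z\<close>.\<close>

lemma spectrum_cmod_le_onorm:
  assumes T: "bounded_clinear T" and z: "z \<in> spectrum T"
  shows "cmod z \<le> onorm T"
proof (rule ccontr)
  assume "\<not> cmod z \<le> onorm T"
  then have less: "onorm T < cmod z" by simp
  note bl = bounded_clinear_linear[OF T]
  have nT: "norm (T f) \<le> onorm T * norm f" for f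
    by (rule onorm[OF bl])
  have pos: "0 \<le> onorm T" by (rule onorm_pos_le[OF bl])
  have "z \<noteq> 0" using less pos by auto
  have ex: "\<exists>!f. T f - z *\<^sub>C f = g" for g
  proof -
    have "\<exists>!f. inverse z *\<^sub>C (T f - g) = f"
    proof (rule banach_fix_type)
      show "0 \<le> onorm T / cmod z" "onorm T / cmod z < 1"
        using pos less \<open>z \<noteq> 0\<close> by (auto simp: divide_simps)
      show "\<forall>x y. dist (inverse z *\<^sub>C (T x - g)) (inverse z *\<^sub>C (T y - g)) \<le> onorm T / cmod z * dist x y"
      proof (intro allI)
        fix x y
        have "inverse z *\<^sub>C (T x - g) - inverse z *\<^sub>C (T y - g) = inverse z *\<^sub>C (T (x - y))"
          by (simp add: linear_diff[OF bounded_linear.linear[OF bl]] flip: scaleC_diff_right)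
        then show "dist (inverse z *\<^sub>C (T x - g)) (inverse z *\<^sub>C (T y - g)) \<le> onorm T / cmod z * dist x y"
          using nT[of "x - y"] \<open>z \<noteq> 0\<close> by (simp add: dist_norm norm_inverse
                divide_inverse mult.commute mult.left_commute mult_left_mono)
      qed
    qed
    moreover have "inverse z *\<^sub>C (T f - g) = f \<longleftrightarrow> T f - z *\<^sub>C f = g" for f
    proof
      assume "inverse z *\<^sub>C (T f - g) = f"
      then have "z *\<^sub>C inverse z *\<^sub>C (T f - g) = z *\<^sub>C f" by simp
      then show "T f - z *\<^sub>C f = g" using \<open>z \<noteq> 0\<close> by (auto simp: algebra_simps)
    next
      assume "T f - z *\<^sub>C f = g"
      then have "T f - g = z *\<^sub>C f" by auto
      then show "inverse z *\<^sub>C (T f - g) = f" using \<open>z \<noteq> 0\<close> by simp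
    qed
    ultimately show ?thesis by simp
  qed
  define R where "R g = (THE f. T f - z *\<^sub>C f = g)" for g
  have R: "T (R g) - z *\<^sub>C R g = g" for g
    unfolding R_def by (rule theI'[OF ex])
  have uniq: "R g = f" if "T f - z *\<^sub>C f = g" for f g
    using ex[of g] R[of g] that by blast
  have "bounded_clinear R"
  proof (rule bounded_clinearI[where K = "inverse (cmod z - onorm T)"])
    show "R (f + g) = R f + R g" for f g
      using R[of f] R[of g]
      by (intro uniq) (simp add: linear_add[OF bounded_linear.linear[OF bl]] scaleC_add_right
          algebra_simps)
    show "R (c *\<^sub>C f) = c *\<^sub>C R f" for c f
      using arg_cong[OF R[of f], of "\<lambda>h. c *\<^sub>C h"]
      by (intro uniq) (simp add: bounded_clinear_scaleC[OF T] scaleC_diff_right mult.commute)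
    show "norm (R f) \<le> inverse (cmod z - onorm T) * norm f" for f
    proof -
      have "z *\<^sub>C R f = T (R f) - f"
        using R[of f] by (simp add: algebra_simps)
      then have "cmod z * norm (R f) \<le> onorm T * norm (R f) + norm f"
        using nT[of "R f"] norm_triangle_ineq4[of "T (R f)" f] by (metis norm_scaleC add_right_mono order_trans)
      then have "(cmod z - onorm T) * norm (R f) \<le> norm f"
        by (simp add: algebra_simps)
      then show ?thesis
        using less by (simp add: field_simps)
    qed
  qed
  then show False
    using z uniq R by (auto simp: spectrum_def)
qed

locale orthogonal_projection =
  fixes P :: "l2 \<Rightarrow> l2"
  assumes bounded: "bounded_clinear P"
    and idem [simp]: "P (P f) = P f"
    and selfadjoint: "cinner (P f) g = cinner f (P g)"
begin

lemma add: "P (f + g) = P f + P g" and diff: "P (f - g) = P f - P g"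
  and zero [simp]: "P 0 = 0"
  using bounded_clinear_linear[OF bounded]
  by (auto simp: linear_add linear_diff linear_0 dest!: bounded_linear.linear)

lemma scaleC: "P (c *\<^sub>C f) = c *\<^sub>C P f"
  by (rule bounded_clinear_scaleC[OF bounded])

lemma scaleR: "P (r *\<^sub>R f) = r *\<^sub>R P f"
  using scaleC[of "complex_of_real r" f] by (simp add: scaleC_of_real)

lemma cinner_proj: "cinner (P f) f = complex_of_real ((norm (P f))\<^sup>2)"
  "cinner f (P f) = complex_of_real ((norm (P f))\<^sup>2)"
  by (metis cinner_self idem selfadjoint)+

lemma norm_compl: "(norm (f - P f))\<^sup>2 = (norm f)\<^sup>2 - (norm (P f))\<^sup>2"
  by (simp add: norm_diff_sq cinner_proj)

lemma norm_le: "norm (P f) \<le> norm f"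
proof -
  have "(norm (P f))\<^sup>2 \<le> (norm f)\<^sup>2"
    using norm_compl[of f] zero_le_power2[of "norm (f - P f)"] by linarith
  then show ?thesis by simp
qed

lemma norm_compl_le: "norm (f - P f) \<le> norm f"
proof -
  have "(norm (f - P f))\<^sup>2 \<le> (norm f)\<^sup>2"
    using norm_compl[of f] zero_le_power2[of "norm (P f)"] by linarith
  then show ?thesis by simp
qed

lemma fixed_if_norm_eq: "norm (P f) = norm f \<Longrightarrow> P f = f"
  using norm_compl[of f] by simp

lemma range_iff: "f \<in> range P \<longleftrightarrow> P f = f"
  by (metis idem rangeE rangeI)

end

text \<open>This is the estimate behind the sector. Here \<open>z = x + \<i>y\<close> stands for the inner product of the
  normalised projections of a unit vector, \<open>t\<close> for the product of the lengths of these
  projections, so that \<open>t z\<close> is a point of the numerical range. The constraint bounds \<open>t\<close> by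
  \<open>(1 - \<bar>z\<bar>\<^sup>2) / (2 (1 - x))\<close>, and Cauchy--Schwarz in the plane then maximises a linear function
  of \<open>(\<bar>y\<bar>, x)\<close> over a circle. The slope \<open>c / \<surd>(4 - c\<^sup>2)\<close> is the largest value of
  \<open>\<bar>z\<bar> / \<surd>(4 - \<bar>z\<bar>\<^sup>2)\<close>; it increases to \<open>1 / \<surd>3 = tan (\<pi>/6)\<close> as \<open>c\<close> increases to one.\<close>

lemma sector_arith:
  fixes t x y c :: real
  defines "k \<equiv> c / sqrt (4 - c\<^sup>2)"
  assumes c: "0 \<le> c" "c < 1" and t: "0 \<le> t" and m: "x\<^sup>2 + y\<^sup>2 \<le> c\<^sup>2"
    and ineq: "2 * t * (1 - x) \<le> 1 - (x\<^sup>2 + y\<^sup>2)"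
  shows "t * \<bar>y\<bar> \<le> k * (1 - t * x)"
proof -
  define m where "m = x\<^sup>2 + y\<^sup>2"
  have c2: "c\<^sup>2 < 1" using c by (simp add: power_less_one_iff)
  have mc: "m \<le> c\<^sup>2" "0 \<le> m" using m by (auto simp: m_def)
  have k: "0 \<le> k" using c c2 by (simp add: k_def)
  have k2: "k\<^sup>2 * (4 - c\<^sup>2) = c\<^sup>2" using c2 by (simp add: k_def power_divide)
  have "k\<^sup>2 * (4 - c\<^sup>2) \<le> k\<^sup>2 * (4 - m)" using mc by (intro mult_left_mono) auto
  then have km: "m \<le> k\<^sup>2 * (4 - m)" using mc k2 by linarith
  have "x\<^sup>2 \<le> c\<^sup>2" using m by (meson add_increasing2 order_refl order_trans le_add_same_cancel1 zero_le_power2)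
  then have "\<bar>x\<bar> \<le> c" using c by (simp add: abs_le_square_iff[symmetric])
  then have x: "x < 1" using c by auto
  have key: "(1 - m) * \<bar>y\<bar> + k * (3 - m) * x \<le> 2 * k"
  proof (rule power2_le_imp_le)
    have "((1 - m) * \<bar>y\<bar> + k * (3 - m) * x)\<^sup>2 + ((1 - m) * x - k * (3 - m) * \<bar>y\<bar>)\<^sup>2
        = m * ((1 - m)\<^sup>2 + k\<^sup>2 * (3 - m)\<^sup>2)"
    proof -
      have "(A * Y + B * X)\<^sup>2 + (A * X - B * Y)\<^sup>2 = (X\<^sup>2 + Y\<^sup>2) * (A\<^sup>2 + B\<^sup>2)" for A B X Y :: real
        by (simp add: power2_eq_square algebra_simps)
      from this[of "1 - m" "\<bar>y\<bar>" "k * (3 - m)" x] show ?thesis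
        by (simp add: m_def power_mult_distrib)
    qed
    then have "((1 - m) * \<bar>y\<bar> + k * (3 - m) * x)\<^sup>2 \<le> m * ((1 - m)\<^sup>2 + k\<^sup>2 * (3 - m)\<^sup>2)"
      by (smt (verit) zero_le_power2)
    also have "\<dots> = (2 * k)\<^sup>2 - (1 - m)\<^sup>2 * (k\<^sup>2 * (4 - m) - m)"
      by (simp add: power2_eq_square algebra_simps)
    also have "\<dots> \<le> (2 * k)\<^sup>2"
      using km by (simp add: mult_nonneg_nonneg)
    finally show "((1 - m) * \<bar>y\<bar> + k * (3 - m) * x)\<^sup>2 \<le> (2 * k)\<^sup>2" .
  qed (use k in auto)
  have "t * (\<bar>y\<bar> + k * x) \<le> k"
  proof (cases "\<bar>y\<bar> + k * x \<le> 0")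
    case True
    then show ?thesis using t k by (meson mult_nonneg_nonpos order_trans)
  next
    case False
    have "(2 * t * (1 - x)) * (\<bar>y\<bar> + k * x) \<le> (1 - m) * (\<bar>y\<bar> + k * x)"
      using ineq False by (intro mult_right_mono) (auto simp: m_def)
    also have "\<dots> \<le> 2 * k * (1 - x)"
      using key by (simp add: algebra_simps)
    finally have "(2 * (1 - x)) * (t * (\<bar>y\<bar> + k * x)) \<le> (2 * (1 - x)) * k"
      by (simp add: algebra_simps)
    then show ?thesis
      using x by (simp add: mult_le_cancel_left_pos)
  qed
  then show ?thesis by (simp add: algebra_simps)
qed

lemma sector_slope_less:
  fixes c :: real
  assumes "0 \<le> c" "c < 1"
  shows "0 \<le> c / sqrt (4 - c\<^sup>2)" "sqrt 3 * (c / sqrt (4 - c\<^sup>2)) < 1"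
proof -
  have c2: "c\<^sup>2 < 1" using assms by (simp add: power_less_one_iff)
  then show "0 \<le> c / sqrt (4 - c\<^sup>2)" using assms by simp
  have "sqrt 3 * c < sqrt (4 - c\<^sup>2)"
  proof -
    have "sqrt 3 * c = sqrt (3 * c\<^sup>2)" using assms by (simp add: real_sqrt_mult)
    also have "\<dots> < sqrt (4 - c\<^sup>2)" using c2 by simp
    finally show ?thesis .
  qed
  then show "sqrt 3 * (c / sqrt (4 - c\<^sup>2)) < 1" using c2 by (simp add: divide_simps)
qed

section \<open>Pairs of orthogonal projections\<close>

locale projection_pair = P: orthogonal_projection P + Q: orthogonal_projection Q for P Q
begin

lemma bounded_PQ: "bounded_clinear (P \<circ> Q)"
  by (rule bounded_clinear_compose[OF P.bounded Q.bounded])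

lemma norm_PQ: "norm (P (Q f)) \<le> onorm (P \<circ> Q) * norm f"
  using onorm[OF bounded_clinear_linear[OF bounded_PQ], of f] by simp

lemma onorm_nonneg: "0 \<le> onorm (P \<circ> Q)"
  by (rule onorm_pos_le[OF bounded_clinear_linear[OF bounded_PQ]])

lemma cinner_PQ_le: "cmod (cinner (P (Q f)) f) \<le> onorm (P \<circ> Q) * norm f * norm f"
  using cinner_Cauchy_Schwarz[of "P (Q f)" f] mult_right_mono[OF norm_PQ[of f] norm_ge_zero[of f]]
  by linarith

text \<open>A projection that almost preserves the length of a vector almost fixes it, by Pythagoras. If
  the norm of the product is at least one, some unit vector loses almost no length in either
  projection. Such vectors refute all the equivalent conditions directly, except the one on the
  spectral radius, which is reduced to the spectrum, and those on the angle of the ranges and on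
  the sector, which need other arguments.\<close>

lemma almost_fixed:
  assumes "\<not> onorm (P \<circ> Q) < 1" "0 < \<epsilon>"
  obtains x where "norm x = 1" "norm (x - P x) < \<epsilon>" "norm (x - Q x) < \<epsilon>"
proof -
  \<comment> \<open>A loss of at most \<open>2 d\<close> in squared length keeps each distance below \<open>\<epsilon> / 2\<close>.\<close>
  define d where "d = min (1/2) (\<epsilon>\<^sup>2 / 16)"
  have d: "0 < d" "d \<le> 1/2" "16 * d \<le> \<epsilon>\<^sup>2" using assms(2) by (auto simp: d_def)
  have "\<exists>f. (1 - d) * norm f < norm (P (Q f))"
  proof (rule ccontr)
    assume "\<nexists>f. (1 - d) * norm f < norm (P (Q f))"
    then have "onorm (P \<circ> Q) \<le> 1 - d"
      using d by (intro onorm_bound) (auto simp: not_less)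
    then show False using assms(1) d by linarith
  qed
  then obtain f where f: "(1 - d) * norm f < norm (P (Q f))" by blast
  then have "f \<noteq> 0" by auto
  define x where "x = (1 / norm f) *\<^sub>R f"
  have x1: "norm x = 1" using \<open>f \<noteq> 0\<close> by (simp add: x_def)
  have PQx: "1 - d < norm (P (Q x))"
    using f \<open>f \<noteq> 0\<close> by (simp add: x_def P.scaleR Q.scaleR field_simps)
  have sq: "1 - 2 * d \<le> (norm (P (Q x)))\<^sup>2"
  proof -
    have "(1 - d)\<^sup>2 \<le> (norm (P (Q x)))\<^sup>2" using PQx d by (intro power_mono) auto
    moreover have "(1 - d)\<^sup>2 = 1 - 2 * d + d\<^sup>2" by (simp add: power2_eq_square algebra_simps)
    ultimately show ?thesis using zero_le_power2[of d] by linarith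
  qed
  have le: "(norm (P (Q x)))\<^sup>2 \<le> (norm (Q x))\<^sup>2" "(norm (Q x))\<^sup>2 \<le> 1"
    using P.norm_le[of "Q x"] Q.norm_le[of x] x1 by (simp_all add: power_le_one)
  have small: "norm u < \<epsilon> / 2" if "(norm u)\<^sup>2 \<le> 2 * d" for u :: l2
  proof (rule power2_less_imp_less)
    show "(norm u)\<^sup>2 < (\<epsilon> / 2)\<^sup>2" using that d by (simp add: power_divide)
  qed (use assms(2) in simp)
  have half: "norm (x - Q x) < \<epsilon> / 2" "norm (Q x - P (Q x)) < \<epsilon> / 2"
  proof -
    have "(norm (x - Q x))\<^sup>2 \<le> 2 * d" "(norm (Q x - P (Q x)))\<^sup>2 \<le> 2 * d"
      using Q.norm_compl[of x] P.norm_compl[of "Q x"] sq le x1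
      unfolding x1 one_power2 by linarith+
    then show "norm (x - Q x) < \<epsilon> / 2" "norm (Q x - P (Q x)) < \<epsilon> / 2"
      by (auto simp only: small)
  qed
  show thesis
  proof (rule that[OF x1])
    \<comment> \<open>\<open>1 - P = (1 - P) (1 - Q) + (1 - P) Q\<close>\<close>
    have "x - P x = (x - Q x) - P (x - Q x) + (Q x - P (Q x))"
      by (simp add: P.diff)
    then have "norm (x - P x) \<le> norm (x - Q x) + norm (Q x - P (Q x))"
      using norm_triangle_ineq P.norm_compl_le[of "x - Q x"] by (metis add_right_mono order_trans)
    then show "norm (x - P x) < \<epsilon>" using half by linarith
    show "norm (x - Q x) < \<epsilon>" using half assms(2) by linarith
  qed
qed

end

context projection_pair
begin

lemma cinner_PQ_near_one:
  assumes "norm x = 1" "norm (x - P x) < \<epsilon>" "norm (x - Q x) < \<epsilon>"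
  shows "cmod (cinner (P (Q x)) x - 1) < 2 * \<epsilon>"
proof -
  have "cinner (P (Q x)) x - 1 = - cinner (x - Q x) (P x) - cinner x (x - P x)"
    using assms(1) by (simp add: P.selfadjoint cinner_diff_left cinner_diff_right cinner_self[of x])
  also have "cmod \<dots> \<le> cmod (cinner (x - Q x) (P x)) + cmod (cinner x (x - P x))"
    by (metis norm_minus_cancel norm_triangle_ineq4)
  also have "\<dots> \<le> norm (x - Q x) * norm (P x) + norm x * norm (x - P x)"
    by (intro add_mono cinner_Cauchy_Schwarz)
  also have "\<dots> \<le> norm (x - Q x) + norm (x - P x)"
    using P.norm_le[of x] assms(1) by (simp add: mult_left_le)
  finally show ?thesis using assms by linarith
qed

text \<open>One direction tests almost fixed vectors. For the other, \<open>f\<close> is decomposed as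
  \<open>P Q f + P (1 - Q) f + (1 - P) f\<close>, and the first term is absorbed into the left-hand side.\<close>

lemma norm_less_one_iff_annihilating:
  "(\<exists>c>0. \<forall>f. (norm f)\<^sup>2 \<le> c * ((norm (f - P f))\<^sup>2 + (norm (f - Q f))\<^sup>2)) \<longleftrightarrow> onorm (P \<circ> Q) < 1"
  (is "?A \<longleftrightarrow> ?D")
proof
  assume ?A
  then obtain c where c: "c > 0" "\<And>f. (norm f)\<^sup>2 \<le> c * ((norm (f - P f))\<^sup>2 + (norm (f - Q f))\<^sup>2)"
    by blast
  show ?D
  proof (rule ccontr)
    define e where "e = sqrt (1 / (4 * c))"
    have e: "0 < e" "e\<^sup>2 = 1 / (4 * c)" using c(1) by (auto simp: e_def)
    assume "\<not> ?D"
    then obtain x where x: "norm x = 1" "norm (x - P x) < e" "norm (x - Q x) < e"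
      using almost_fixed e(1) by blast
    have "(norm (x - P x))\<^sup>2 \<le> e\<^sup>2" "(norm (x - Q x))\<^sup>2 \<le> e\<^sup>2"
      using x by (auto intro!: power_mono)
    then have "c * ((norm (x - P x))\<^sup>2 + (norm (x - Q x))\<^sup>2) \<le> c * (e\<^sup>2 + e\<^sup>2)"
      using c(1) by (intro mult_left_mono add_mono) auto
    also have "\<dots> = 1 / 2" using c(1) e by (simp add: field_simps)
    finally show False using c(2)[of x] x(1) by simp
  qed
next
  assume ?D
  define q where "q = onorm (P \<circ> Q)"
  have q: "0 \<le> q" "q < 1" using onorm_nonneg \<open>?D\<close> by (auto simp: q_def)
  have "(norm f)\<^sup>2 \<le> 2 / (1 - q)\<^sup>2 * ((norm (f - P f))\<^sup>2 + (norm (f - Q f))\<^sup>2)" for f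
  proof -
    let ?a = "norm (f - P f)" and ?b = "norm (f - Q f)"
    have "f = P (Q f) + (P (f - Q f) + (f - P f))" by (simp add: P.diff)
    then have "norm f \<le> norm (P (Q f)) + (norm (P (f - Q f)) + norm (f - P f))"
      by (metis norm_triangle_ineq add_left_mono order_trans)
    then have "norm f \<le> q * norm f + (?b + ?a)"
      using norm_PQ[of f] P.norm_le[of "f - Q f"] unfolding q_def by linarith
    then have "(1 - q) * norm f \<le> ?a + ?b" by (simp add: algebra_simps)
    then have "((1 - q) * norm f)\<^sup>2 \<le> (?a + ?b)\<^sup>2"
      using q by (intro power_mono) auto
    also have "\<dots> \<le> 2 * (?a\<^sup>2 + ?b\<^sup>2)"
      using sum_squares_bound[of ?a ?b] by (simp add: power2_sum)
    finally have "(1 - q)\<^sup>2 * (norm f)\<^sup>2 \<le> 2 * (?a\<^sup>2 + ?b\<^sup>2)"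
      by (simp only: power_mult_distrib)
    then show ?thesis using q by (simp add: pos_le_divide_eq mult.commute)
  qed
  moreover have "0 < 2 / (1 - q)\<^sup>2" using q by simp
  ultimately show ?A by blast
qed

text \<open>For a unit vector \<open>x\<close> the point of the numerical range is
  \<open>\<parallel>P x\<parallel>\<^sup>2 + \<i>\<parallel>Q x\<parallel>\<^sup>2\<close>, and \<open>2 - \<parallel>P x\<parallel>\<^sup>2 - \<parallel>Q x\<parallel>\<^sup>2\<close> is exactly the quantity that the
  annihilation inequality bounds from below. That inequality therefore confines the numerical
  range to a closed half-plane that misses \<open>1 + \<i>\<close>.\<close>

lemma norm_less_one_iff_numerical_range_sum:
  "1 + \<i> \<notin> closure (numerical_range (\<lambda>f. P f + \<i> *\<^sub>C Q f)) \<longleftrightarrow> onorm (P \<circ> Q) < 1"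
  (is "?B \<longleftrightarrow> ?D")
proof
  have val: "cinner (P x + \<i> *\<^sub>C Q x) x = Complex ((norm (P x))\<^sup>2) ((norm (Q x))\<^sup>2)" for x
    by (simp add: cinner_simps P.cinner_proj Q.cinner_proj complex_eq_iff del: of_real_power)
  {
    assume ?B
    show ?D
    proof (rule ccontr)
      assume nD: "\<not> ?D"
      have "\<exists>z\<in>numerical_range (\<lambda>f. P f + \<i> *\<^sub>C Q f). dist z (1 + \<i>) < e" if "0 < e" for e
      proof -
        define d where "d = min 1 (e / 3)"
        have d: "0 < d" "d \<le> 1" "3 * d \<le> e" using that by (auto simp: d_def)
        obtain x where x: "norm x = 1" "norm (x - P x) < d" "norm (x - Q x) < d"
          using almost_fixed[OF nD d(1)] by blast
        have sq: "u\<^sup>2 \<le> d" if "0 \<le> u" "u < d" for u :: real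
        proof -
          have "u * u \<le> d * 1" using that d by (intro mult_mono) auto
          then show ?thesis by (simp add: power2_eq_square)
        qed
        have "1 - (norm (P x))\<^sup>2 \<le> d" "1 - (norm (Q x))\<^sup>2 \<le> d"
          using sq[of "norm (x - P x)"] sq[of "norm (x - Q x)"] x P.norm_compl[of x] Q.norm_compl[of x]
          by auto
        moreover have "(norm (P x))\<^sup>2 \<le> 1" "(norm (Q x))\<^sup>2 \<le> 1"
          using P.norm_le[of x] Q.norm_le[of x] x(1) by (auto simp: power_le_one)
        ultimately have "cmod (cinner (P x + \<i> *\<^sub>C Q x) x - (1 + \<i>)) \<le> d + d"
          unfolding val by (intro order_trans[OF cmod_le]) auto
        then have "dist (cinner (P x + \<i> *\<^sub>C Q x) x) (1 + \<i>) < e"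
          using d by (simp add: dist_norm)
        then show ?thesis using x(1) by (auto simp: numerical_range_def)
      qed
      then show False using \<open>?B\<close> by (simp add: closure_approachable)
    qed
  }
  assume ?D
  then obtain c where c: "c > 0" "\<And>f. (norm f)\<^sup>2 \<le> c * ((norm (f - P f))\<^sup>2 + (norm (f - Q f))\<^sup>2)"
    using norm_less_one_iff_annihilating by blast
  have "numerical_range (\<lambda>f. P f + \<i> *\<^sub>C Q f) \<subseteq> {z. Re z + Im z \<le> 2 - 1 / c}"
  proof
    fix z assume "z \<in> numerical_range (\<lambda>f. P f + \<i> *\<^sub>C Q f)"
    then obtain x where x: "norm x = 1" and z: "z = Complex ((norm (P x))\<^sup>2) ((norm (Q x))\<^sup>2)"
      by (auto simp: numerical_range_def val)
    have "1 \<le> c * (2 - (norm (P x))\<^sup>2 - (norm (Q x))\<^sup>2)"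
      using c(2)[of x] x by (simp add: P.norm_compl Q.norm_compl algebra_simps)
    then show "z \<in> {z. Re z + Im z \<le> 2 - 1 / c}" using c(1) by (simp add: z field_simps)
  qed
  moreover have "closed {z. Re z + Im z \<le> 2 - 1 / c}"
    by (intro closed_Collect_le continuous_intros)
  ultimately have "closure (numerical_range (\<lambda>f. P f + \<i> *\<^sub>C Q f)) \<subseteq> {z. Re z + Im z \<le> 2 - 1 / c}"
    by (rule closure_minimal)
  then show ?B using c(1) by auto
qed

lemma common_fixed_zero:
  assumes "onorm (P \<circ> Q) < 1" "P f = f" "Q f = f"
  shows "f = 0"
proof (rule ccontr)
  assume "f \<noteq> 0"
  then have "onorm (P \<circ> Q) * norm f < 1 * norm f"
    using assms(1) by (intro mult_strict_right_mono) auto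
  then show False using norm_PQ[of f] assms by simp
qed

text \<open>When the ranges meet only in zero, the cosine of their angle is the best constant \<open>k\<close> in
  \<open>\<bar>\<langle>f, g\<rangle>\<bar> \<le> k \<parallel>f\<parallel> \<parallel>g\<parallel>\<close> for \<open>f\<close>, \<open>g\<close> in the two ranges. Applying this to \<open>P Q f\<close> and \<open>Q f\<close>
  shows that it equals the norm of \<open>P Q\<close>.\<close>

lemma norm_less_one_iff_cos_angle:
  "range P \<inter> range Q = {0} \<and> cos_angle (range P) (range Q) < 1 \<longleftrightarrow> onorm (P \<circ> Q) < 1"
  (is "?C \<longleftrightarrow> ?D")
proof
  let ?A = "{cmod (cinner f g) | f g. f \<in> range P \<inter> ortho {0} \<and> g \<in> range Q \<inter> ortho {0}
    \<and> norm f = 1 \<and> norm g = 1}"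
  have cos: "cos_angle (range P) (range Q) = (if ?A = {} then 0 else Sup ?A)"
    if "range P \<inter> range Q = {0}"
    unfolding cos_angle_def Let_def that ..
  have ortho: "ortho {0} = UNIV" by (auto simp: ortho_def)
  {
    assume C: ?C
    define k where "k = cos_angle (range P) (range Q)"
    have "bdd_above ?A"
    proof (rule bdd_aboveI[of _ 1])
      fix a assume "a \<in> ?A"
      then obtain f g where "a = cmod (cinner f g)" "norm f = 1" "norm g = 1" by blast
      then show "a \<le> 1" using cinner_Cauchy_Schwarz[of f g] by simp
    qed
    then have up: "a \<le> k" if "a \<in> ?A" for a
      using that unfolding k_def cos[OF conjunct1[OF C]] by (auto intro: cSup_upper)
    have k: "0 \<le> k"
    proof (cases "?A = {}")
      case False
      then obtain a where "a \<in> ?A" by blast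
      moreover from this have "0 \<le> a" by auto
      ultimately show ?thesis using up order_trans by blast
    qed (simp add: k_def cos[OF conjunct1[OF C]])
    have bound: "cmod (cinner f g) \<le> k * (norm f * norm g)" if "P f = f" "Q g = g" for f g
    proof (cases "f = 0 \<or> g = 0")
      case False
      let ?f = "(1 / norm f) *\<^sub>R f" and ?g = "(1 / norm g) *\<^sub>R g"
      have "?f \<in> range P \<inter> ortho {0} \<and> ?g \<in> range Q \<inter> ortho {0} \<and> norm ?f = 1 \<and> norm ?g = 1"
        using False that by (simp add: ortho P.range_iff Q.range_iff P.scaleR Q.scaleR)
      then have "cmod (cinner ?f ?g) \<in> ?A" by blast
      from up[OF this] False show ?thesis
        by (simp add: cinner_scaleR_left cinner_scaleR_right norm_mult norm_divide divide_simps mult_ac)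
    qed auto
    have "norm (P (Q f)) \<le> k * norm f" for f
    proof (cases "P (Q f) = 0")
      case False
      have "(norm (P (Q f)))\<^sup>2 = cmod (cinner (P (Q f)) (Q f))"
        by (simp add: P.cinner_proj norm_power)
      also have "\<dots> \<le> k * (norm (P (Q f)) * norm (Q f))"
        by (rule bound) auto
      also have "\<dots> \<le> k * (norm (P (Q f)) * norm f)"
        using k by (intro mult_left_mono Q.norm_le) auto
      finally show ?thesis using False by (simp add: power2_eq_square)
    qed (use k in simp)
    then have "onorm (P \<circ> Q) \<le> k" by (intro onorm_bound k) auto
    then show ?D using C k_def by linarith
  }
  assume ?D
  have zero: "range P \<inter> range Q = {0}"
    using common_fixed_zero[OF \<open>?D\<close>] P.range_iff Q.range_iff P.zero Q.zero by blast
  have le: "a \<le> onorm (P \<circ> Q)" if "a \<in> ?A" for a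
  proof -
    from that obtain f g where fg: "P f = f" "Q g = g" "norm f = 1" "norm g = 1" "a = cmod (cinner f g)"
      by (auto simp: P.range_iff Q.range_iff)
    have "cinner f g = cinner f (P (Q g))" using fg P.selfadjoint by metis
    then have "a \<le> norm f * norm (P (Q g))" using fg(5) cinner_Cauchy_Schwarz by simp
    then show ?thesis using norm_PQ[of g] fg by simp
  qed
  have "cos_angle (range P) (range Q) \<le> onorm (P \<circ> Q)"
    unfolding cos[OF zero] using le onorm_nonneg by (auto intro!: cSup_least)
  with zero \<open>?D\<close> show ?C by simp
qed

text \<open>The spectral radius is bounded by the norm. The supremum that defines it is taken over a
  nonempty set because zero is a spectral value: if \<open>P Q\<close> were invertible, \<open>Q\<close> would be injective
  and \<open>P\<close> surjective, so both would be the identity and the norm of \<open>P Q\<close> would be one.\<close>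

lemma spectral_radius_less_one:
  assumes "onorm (P \<circ> Q) < 1"
  shows "spectral_radius (P \<circ> Q) < 1"
proof -
  have "0 \<in> spectrum (P \<circ> Q)"
  proof (rule ccontr)
    assume "0 \<notin> spectrum (P \<circ> Q)"
    then obtain R where R: "\<And>f. R (P (Q f)) = f" "\<And>f. P (Q (R f)) = f" "bounded_clinear R"
      by (auto simp: spectrum_def)
    obtain e :: l2 where e: "norm e = 1" using exists_unit by blast
    have "P e = e" using R(2)[of e] P.idem by metis
    moreover have "Q e = e"
    proof -
      have "P (Q (e - Q e)) = P (Q 0)" by (simp add: Q.diff)
      then have "e - Q e = 0" using R(1) by metis
      then show ?thesis by simp
    qed
    ultimately have "e = 0" by (rule common_fixed_zero[OF assms])
    then show False using e by simp
  qed
  then have "spectral_radius (P \<circ> Q) \<le> onorm (P \<circ> Q)"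
    unfolding spectral_radius_def
    by (intro cSUP_least spectrum_cmod_le_onorm[OF bounded_PQ]) auto
  then show ?thesis using assms by linarith
qed

lemma one_notin_spectrum:
  assumes "spectral_radius (P \<circ> Q) < 1"
  shows "1 \<notin> spectrum (P \<circ> Q)"
proof
  assume "1 \<in> spectrum (P \<circ> Q)"
  moreover have "bdd_above (cmod ` spectrum (P \<circ> Q))"
    by (rule bdd_aboveI2[where M = "onorm (P \<circ> Q)"]) (rule spectrum_cmod_le_onorm[OF bounded_PQ])
  ultimately have "cmod 1 \<le> spectral_radius (P \<circ> Q)"
    unfolding spectral_radius_def by (intro cSUP_upper)
  then show False using assms by simp
qed

text \<open>Almost fixed unit vectors are approximate eigenvectors for the value one, which a bounded
  inverse of \<open>P Q - 1\<close> excludes.\<close>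

lemma norm_less_one_if_one_notin_spectrum:
  assumes "1 \<notin> spectrum (P \<circ> Q)"
  shows "onorm (P \<circ> Q) < 1"
proof (rule ccontr)
  assume nD: "\<not> onorm (P \<circ> Q) < 1"
  obtain R where R: "bounded_clinear R" "\<And>f. R (P (Q f) - f) = f"
    using assms by (auto simp: spectrum_def)
  define K where "K = onorm R"
  have K: "norm (R f) \<le> K * norm f" "0 \<le> K" for f
    using onorm[OF bounded_clinear_linear[OF R(1)]] onorm_pos_le[OF bounded_clinear_linear[OF R(1)]]
    by (auto simp: K_def)
  define e where "e = 1 / (2 * (K + 1))"
  have e: "0 < e" "K * (2 * e) < 1" using K(2) by (auto simp: e_def field_simps)
  obtain x where x: "norm x = 1" "norm (x - P x) < e" "norm (x - Q x) < e"
    using almost_fixed[OF nD e(1)] by blast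
  have "P (Q x) - x = - (P (x - Q x) + (x - P x))" by (simp add: P.diff)
  then have "norm (P (Q x) - x) \<le> norm (P (x - Q x)) + norm (x - P x)"
    by (metis norm_minus_cancel norm_triangle_ineq)
  then have "norm (P (Q x) - x) \<le> 2 * e"
    using P.norm_le[of "x - Q x"] x by linarith
  then have "K * norm (P (Q x) - x) \<le> K * (2 * e)"
    using K(2) by (rule mult_left_mono)
  then show False using K(1)[of "P (Q x) - x"] R(2)[of x] x(1) e(2) by simp
qed

lemma cinner_PQ_unit: "norm f = 1 \<Longrightarrow> cmod (cinner ((P \<circ> Q) f) f) \<le> onorm (P \<circ> Q)"
  using cinner_PQ_le[of f] by simp

lemma numerical_radius_less_one:
  assumes "onorm (P \<circ> Q) < 1"
  shows "numerical_radius (P \<circ> Q) < 1"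
proof -
  have "numerical_radius (P \<circ> Q) \<le> onorm (P \<circ> Q)"
    by (rule numerical_radius_le) (rule cinner_PQ_unit)
  with assms show ?thesis by linarith
qed

lemma one_notin_closure_numerical_range:
  assumes "numerical_radius (P \<circ> Q) < 1"
  shows "1 \<notin> closure (numerical_range (P \<circ> Q))"
proof -
  have "numerical_range (P \<circ> Q) \<subseteq> cball 0 (numerical_radius (P \<circ> Q))"
  proof
    fix z assume "z \<in> numerical_range (P \<circ> Q)"
    then obtain f where f: "norm f = 1" "z = cinner ((P \<circ> Q) f) f" by (auto simp: numerical_range_def)
    have "cmod z \<le> numerical_radius (P \<circ> Q)"
      unfolding f(2) by (rule numerical_radius_upper[OF cinner_PQ_unit f(1)])
    then show "z \<in> cball 0 (numerical_radius (P \<circ> Q))" by simp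
  qed
  then have "closure (numerical_range (P \<circ> Q)) \<subseteq> cball 0 (numerical_radius (P \<circ> Q))"
    by (rule closure_minimal) simp
  then show ?thesis using assms by auto
qed

lemma norm_less_one_if_one_notin_closure:
  assumes "1 \<notin> closure (numerical_range (P \<circ> Q))"
  shows "onorm (P \<circ> Q) < 1"
proof (rule ccontr)
  assume nD: "\<not> onorm (P \<circ> Q) < 1"
  have "\<exists>z\<in>numerical_range (P \<circ> Q). dist z 1 < e" if e: "0 < e" for e
  proof -
    obtain x where x: "norm x = 1" "norm (x - P x) < e / 2" "norm (x - Q x) < e / 2"
      using almost_fixed[OF nD, of "e / 2"] e by auto
    have "dist (cinner ((P \<circ> Q) x) x) 1 < e"
      using cinner_PQ_near_one[OF x] by (simp add: dist_norm)
    then show ?thesis using x(1) by (auto simp: numerical_range_def)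
  qed
  then show False using assms by (simp add: closure_approachable)
qed

end

section \<open>The sector of the numerical range\<close>

context projection_pair
begin

text \<open>With \<open>t = \<parallel>P x\<parallel> \<parallel>Q x\<parallel>\<close> and \<open>\<langle>Q x, P x\<rangle> = t z\<close>, the last inequality is Cauchy--Schwarz for the
  components of \<open>Q x\<close> and \<open>P x\<close> orthogonal to \<open>x\<close>, combined with
  \<open>2 t \<le> \<parallel>P x\<parallel>\<^sup>2 + \<parallel>Q x\<parallel>\<^sup>2\<close>.\<close>

lemma cinner_PQ_polar:
  assumes x: "norm x = 1"
  obtains t z where "cinner (P (Q x)) x = complex_of_real t * z" "0 \<le> t"
    "cmod z \<le> onorm (P \<circ> Q)" "2 * t * (1 - Re z) \<le> 1 - (cmod z)\<^sup>2"
proof -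
  define p where "p = norm (P x)"
  define q where "q = norm (Q x)"
  define w where "w = cinner (P (Q x)) x"
  have pq: "0 \<le> p" "p \<le> 1" "0 \<le> q" "q \<le> 1"
    using P.norm_le[of x] Q.norm_le[of x] x by (auto simp: p_def q_def)
  have w: "w = cinner (Q x) (P x)" by (simp add: w_def P.selfadjoint)
  have wle: "cmod w \<le> onorm (P \<circ> Q) * (q * p)"
  proof -
    have "w = cinner (P (Q (Q x))) (P x)" by (simp add: w P.selfadjoint)
    then have "cmod w \<le> norm (P (Q (Q x))) * norm (P x)" by (simp add: cinner_Cauchy_Schwarz)
    also have "\<dots> \<le> onorm (P \<circ> Q) * norm (Q x) * norm (P x)"
      using norm_PQ[of "Q x"] by (intro mult_right_mono) auto
    finally show ?thesis by (simp add: p_def q_def mult.assoc)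
  qed
  show thesis
  proof (cases "p * q = 0")
    case True
    then have "q * p = 0" by auto
    then have "w = 0" using wle by (metis mult_zero_right norm_le_zero_iff)
    then show thesis
      using onorm_nonneg by (intro that[of 0 0]) (auto simp: w_def)
  next
    case False
    define t where "t = p * q"
    define z where "z = w / complex_of_real t"
    have t: "0 < t" using False pq by (auto simp: t_def less_le)
    have wz: "w = complex_of_real t * z" using t by (simp add: z_def)
    have "cmod z \<le> onorm (P \<circ> Q)"
    proof -
      have "cmod z = cmod w / t" using t by (simp add: z_def norm_divide)
      then show ?thesis using wle t by (simp add: t_def pos_divide_le_eq mult.commute)
    qed
    moreover have "2 * t * (1 - Re z) \<le> 1 - (cmod z)\<^sup>2"
    proof -
      let ?u = "Q x - q\<^sup>2 *\<^sub>R x" and ?v = "P x - p\<^sup>2 *\<^sub>R x"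
      have "cinner ?u ?v = w - complex_of_real (p\<^sup>2 * q\<^sup>2)"
        using x by (simp add: cinner_simps cinner_scaleR_left cinner_scaleR_right w P.cinner_proj
            Q.cinner_proj cinner_self p_def q_def algebra_simps)
      also have "\<dots> = complex_of_real t * (z - complex_of_real t)"
        by (simp add: wz t_def power2_eq_square algebra_simps)
      finally have uv: "cinner ?u ?v = complex_of_real t * (z - complex_of_real t)" .
      have res: "(norm (f - r\<^sup>2 *\<^sub>R x))\<^sup>2 = r\<^sup>2 * (1 - r\<^sup>2)"
        if "cinner f x = complex_of_real (r\<^sup>2)" "norm f = r" for f r
      proof -
        have "cinner f (r\<^sup>2 *\<^sub>R x) = complex_of_real (r\<^sup>2 * r\<^sup>2)"
          by (simp only: cinner_scaleR_right that of_real_mult)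
        then have "(norm (f - r\<^sup>2 *\<^sub>R x))\<^sup>2 = r\<^sup>2 - 2 * (r\<^sup>2 * r\<^sup>2) + (r\<^sup>2)\<^sup>2"
          unfolding norm_diff_sq that by (simp only: Re_complex_of_real) (simp add: x)
        then show ?thesis by (simp add: power2_eq_square algebra_simps)
      qed
      have u: "(norm ?u)\<^sup>2 = q\<^sup>2 * (1 - q\<^sup>2)"
        by (rule res) (simp_all only: Q.cinner_proj q_def)
      have v: "(norm ?v)\<^sup>2 = p\<^sup>2 * (1 - p\<^sup>2)"
        by (rule res) (simp_all only: P.cinner_proj p_def)
      have "(cmod (cinner ?u ?v))\<^sup>2 \<le> (norm ?u * norm ?v)\<^sup>2"
        by (intro power_mono cinner_Cauchy_Schwarz) auto
      then have "t\<^sup>2 * (cmod (z - complex_of_real t))\<^sup>2 \<le> (q\<^sup>2 * (1 - q\<^sup>2)) * (p\<^sup>2 * (1 - p\<^sup>2))"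
        unfolding uv power_mult_distrib u v using t by (simp add: norm_mult power_mult_distrib)
      also have "\<dots> = t\<^sup>2 * ((1 - q\<^sup>2) * (1 - p\<^sup>2))"
        by (simp add: t_def power_mult_distrib)
      finally have "(cmod (z - complex_of_real t))\<^sup>2 \<le> (1 - q\<^sup>2) * (1 - p\<^sup>2)"
        using t by (simp add: mult_le_cancel_left_pos)
      moreover have "(cmod (z - complex_of_real t))\<^sup>2 = (cmod z)\<^sup>2 - 2 * t * Re z + t\<^sup>2"
        unfolding cmod_power2 by (simp add: power2_eq_square algebra_simps)
      moreover have "(1 - q\<^sup>2) * (1 - p\<^sup>2) = 1 - q\<^sup>2 - p\<^sup>2 + t\<^sup>2"
        by (simp add: t_def power_mult_distrib algebra_simps)
      moreover have "2 * t \<le> p\<^sup>2 + q\<^sup>2"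
        using sum_squares_bound[of p q] by (simp add: t_def)
      ultimately show ?thesis by (simp add: algebra_simps)
    qed
    ultimately show thesis
      using wz t by (intro that[of t z]) (auto simp: w_def)
  qed
qed

lemma numerical_range_sector:
  assumes "onorm (P \<circ> Q) < 1" "norm x = 1"
  defines "w \<equiv> cinner (P (Q x)) x"
  shows "\<bar>Im w\<bar> \<le> onorm (P \<circ> Q) / sqrt (4 - (onorm (P \<circ> Q))\<^sup>2) * (1 - Re w)"
    and "Re w \<le> 0 \<Longrightarrow> cmod w \<le> onorm (P \<circ> Q) / 2"
proof -
  define c where "c = onorm (P \<circ> Q)"
  have c: "0 \<le> c" "c < 1" using assms onorm_nonneg by (auto simp: c_def)
  obtain t z where tz: "w = complex_of_real t * z" "0 \<le> t"
    "cmod z \<le> c" "2 * t * (1 - Re z) \<le> 1 - (cmod z)\<^sup>2"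
    using cinner_PQ_polar[OF assms(2)] unfolding w_def c_def by metis
  have "(cmod z)\<^sup>2 \<le> c\<^sup>2" using tz(3) by (intro power_mono) auto
  then have "t * \<bar>Im z\<bar> \<le> c / sqrt (4 - c\<^sup>2) * (1 - t * Re z)"
    using tz c by (intro sector_arith) (auto simp: cmod_power2)
  then show "\<bar>Im w\<bar> \<le> onorm (P \<circ> Q) / sqrt (4 - (onorm (P \<circ> Q))\<^sup>2) * (1 - Re w)"
    using tz by (simp add: c_def abs_mult)
  show "cmod w \<le> onorm (P \<circ> Q) / 2" if "Re w \<le> 0"
  proof (cases "t = 0")
    case False
    then have "Re z \<le> 0" using that tz by (simp add: mult_le_0_iff)
    then have "2 * t * 1 \<le> 2 * t * (1 - Re z)" using tz(2) by (intro mult_left_mono) auto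
    then have "t \<le> 1 / 2" using tz(4) zero_le_power2[of "cmod z"] by linarith
    then have "t * cmod z \<le> 1 / 2 * c" using tz c by (intro mult_mono) auto
    then show ?thesis using tz by (simp add: norm_mult c_def)
  qed (use tz onorm_nonneg in simp)
qed

lemma cadjoint_cscale_PQ: "cadjoint (\<lambda>f. c *\<^sub>C (P \<circ> Q) f) = (\<lambda>f. cnj c *\<^sub>C Q (P f))"
  by (rule cadjoint_eqI) (simp add: cinner_simps P.selfadjoint Q.selfadjoint)

lemma cinner_re_op:
  "cinner (re_op (\<lambda>f. c *\<^sub>C (P \<circ> Q) f) x) x = complex_of_real (Re (c * cinner (P (Q x)) x))"
proof -
  have "cinner (Q (P x)) x = cnj (cinner (P (Q x)) x)"
    by (metis P.selfadjoint Q.selfadjoint cinner_commute)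
  then show ?thesis
    unfolding re_op_def cadjoint_cscale_PQ
    by (simp add: cinner_simps complex_eq_iff field_simps)
qed

text \<open>On \<open>[0, \<pi>/3]\<close> the tangent is at most \<open>\<surd>3\<close>, and the slope \<open>k\<close> of the sector is smaller than
  \<open>1 / \<surd>3\<close>. So \<open>cos \<alpha> Re w + sin \<alpha> \<bar>Im w\<bar>\<close> stays below \<open>cos \<alpha>\<close>, uniformly because \<open>Re w \<le> c < 1\<close>.
  Where \<open>Re w \<le> 0\<close>, the bound \<open>\<bar>w\<bar> \<le> c / 2\<close> suffices since \<open>cos \<alpha> \<ge> 1/2\<close>.\<close>

lemma numerical_radius_re_op_less:
  assumes norm: "onorm (P \<circ> Q) < 1" and \<alpha>: "\<alpha> \<in> {0..pi/3}"
  shows "numerical_radius (re_op (\<lambda>f. exp (- \<i> * complex_of_real \<alpha>) *\<^sub>C (P \<circ> Q) f)) < cos \<alpha>"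
proof -
  define c where "c = onorm (P \<circ> Q)"
  define k where "k = c / sqrt (4 - c\<^sup>2)"
  have c: "0 \<le> c" "c < 1" using norm onorm_nonneg by (auto simp: c_def)
  have k: "0 \<le> k" "sqrt 3 * k < 1" using sector_slope_less[OF c] by (auto simp: k_def)
  have cos: "1 / 2 \<le> cos \<alpha>"
    using cos_monotone_0_pi_le[of \<alpha> "pi/3"] \<alpha> by (simp add: cos_60)
  have sin: "0 \<le> sin \<alpha>" using \<alpha> by (intro sin_ge_zero) auto
  have "sin \<alpha> \<le> sin (pi/3)" using \<alpha> by (intro sin_monotone_2pi_le) auto
  then have "sin \<alpha> \<le> sqrt 3 / 2" by (simp add: sin_60)
  also have "\<dots> \<le> sqrt 3 * cos \<alpha>" using cos by simp
  finally have sin_le: "sin \<alpha> \<le> sqrt 3 * cos \<alpha>" .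
  define K where "K = max (c / 2) (cos \<alpha> * (1 - (1 - sqrt 3 * k) * (1 - c)))"
  have "cos \<alpha> * (1 - (1 - sqrt 3 * k) * (1 - c)) < cos \<alpha> * 1"
    using cos k c by (intro mult_strict_left_mono) auto
  then have K: "K < cos \<alpha>" using c cos by (auto simp: K_def)
  have "numerical_radius (re_op (\<lambda>f. exp (- \<i> * complex_of_real \<alpha>) *\<^sub>C (P \<circ> Q) f)) \<le> K"
  proof (rule numerical_radius_le)
    fix x :: l2 assume x: "norm x = 1"
    define w where "w = cinner (P (Q x)) x"
    define v where "v = Re (exp (- \<i> * complex_of_real \<alpha>) * w)"
    have sector: "\<bar>Im w\<bar> \<le> k * (1 - Re w)" "Re w \<le> 0 \<Longrightarrow> cmod w \<le> c / 2"
      using numerical_range_sector[OF norm x] by (auto simp: w_def k_def c_def)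
    have wc: "cmod w \<le> c" using cinner_PQ_unit[OF x] by (simp add: w_def c_def)
    have v: "v = cos \<alpha> * Re w + sin \<alpha> * Im w"
      by (simp add: v_def Re_exp Im_exp)
    have vw: "\<bar>v\<bar> \<le> cmod w"
      unfolding v_def using abs_Re_le_cmod[of "exp (- \<i> * complex_of_real \<alpha>) * w"]
      by (simp add: norm_mult)
    have "sin \<alpha> * \<bar>Im w\<bar> \<le> (sqrt 3 * cos \<alpha>) * (k * (1 - Re w))"
      using sin_le sector(1) cos by (intro mult_mono) auto
    then have "cos \<alpha> * Re w + sin \<alpha> * \<bar>Im w\<bar> \<le> cos \<alpha> * (1 - (1 - sqrt 3 * k) * (1 - Re w))"
      by (simp add: algebra_simps)
    also have "\<dots> \<le> cos \<alpha> * (1 - (1 - sqrt 3 * k) * (1 - c))"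
      using cos k wc complex_Re_le_cmod[of w] by (intro mult_left_mono diff_left_mono) auto
    also have "\<dots> \<le> K" by (simp add: K_def)
    finally have up: "cos \<alpha> * Re w + sin \<alpha> * \<bar>Im w\<bar> \<le> K" .
    have "\<bar>v\<bar> \<le> K"
    proof (cases "Re w \<le> 0")
      case True
      then show ?thesis using sector(2) vw by (auto simp: K_def)
    next
      case False
      have "\<bar>sin \<alpha> * Im w\<bar> = sin \<alpha> * \<bar>Im w\<bar>" using sin by (simp add: abs_mult)
      moreover have "0 \<le> cos \<alpha> * Re w" using False cos by simp
      ultimately show ?thesis using up unfolding v by linarith
    qed
    then show "cmod (cinner (re_op (\<lambda>f. exp (- \<i> * complex_of_real \<alpha>) *\<^sub>C (P \<circ> Q) f) x) x) \<le> K"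
      unfolding cinner_re_op by (simp only: norm_of_real v_def w_def)
  qed
  with K show ?thesis by linarith
qed

lemma norm_less_one_if_numerical_radius_re_op_less:
  assumes less: "numerical_radius (re_op (\<lambda>f. exp (- \<i> * complex_of_real \<alpha>) *\<^sub>C (P \<circ> Q) f)) < cos \<alpha>"
  shows "onorm (P \<circ> Q) < 1"
proof (rule ccontr)
  assume nD: "\<not> onorm (P \<circ> Q) < 1"
  let ?T = "re_op (\<lambda>f. exp (- \<i> * complex_of_real \<alpha>) *\<^sub>C (P \<circ> Q) f)"
  define e where "e = (cos \<alpha> - numerical_radius ?T) / 2"
  have e: "0 < e" using less by (simp add: e_def)
  obtain x where x: "norm x = 1" "norm (x - P x) < e" "norm (x - Q x) < e"
    using almost_fixed[OF nD e] by blast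
  let ?c = "exp (- \<i> * complex_of_real \<alpha>)" and ?w = "cinner (P (Q x)) x"
  have c1: "cmod ?c = 1" by simp
  have "cmod (?c * ?w - ?c) < 2 * e"
    using cinner_PQ_near_one[OF x] c1 by (metis mult.right_neutral mult_1 norm_mult right_diff_distrib)
  moreover have "Re ?c = cos \<alpha>" by (simp add: Re_exp)
  ultimately have "cos \<alpha> - Re (?c * ?w) < 2 * e"
    using abs_Re_le_cmod[of "?c * ?w - ?c"] by (smt (verit) minus_complex.sel(1))
  moreover have "cmod (cinner (?T x) x) \<le> numerical_radius ?T"
  proof (rule numerical_radius_upper[where K = "onorm (P \<circ> Q)"])
    show "cmod (cinner (?T f) f) \<le> onorm (P \<circ> Q)" if "norm f = 1" for f
      unfolding cinner_re_op
      using abs_Re_le_cmod[of "?c * cinner (P (Q f)) f"] cinner_PQ_unit[OF that]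
      by (simp only: norm_of_real norm_mult c1 o_def)
  qed (rule x)
  then have "Re (?c * ?w) \<le> numerical_radius ?T"
    unfolding cinner_re_op norm_of_real by linarith
  ultimately show False by (simp add: e_def)
qed

text \<open>The sector estimate says that the argument of \<open>1 - w\<close> is at most \<open>arctan k\<close>, and
  \<open>k < 1 / \<surd>3 = tan (\<pi>/6)\<close>.\<close>

lemma numerical_range_subset_sector:
  assumes norm: "onorm (P \<circ> Q) < 1"
  shows "\<exists>\<theta><pi/6. numerical_range (P \<circ> Q) \<subseteq> {z. \<bar>Arg (1 - z)\<bar> \<le> \<theta>} - {1}"
proof -
  define c where "c = onorm (P \<circ> Q)"
  define k where "k = c / sqrt (4 - c\<^sup>2)"
  have c: "0 \<le> c" "c < 1" using norm onorm_nonneg by (auto simp: c_def)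
  have k: "0 \<le> k" "sqrt 3 * k < 1" using sector_slope_less[OF c] by (auto simp: k_def)
  have "k < 1 / sqrt 3" using k by (simp add: field_simps)
  then have "arctan k < arctan (1 / sqrt 3)" by (simp add: arctan_less_iff)
  also have "arctan (1 / sqrt 3) = pi / 6"
    by (rule arctan_unique) (simp_all add: tan_30)
  finally have "arctan k < pi / 6" .
  moreover have "numerical_range (P \<circ> Q) \<subseteq> {z. \<bar>Arg (1 - z)\<bar> \<le> arctan k} - {1}"
  proof
    fix w assume "w \<in> numerical_range (P \<circ> Q)"
    then obtain x where x: "norm x = 1" and w: "w = cinner (P (Q x)) x"
      by (auto simp: numerical_range_def)
    have wc: "cmod w \<le> c" using cinner_PQ_unit[OF x] by (simp add: w c_def)
    then have re: "Re w < 1" using c complex_Re_le_cmod[of w] by linarith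
    have sector: "\<bar>Im w\<bar> \<le> k * (1 - Re w)"
      using numerical_range_sector(1)[OF norm x] by (simp add: w k_def c_def)
    have "Arg (1 - w) = arctan (Im (1 - w) / Re (1 - w))"
      using re by (intro arg_conv_arctan) simp
    moreover have "- k \<le> Im (1 - w) / Re (1 - w)" "Im (1 - w) / Re (1 - w) \<le> k"
      using sector re by (simp_all add: pos_le_divide_eq pos_divide_le_eq pos_minus_divide_le_eq abs_le_iff)
    ultimately have "\<bar>Arg (1 - w)\<bar> \<le> arctan k"
      by (metis abs_leI arctan_le_iff arctan_minus minus_le_iff)
    then show "w \<in> {z. \<bar>Arg (1 - z)\<bar> \<le> arctan k} - {1}" using re by auto
  qed
  ultimately show ?thesis by blast
qed

text \<open>The defects \<open>b\<close> and \<open>a\<close> of a vector \<open>y\<close> of the range of \<open>Q\<close> are the squared lengths lost in the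
  first and in the second projection. Testing the sector condition on
  \<open>y + \<zeta> (1 - Q) P y\<close> with \<open>\<zeta> = exp (\<i>\<pi>/3)\<close> compares them: for this vector
  \<open>\<parallel>x\<parallel>\<^sup>2 - \<langle>P Q x, x\<rangle> = b + (1 - cnj \<zeta>) a\<close>.\<close>

lemma sector_defect:
  assumes k: "0 \<le> k" "sqrt 3 * k < 1"
    and sector: "\<And>x. \<bar>Im (cinner (P (Q x)) x)\<bar> \<le> k * ((norm x)\<^sup>2 - Re (cinner (P (Q x)) x))"
    and y: "Q y = y"
  defines "\<rho> \<equiv> 2 * k / (sqrt 3 - k)"
  shows "(norm (P y))\<^sup>2 - (norm (Q (P y)))\<^sup>2 \<le> \<rho> * ((norm y)\<^sup>2 - (norm (P y))\<^sup>2)"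
proof -
  define a where "a = (norm (P y))\<^sup>2 - (norm (Q (P y)))\<^sup>2"
  define b where "b = (norm y)\<^sup>2 - (norm (P y))\<^sup>2"
  define \<zeta> where "\<zeta> = Complex (1/2) (sqrt 3 / 2)"
  define x where "x = y + \<zeta> *\<^sub>C (P y - Q (P y))"
  have \<zeta>: "cmod \<zeta> = 1" by (simp add: \<zeta>_def cmod_def power_divide)
  have Qx: "Q x = y" by (simp add: x_def Q.add Q.scaleC Q.diff y)
  have orth: "cinner y (P y - Q (P y)) = 0"
    using Q.selfadjoint[of y "P y - Q (P y)"] y by (simp add: Q.diff)
  have nx: "(norm x)\<^sup>2 = (norm y)\<^sup>2 + a"
    unfolding x_def norm_add_sq cinner_scaleC_right orth
    by (simp add: \<zeta> Q.norm_compl a_def)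
  have w: "cinner (P (Q x)) x = complex_of_real ((norm (P y))\<^sup>2) + cnj \<zeta> * complex_of_real a"
    unfolding Qx by (simp add: x_def cinner_simps P.cinner_proj Q.cinner_proj cinner_self a_def)
  have "sqrt 3 / 2 * a \<le> sqrt 3 / 2 * \<bar>a\<bar>" by (intro mult_left_mono) auto
  also have "\<dots> \<le> k * (b + a / 2)"
    using sector[of x] unfolding w nx by (simp add: \<zeta>_def abs_mult b_def algebra_simps)
  finally have "sqrt 3 / 2 * a \<le> k * (b + a / 2)" .
  then have "a * (sqrt 3 - k) \<le> 2 * k * b" by (simp add: algebra_simps)
  moreover have "k < sqrt 3"
  proof -
    have "(1::real) \<le> sqrt 3" by simp
    moreover from this have "1 * k \<le> sqrt 3 * k" using k by (intro mult_right_mono)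
    ultimately show ?thesis using k by linarith
  qed
  ultimately show ?thesis by (simp add: \<rho>_def a_def b_def field_simps)
qed

text \<open>Von Neumann's alternating projections \<open>y\<^sub>n = (Q P)\<^sup>n y\<close>: if the second defect is at most \<open>\<rho> < 1\<close>
  times the first, then the defects decay geometrically, so \<open>y\<^sub>n\<close> converges. Its limit is a common
  fixed vector, hence zero, and the sum of the defects is the whole of \<open>\<parallel>y\<parallel>\<^sup>2\<close>. The first defect
  must then carry a fixed proportion of \<open>\<parallel>y\<parallel>\<^sup>2\<close>. The limit exists
  because \<open>L\<^sub>2\<close> is complete.\<close>

lemma norm_le_defect:
  assumes \<rho>: "0 \<le> \<rho>" "\<rho> < 1"
    and defect: "\<And>y. Q y = y \<Longrightarrow>
      (norm (P y))\<^sup>2 - (norm (Q (P y)))\<^sup>2 \<le> \<rho> * ((norm y)\<^sup>2 - (norm (P y))\<^sup>2)"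
    and trivial: "\<And>f. P f = f \<Longrightarrow> Q f = f \<Longrightarrow> f = 0"
    and y: "Q y = y"
  shows "(1 - \<rho>) * (norm y)\<^sup>2 \<le> 2 * ((norm y)\<^sup>2 - (norm (P y))\<^sup>2)"
proof -
  define Y where "Y n = ((\<lambda>f. Q (P f)) ^^ n) y" for n
  define b where "b n = (norm (Y n))\<^sup>2 - (norm (P (Y n)))\<^sup>2" for n
  have Y0: "Y 0 = y" and YS: "Y (Suc n) = Q (P (Y n))" for n by (simp_all add: Y_def)
  have QY: "Q (Y n) = Y n" for n by (cases n) (simp_all add: Y0 YS y)
  have b0: "0 \<le> b n" for n
    using P.norm_le[of "Y n"] by (simp add: b_def)
  have a: "(norm (P (Y n)))\<^sup>2 - (norm (Y (Suc n)))\<^sup>2 \<le> \<rho> * b n" for n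
    using defect[OF QY[of n]] by (simp add: YS b_def)
  \<comment> \<open>The first defect of \<open>Q P y\<close> is at most the second defect of \<open>y\<close>, because \<open>\<parallel>Q v\<parallel>\<^sup>2 = \<langle>P Q v, v\<rangle>\<close>
    for \<open>v = P y\<close>.\<close>
  have bS: "b (Suc n) \<le> \<rho> * b n" for n
  proof -
    let ?v = "P (Y n)"
    have "complex_of_real ((norm (Q ?v))\<^sup>2) = cinner (P (Q ?v)) ?v"
      by (metis P.idem P.selfadjoint Q.cinner_proj(1))
    then have "(norm (Q ?v))\<^sup>2 \<le> norm (P (Q ?v)) * norm ?v"
      using cinner_Cauchy_Schwarz[of "P (Q ?v)" ?v] by (metis abs_of_nonneg norm_of_real zero_le_power2)
    then have "2 * (norm (Q ?v))\<^sup>2 \<le> (norm (P (Q ?v)))\<^sup>2 + (norm ?v)\<^sup>2"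
      using sum_squares_bound[of "norm (P (Q ?v))" "norm ?v"] by linarith
    then show ?thesis using a[of n] by (simp add: b_def YS)
  qed
  have bn: "b n \<le> \<rho> ^ n * b 0" for n
  proof (induction n)
    case (Suc n)
    then have "\<rho> * b n \<le> \<rho> * (\<rho> ^ n * b 0)" using \<rho> by (intro mult_left_mono)
    then show ?case using bS[of n] by (simp add: mult.assoc)
  qed simp
  have step: "norm (Y n - Y (Suc n)) \<le> sqrt (b 0) * sqrt \<rho> ^ n" for n
  proof -
    have "cinner (Y n) (Q (P (Y n))) = complex_of_real ((norm (P (Y n)))\<^sup>2)"
      by (metis P.cinner_proj(2) Q.selfadjoint QY)
    then have "(norm (Y n - Y (Suc n)))\<^sup>2 = (norm (Y n))\<^sup>2 - 2 * (norm (P (Y n)))\<^sup>2 + (norm (Y (Suc n)))\<^sup>2"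
      by (simp add: norm_diff_sq YS)
    also have "\<dots> \<le> b n"
      using Q.norm_le[of "P (Y n)"] by (simp add: b_def YS)
    also have "\<dots> \<le> (sqrt (b 0) * sqrt \<rho> ^ n)\<^sup>2"
    proof -
      have "(sqrt \<rho> ^ n)\<^sup>2 = \<rho> ^ n"
        by (metis \<rho>(1) mult.commute power_mult real_sqrt_pow2)
      then show ?thesis
        using bn[of n] b0[of 0] by (simp add: power_mult_distrib mult.commute)
    qed
    finally show ?thesis by (rule power2_le_imp_le) (use b0[of 0] \<rho> in simp)
  qed
  have "summable (\<lambda>n. sqrt (b 0) * sqrt \<rho> ^ n)"
    using \<rho> by (intro summable_mult summable_geometric) simp
  then have "summable (\<lambda>n. Y n - Y (Suc n))"
    by (rule summable_norm_cancel[OF summable_comparison_test'[where N = 0]]) (use step in simp)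
  then have "(\<lambda>n. \<Sum>i<n. Y i - Y (Suc i)) \<longlonglongrightarrow> (\<Sum>i. Y i - Y (Suc i))"
    by (rule summable_LIMSEQ)
  then have "(\<lambda>n. Y 0 - Y n) \<longlonglongrightarrow> (\<Sum>i. Y i - Y (Suc i))"
    by (simp only: sum_lessThan_telescope'[of Y])
  from tendsto_diff[OF tendsto_const[of "Y 0"] this]
  obtain z where z: "Y \<longlonglongrightarrow> z" by auto
  have blP: "bounded_linear P" and blQ: "bounded_linear Q"
    by (rule bounded_clinear_linear[OF P.bounded] bounded_clinear_linear[OF Q.bounded])+
  have "(\<lambda>n. Y (Suc n)) \<longlonglongrightarrow> Q (P z)"
    unfolding YS by (intro bounded_linear.tendsto[OF blQ] bounded_linear.tendsto[OF blP] z)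
  then have QPz: "Q (P z) = z"
    using LIMSEQ_unique LIMSEQ_Suc[OF z] by blast
  then have Qz: "Q z = z" using Q.idem by metis
  have "P z = z"
  proof (rule P.fixed_if_norm_eq, rule antisym[OF P.norm_le])
    show "norm z \<le> norm (P z)" using Q.norm_le[of "P z"] QPz by simp
  qed
  then have "z = 0" using Qz by (rule trivial)
  with z have "(\<lambda>n. (norm (Y n))\<^sup>2) \<longlonglongrightarrow> (norm (0::l2))\<^sup>2"
    by (intro tendsto_intros) simp
  then have lim: "(\<lambda>n. (norm y)\<^sup>2 - (norm (Y n))\<^sup>2) \<longlonglongrightarrow> (norm y)\<^sup>2 - 0"
    by (intro tendsto_intros) simp
  have "(1 - \<rho>) * ((norm y)\<^sup>2 - (norm (Y n))\<^sup>2) \<le> 2 * b 0" for n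
  proof -
    have "(norm y)\<^sup>2 - (norm (Y n))\<^sup>2 = (\<Sum>i<n. (norm (Y i))\<^sup>2 - (norm (Y (Suc i)))\<^sup>2)"
      using sum_lessThan_telescope'[of "\<lambda>i. (norm (Y i))\<^sup>2"] by (simp add: Y0)
    also have "\<dots> \<le> (\<Sum>i<n. 2 * b 0 * \<rho> ^ i)"
    proof (rule sum_mono)
      fix i
      have "\<rho> * b i \<le> 1 * b i" using \<rho> b0[of i] by (intro mult_right_mono) auto
      then have "(norm (Y i))\<^sup>2 - (norm (Y (Suc i)))\<^sup>2 \<le> 2 * b i"
        using a[of i] by (simp add: b_def)
      then show "(norm (Y i))\<^sup>2 - (norm (Y (Suc i)))\<^sup>2 \<le> 2 * b 0 * \<rho> ^ i"
        using bn[of i] by (simp add: mult.commute mult.left_commute)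
    qed
    also have "\<dots> = 2 * b 0 * (\<Sum>i<n. \<rho> ^ i)" by (simp add: sum_distrib_left)
    finally have "(1 - \<rho>) * ((norm y)\<^sup>2 - (norm (Y n))\<^sup>2) \<le> (1 - \<rho>) * (2 * b 0 * (\<Sum>i<n. \<rho> ^ i))"
      using \<rho> by (intro mult_left_mono) auto
    also have "\<dots> = 2 * b 0 * (1 - \<rho> ^ n)"
      using one_diff_power_eq[of \<rho> n] by (simp add: mult.commute mult.left_commute)
    also have "\<dots> \<le> 2 * b 0 * 1" using \<rho> b0[of 0] by (intro mult_left_mono) auto
    finally show ?thesis by simp
  qed
  then have "(1 - \<rho>) * ((norm y)\<^sup>2 - 0) \<le> 2 * b 0"
    by (intro Lim_bounded[OF tendsto_mult_left[OF lim]]) auto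
  then show ?thesis by (simp add: b_def Y0)
qed

text \<open>Excluding the point one from the numerical range makes zero the only common fixed vector. The
  ratio \<open>\<rho> = 2 k / (\<surd>3 - k)\<close> of the defects is smaller than one precisely when \<open>k < 1 / \<surd>3\<close>. As
  \<open>\<theta>\<close> may be negative, the slope is the tangent of its positive part.\<close>

lemma norm_less_one_if_subset_sector:
  assumes \<theta>: "\<theta> < pi/6"
    and sub: "numerical_range (P \<circ> Q) \<subseteq> {z. \<bar>Arg (1 - z)\<bar> \<le> \<theta>} - {1}"
  shows "onorm (P \<circ> Q) < 1"
proof -
  define k where "k = tan (max \<theta> 0)"
  have m: "0 \<le> max \<theta> 0" "max \<theta> 0 < pi/6"
    unfolding max_less_iff_conj using \<theta> by auto
  have k0: "0 \<le> k" unfolding k_def using m by (cases "max \<theta> 0 = 0") (auto intro!: less_imp_le[OF tan_gt_zero])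
  have "k < tan (pi/6)" unfolding k_def using m by (intro tan_monotone) auto
  then have k1: "sqrt 3 * k < 1" by (simp add: tan_30 field_simps)
  have unit: "\<bar>Im (cinner (P (Q x)) x)\<bar> \<le> k * (1 - Re (cinner (P (Q x)) x)) \<and> cinner (P (Q x)) x \<noteq> 1"
    if x: "norm x = 1" for x
  proof -
    let ?w = "cinner (P (Q x)) x"
    have "?w \<in> numerical_range (P \<circ> Q)" using x by (auto simp: numerical_range_def)
    then have w: "\<bar>Arg (1 - ?w)\<bar> \<le> \<theta>" "?w \<noteq> 1" using sub by auto
    then have "\<bar>Arg (1 - ?w)\<bar> < pi/2" using \<theta> pi_gt_zero by linarith
    then have re: "0 < Re (1 - ?w)" using w(2) unfolding Arg_Re_pos by auto
    define s where "s = Im (1 - ?w) / Re (1 - ?w)"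
    have "\<bar>arctan s\<bar> \<le> max \<theta> 0"
      using w(1) arg_conv_arctan[OF re] by (simp add: s_def)
    moreover have "tan \<bar>arctan s\<bar> = \<bar>s\<bar>"
      by (cases "0 \<le> arctan s") (auto simp: tan_arctan abs_if)
    moreover have "tan \<bar>arctan s\<bar> \<le> tan (max \<theta> 0)"
      using m pi_gt_zero calculation(1) by (intro tan_mono_le) auto
    ultimately have "\<bar>s\<bar> \<le> k" by (simp add: k_def)
    then have "\<bar>Im (1 - ?w)\<bar> \<le> k * Re (1 - ?w)"
      using re by (simp add: s_def abs_div field_simps)
    then show ?thesis using w(2) by simp
  qed
  have sector: "\<bar>Im (cinner (P (Q x)) x)\<bar> \<le> k * ((norm x)\<^sup>2 - Re (cinner (P (Q x)) x))" for x
  proof (cases "x = 0")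
    case False
    define r where "r = norm x"
    define u where "u = (1 / r) *\<^sub>R x"
    have r: "0 < r" using False by (simp add: r_def)
    have u: "norm u = 1" using r by (simp add: u_def r_def)
    have "x = r *\<^sub>R u" using r by (simp add: u_def)
    then have "cinner (P (Q x)) x = complex_of_real (r\<^sup>2) * cinner (P (Q u)) u"
      by (simp add: P.scaleR Q.scaleR cinner_scaleR_left cinner_scaleR_right power2_eq_square)
    then have "Im (cinner (P (Q x)) x) = r\<^sup>2 * Im (cinner (P (Q u)) u)"
      "Re (cinner (P (Q x)) x) = r\<^sup>2 * Re (cinner (P (Q u)) u)"
      by (simp_all del: of_real_power)
    then show ?thesis
      using mult_left_mono[OF conjunct1[OF unit[OF u]], of "r\<^sup>2"] r
      by (simp add: abs_mult algebra_simps flip: r_def)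
  qed simp
  have trivial: "f = 0" if "P f = f" "Q f = f" for f
  proof (rule ccontr)
    assume "f \<noteq> 0"
    then have "norm ((1 / norm f) *\<^sub>R f) = 1" by simp
    moreover from this have "cinner (P (Q ((1 / norm f) *\<^sub>R f))) ((1 / norm f) *\<^sub>R f) = 1"
      by (simp only: P.scaleR Q.scaleR that cinner_self) simp
    ultimately show False using unit by blast
  qed
  define \<rho> where "\<rho> = 2 * k / (sqrt 3 - k)"
  have "3 * k < sqrt 3"
  proof -
    have "sqrt 3 * (sqrt 3 * k) < sqrt 3 * 1" using k1 by (intro mult_strict_left_mono) auto
    then show ?thesis by (simp add: mult.assoc[symmetric])
  qed
  then have \<rho>: "0 \<le> \<rho>" "\<rho> < 1" using k0 by (auto simp: \<rho>_def field_simps)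
  have main: "(1 - \<rho>) * (norm y)\<^sup>2 \<le> 2 * ((norm y)\<^sup>2 - (norm (P y))\<^sup>2)" if "Q y = y" for y
    using norm_le_defect[OF \<rho> sector_defect[OF k0 k1 sector, folded \<rho>_def] trivial that] .
  define q where "q = sqrt (1 - (1 - \<rho>) / 2)"
  have q: "0 \<le> q" "q < 1" using \<rho> by (auto simp: q_def)
  have "norm (P (Q f)) \<le> q * norm f" for f
  proof -
    have "(norm (P (Q f)))\<^sup>2 \<le> (1 - (1 - \<rho>) / 2) * (norm (Q f))\<^sup>2"
      using main[of "Q f", OF Q.idem] by (simp add: field_simps)
    also have "\<dots> = (q * norm (Q f))\<^sup>2" using \<rho> by (simp add: q_def power_mult_distrib)
    finally have "norm (P (Q f)) \<le> q * norm (Q f)" by (rule power2_le_imp_le) (use q in simp)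
    also have "\<dots> \<le> q * norm f" using q by (intro mult_left_mono Q.norm_le) auto
    finally show ?thesis .
  qed
  then have "onorm (P \<circ> Q) \<le> q" by (intro onorm_bound q) auto
  with q show ?thesis by linarith
qed

end

section \<open>Multiplication by indicators and density of step functions\<close>

lemma square_integrable_mult_indicator:
  assumes "A \<in> sets lebesgue" "square_integrable f"
  shows "square_integrable (\<lambda>x. indicator A x * f x)"
proof -
  have [measurable]: "f \<in> borel_measurable lebesgue" "A \<in> sets lebesgue"
    using assms by (auto simp: square_integrable_def)
  have int: "integrable lebesgue (\<lambda>x. (cmod (f x))\<^sup>2)"
    using assms by (simp add: square_integrable_def)
  have "integrable lebesgue (\<lambda>x. (cmod (indicator A x * f x))\<^sup>2)"
  proof (rule Bochner_Integration.integrable_bound[OF int])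
    show "AE x in lebesgue. norm ((cmod (indicator A x * f x))\<^sup>2) \<le> norm ((cmod (f x))\<^sup>2)"
      by (rule AE_I2) (auto simp: indicator_def)
  qed measurable
  then show ?thesis by (simp add: square_integrable_def)
qed

lemma rep_time_proj:
  assumes "A \<in> sets lebesgue"
  shows "AE x in lebesgue. rep_l2 (time_proj A f) x = indicator A x * rep_l2 f x"
  unfolding time_proj_def mult_op_def
  by (rule rep_abs[OF square_integrable_mult_indicator[OF assms square_integrable_rep]])

lemma orthogonal_projection_time_proj:
  assumes A: "A \<in> sets lebesgue"
  shows "orthogonal_projection (time_proj A)"
proof
  note [measurable] = A
  note rep = rep_time_proj[OF A]
  show "cinner (time_proj A f) g = cinner f (time_proj A g)" for f g
    unfolding cinner_rep
  proof (rule integral_cong_AE)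
    show "AE x in lebesgue. rep_l2 (time_proj A f) x * cnj (rep_l2 g x) =
        rep_l2 f x * cnj (rep_l2 (time_proj A g) x)"
      using rep[of f] rep[of g] by eventually_elim (simp add: indicator_def)
  qed (auto intro!: borel_measurable_integrable square_integrable_mult_cnj square_integrable_rep)
  show idem: "time_proj A (time_proj A f) = time_proj A f" for f
  proof (rule l2_eqI)
    show "AE x in lebesgue. rep_l2 (time_proj A (time_proj A f)) x = rep_l2 (time_proj A f) x"
      using rep[of f] rep[of "time_proj A f"] by eventually_elim (simp add: indicator_def)
  qed
  show "bounded_clinear (time_proj A)"
  proof (rule bounded_clinearI[where K = 1])
    show "time_proj A (f + g) = time_proj A f + time_proj A g" for f g
    proof (rule l2_eqI)
      show "AE x in lebesgue. rep_l2 (time_proj A (f + g)) x = rep_l2 (time_proj A f + time_proj A g) x"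
        using rep[of f] rep[of g] rep[of "f + g"] rep_add[of f g]
          rep_add[of "time_proj A f" "time_proj A g"]
        by eventually_elim (simp add: distrib_left)
    qed
    show "time_proj A (c *\<^sub>C f) = c *\<^sub>C time_proj A f" for c f
    proof (rule l2_eqI)
      show "AE x in lebesgue. rep_l2 (time_proj A (c *\<^sub>C f)) x = rep_l2 (c *\<^sub>C time_proj A f) x"
        using rep[of f] rep[of "c *\<^sub>C f"] rep_scaleC[of c f] rep_scaleC[of c "time_proj A f"]
        by eventually_elim simp
    qed
    show "norm (time_proj A f) \<le> 1 * norm f" for f
    proof -
      have "(norm (time_proj A f))\<^sup>2 \<le> (norm f)\<^sup>2"
        unfolding norm_rep
      proof (rule integral_mono_AE[OF integrable_cmod_rep integrable_cmod_rep])
        show "AE x in lebesgue. (cmod (rep_l2 (time_proj A f) x))\<^sup>2 \<le> (cmod (rep_l2 f x))\<^sup>2"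
          using rep[of f] by eventually_elim (simp add: indicator_def)
      qed
      then show ?thesis by simp
    qed
  qed
qed

lemma l2_dominated_convergence:
  fixes u :: "nat \<Rightarrow> l2"
  assumes lim: "AE x in lebesgue. (\<lambda>n. rep_l2 (u n) x) \<longlonglongrightarrow> rep_l2 f x"
    and bound: "\<And>n. AE x in lebesgue. cmod (rep_l2 (u n) x) \<le> cmod (rep_l2 h x)"
  shows "u \<longlonglongrightarrow> f"
proof -
  have bound': "AE x in lebesgue. \<forall>n. cmod (rep_l2 (u n) x) \<le> cmod (rep_l2 h x)"
    unfolding AE_all_countable using bound by blast
  have diff: "AE x in lebesgue. \<forall>n. rep_l2 (u n - f) x = rep_l2 (u n) x - rep_l2 f x"
    unfolding AE_all_countable using rep_diff by blast
  have "(\<lambda>n. integral\<^sup>L lebesgue (\<lambda>x. (cmod (rep_l2 (u n - f) x))\<^sup>2))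
      \<longlonglongrightarrow> integral\<^sup>L lebesgue (\<lambda>x::real. 0)"
  proof (rule integral_dominated_convergence[where w = "\<lambda>x. 4 * (cmod (rep_l2 h x))\<^sup>2"])
    show "integrable lebesgue (\<lambda>x. 4 * (cmod (rep_l2 h x))\<^sup>2)"
      using integrable_cmod_rep by simp
    show "AE x in lebesgue. (\<lambda>n. (cmod (rep_l2 (u n - f) x))\<^sup>2) \<longlonglongrightarrow> 0"
      using lim diff
    proof eventually_elim
      case (elim x)
      have "(\<lambda>n. (cmod (rep_l2 (u n) x - rep_l2 f x))\<^sup>2) \<longlonglongrightarrow> (cmod (rep_l2 f x - rep_l2 f x))\<^sup>2"
        by (intro tendsto_intros elim)
      then show ?case using elim by simp
    qed
    show "AE x in lebesgue. norm ((cmod (rep_l2 (u n - f) x))\<^sup>2) \<le> 4 * (cmod (rep_l2 h x))\<^sup>2" for n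
      using lim bound' diff
    proof eventually_elim
      case (elim x)
      have "cmod (rep_l2 f x) \<le> cmod (rep_l2 h x)"
        by (rule Lim_bounded[OF tendsto_norm[OF elim(1)]]) (use elim(2) in auto)
      then have "cmod (rep_l2 (u n) x - rep_l2 f x) \<le> 2 * cmod (rep_l2 h x)"
        using elim(2) norm_triangle_ineq4[of "rep_l2 (u n) x" "rep_l2 f x"]
        by (smt (verit))
      then have "(cmod (rep_l2 (u n) x - rep_l2 f x))\<^sup>2 \<le> (2 * cmod (rep_l2 h x))\<^sup>2"
        by (intro power_mono) auto
      then show ?case using elim(3) by (simp add: power_mult_distrib)
    qed
  qed measurable
  then have "(\<lambda>n. (norm (u n - f))\<^sup>2) \<longlonglongrightarrow> 0"
    by (simp add: norm_rep)
  then have "(\<lambda>n. sqrt ((norm (u n - f))\<^sup>2)) \<longlonglongrightarrow> sqrt 0"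
    by (rule tendsto_real_sqrt)
  then have "(\<lambda>n. u n - f) \<longlonglongrightarrow> 0"
    by (simp add: tendsto_norm_zero_iff)
  then show ?thesis by (rule LIM_zero_cancel)
qed

text \<open>Half-open, so that truncating the indicator of a half-open interval gives another one.\<close>

definition window :: "nat \<Rightarrow> real set" where
  "window n = {- real n <.. real n}"

lemma window_sets [simp, measurable]: "window n \<in> sets lebesgue"
  by (simp add: window_def)

lemma eventually_in_window: "\<forall>\<^sub>F n in sequentially. x \<in> window n"
proof -
  obtain N where N: "\<bar>x\<bar> < real N" using reals_Archimedean2 by blast
  have "x \<in> window n" if "n \<ge> N" for n
  proof -
    have "\<bar>x\<bar> < real n" using N that by linarith
    then show ?thesis by (auto simp: window_def)
  qed
  then show ?thesis by (auto simp: eventually_sequentially)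
qed

lemma truncation_tendsto: "(\<lambda>n. time_proj (window n) f) \<longlonglongrightarrow> f"
proof (rule l2_dominated_convergence[where h = f])
  have "AE x in lebesgue. \<forall>n. rep_l2 (time_proj (window n) f) x = indicator (window n) x * rep_l2 f x"
    unfolding AE_all_countable using rep_time_proj[OF window_sets] by blast
  then show "AE x in lebesgue. (\<lambda>n. rep_l2 (time_proj (window n) f) x) \<longlonglongrightarrow> rep_l2 f x"
  proof eventually_elim
    case (elim x)
    have "\<forall>\<^sub>F n in sequentially. rep_l2 (time_proj (window n) f) x = rep_l2 f x"
      using eventually_in_window[of x] by eventually_elim (use elim in simp)
    then show ?case by (rule tendsto_eventually)
  qed
  show "AE x in lebesgue. cmod (rep_l2 (time_proj (window n) f) x) \<le> cmod (rep_l2 f x)" for n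
    using rep_time_proj[OF window_sets[of n], of f] by eventually_elim (simp add: indicator_def)
qed

lemma square_integrable_indicator:
  assumes "A \<in> lmeasurable"
  shows "square_integrable (indicator A)"
proof -
  have eq: "(\<lambda>x. (cmod (indicator A x))\<^sup>2) = (indicator A :: real \<Rightarrow> real)"
    by (auto simp: indicator_def)
  have [measurable]: "A \<in> sets lebesgue" using assms by blast
  show ?thesis
    unfolding square_integrable_def eq
    using assms by (auto simp: fmeasurable_def intro!: integrable_real_indicator)
qed

definition ind :: "real set \<Rightarrow> l2" where
  "ind A = abs_l2 (indicator A)"

lemma rep_ind: "A \<in> lmeasurable \<Longrightarrow> AE x in lebesgue. rep_l2 (ind A) x = indicator A x"
  unfolding ind_def by (rule rep_abs[OF square_integrable_indicator])

lemma ind_empty [simp]: "ind {} = 0"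
proof (rule l2_eqI)
  show "AE x in lebesgue. rep_l2 (ind {}) x = rep_l2 0 x"
    using rep_ind[of "{}"] rep_abs[OF square_integrable_zero] by (auto simp: zero_l2_def)
qed

lemma lmeasurable_Ioc [simp]: "{a<..b::real} \<in> lmeasurable"
  by (cases "a \<le> b") (auto simp: fmeasurable_def)

lemma lmeasurable_Int_window: "A \<in> sets lebesgue \<Longrightarrow> A \<inter> window n \<in> lmeasurable"
  by (rule fmeasurable_Int_fmeasurable[of "window n", simplified Int_commute])
    (auto simp: window_def)

lemma ind_cong:
  assumes "A \<in> lmeasurable" "B \<in> lmeasurable" "AE x in lebesgue. x \<in> A \<longleftrightarrow> x \<in> B"
  shows "ind A = ind B"
proof (rule l2_eqI)
  show "AE x in lebesgue. rep_l2 (ind A) x = rep_l2 (ind B) x"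
    using rep_ind[OF assms(1)] rep_ind[OF assms(2)] assms(3)
    by eventually_elim (simp add: indicator_def)
qed

text \<open>A closed complex subspace containing the indicators of bounded intervals is everything:
  the sets whose truncated indicators belong to it form a Dynkin system, and simple functions
  approximate in \<open>L\<^sub>2\<close> by dominated convergence.\<close>

lemma l2_induct [case_names ind add scale limit]:
  assumes ind: "\<And>a b. Pr (ind {a<..b})"
    and add: "\<And>f g. Pr f \<Longrightarrow> Pr g \<Longrightarrow> Pr (f + g)"
    and scale: "\<And>c f. Pr f \<Longrightarrow> Pr (c *\<^sub>C f)"
    and limit: "\<And>(u :: nat \<Rightarrow> l2) f. (\<And>n. Pr (u n)) \<Longrightarrow> u \<longlonglongrightarrow> f \<Longrightarrow> Pr f"
  shows "Pr f"
proof -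
  have zero: "Pr 0" using scale[of _ 0] ind by fastforce
  have diff: "Pr (f - g)" if "Pr f" "Pr g" for f g
    using add[OF that(1) scale[OF that(2), of "-1"]] by (simp add: scaleC_minus_one)
  have sum: "Pr (\<Sum>i\<in>I. v i)" if "finite I" "\<And>i. i \<in> I \<Longrightarrow> Pr (v i)" for I and v :: "complex \<Rightarrow> l2"
    using that by (induction I rule: finite_induct) (auto simp: zero add)
  have borel: "Pr (ind (A \<inter> window n))" if "A \<in> sets borel" for A n
  proof -
    let ?G = "range (\<lambda>(a, b). {a<..b::real})"
    have eq: "sets borel = sigma_sets UNIV ?G"
      by (subst borel_sigma_sets_Ioc) (simp add: sets_measure_of)
    have Int: "Int_stable ?G" by (auto simp: Int_stable_def)
    have sub: "?G \<subseteq> Pow UNIV" by simp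
    have "A \<in> sigma_sets UNIV ?G" using that eq by simp
    from Int sub this show ?thesis
    proof (induction A rule: sigma_sets_induct_disjoint)
      case (basic A)
      then obtain a b where "A = {a<..b}" by auto
      then have "A \<inter> window n = {max a (- real n)<..min b (real n)}" by (auto simp: window_def)
      then show ?case using ind by simp
    next
      case empty
      then show ?case using zero by simp
    next
      case (compl A)
      then have A: "A \<in> sets lebesgue" using eq by auto
      have "ind ((UNIV - A) \<inter> window n) = ind (UNIV \<inter> window n) - ind (A \<inter> window n)"
      proof (rule l2_eqI)
        have 1: "(UNIV - A) \<inter> window n \<in> lmeasurable" "UNIV \<inter> window n \<in> lmeasurable"
          "A \<inter> window n \<in> lmeasurable"
          using A by (intro lmeasurable_Int_window; auto)+
        show "AE x in lebesgue. rep_l2 (ind ((UNIV - A) \<inter> window n)) x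
            = rep_l2 (ind (UNIV \<inter> window n) - ind (A \<inter> window n)) x"
          using 1[THEN rep_ind] rep_diff[of "ind (UNIV \<inter> window n)" "ind (A \<inter> window n)"]
          by eventually_elim (auto simp: indicator_def)
      qed
      moreover have "Pr (ind (UNIV \<inter> window n))" using ind by (simp add: window_def)
      ultimately show ?case using compl diff by simp
    next
      case (union A)
      have A: "A i \<in> sets lebesgue" for i
      proof -
        have "A i \<in> sets borel" using union(2) eq by blast
        then show ?thesis by simp
      qed
      have Am: "A i \<inter> window n \<in> lmeasurable" for i using A by (rule lmeasurable_Int_window)
      have Um: "(\<Union>i. A i) \<inter> window n \<in> lmeasurable" using A by (intro lmeasurable_Int_window) auto
      have part: "(\<Union>i<k. A i) \<inter> window n \<in> lmeasurable" for k
        using A by (intro lmeasurable_Int_window) auto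
      have parts: "Pr (ind ((\<Union>i<k. A i) \<inter> window n))" for k
      proof (induction k)
        case 0
        then show ?case using zero by simp
      next
        case (Suc k)
        have "ind ((\<Union>i<Suc k. A i) \<inter> window n)
            = ind ((\<Union>i<k. A i) \<inter> window n) + ind (A k \<inter> window n)"
        proof (rule l2_eqI)
          have disj: "x \<notin> A i" if "x \<in> A k" "i < k" for x i
            using disjoint_family_onD[OF union(1), of k i] that by auto
          show "AE x in lebesgue. rep_l2 (ind ((\<Union>i<Suc k. A i) \<inter> window n)) x
              = rep_l2 (ind ((\<Union>i<k. A i) \<inter> window n) + ind (A k \<inter> window n)) x"
            using rep_ind[OF part[of "Suc k"]] rep_ind[OF part[of k]] rep_ind[OF Am[of k]]
              rep_add[of "ind ((\<Union>i<k. A i) \<inter> window n)" "ind (A k \<inter> window n)"]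
            by eventually_elim (use disj in \<open>auto simp: indicator_def less_Suc_eq\<close>)
        qed
        then show ?case using add Suc union(3) by simp
      qed
      have "(\<lambda>k. ind ((\<Union>i<k. A i) \<inter> window n)) \<longlonglongrightarrow> ind ((\<Union>i. A i) \<inter> window n)"
      proof (rule l2_dominated_convergence[where h = "ind ((\<Union>i. A i) \<inter> window n)"])
        have all: "AE x in lebesgue. \<forall>k. rep_l2 (ind ((\<Union>i<k. A i) \<inter> window n)) x
            = indicator ((\<Union>i<k. A i) \<inter> window n) x"
          unfolding AE_all_countable using rep_ind[OF part] by blast
        from all rep_ind[OF Um]
        show "AE x in lebesgue. (\<lambda>k. rep_l2 (ind ((\<Union>i<k. A i) \<inter> window n)) x)
            \<longlonglongrightarrow> rep_l2 (ind ((\<Union>i. A i) \<inter> window n)) x"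
        proof eventually_elim
          case (elim x)
          have "\<forall>\<^sub>F k in sequentially. indicator ((\<Union>i<k. A i) \<inter> window n) x
              = (indicator ((\<Union>i. A i) \<inter> window n) x :: complex)"
          proof (cases "\<exists>i. x \<in> A i")
            case True
            then obtain i where "x \<in> A i" by blast
            then show ?thesis
              unfolding eventually_sequentially by (intro exI[of _ "Suc i"]) (auto simp: indicator_def)
          qed (auto simp: indicator_def)
          then show ?case using elim by (simp add: tendsto_eventually)
        qed
        show "AE x in lebesgue. cmod (rep_l2 (ind ((\<Union>i<k. A i) \<inter> window n)) x)
            \<le> cmod (rep_l2 (ind ((\<Union>i. A i) \<inter> window n)) x)" for k
          using rep_ind[OF part[of k]] rep_ind[OF Um]
          by eventually_elim (auto simp: indicator_def)
      qed
      then show ?case by (rule limit[OF parts])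
    qed
  qed
  have leb: "Pr (ind (A \<inter> window n))" if A: "A \<in> sets lebesgue" for A n
  proof -
    have "main_part lborel A \<in> sets borel" using main_part_sets[OF A] by simp
    then have "Pr (ind (main_part lborel A \<inter> window n))" by (rule borel)
    moreover have "ind (main_part lborel A \<inter> window n) = ind (A \<inter> window n)"
    proof (rule ind_cong)
      show "main_part lborel A \<inter> window n \<in> lmeasurable"
        using main_part_sets[OF A] by (intro lmeasurable_Int_window) auto
      show "A \<inter> window n \<in> lmeasurable" by (rule lmeasurable_Int_window[OF A])
      have "AE x in lebesgue. x \<in> main_part lborel A \<longleftrightarrow> x \<in> A"
        by (rule AE_completion[OF AE_in_main_part[OF A]])
      then show "AE x in lebesgue. x \<in> main_part lborel A \<inter> window n \<longleftrightarrow> x \<in> A \<inter> window n"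
        by eventually_elim auto
    qed
    ultimately show ?thesis by simp
  qed
  obtain s where s: "\<And>i. simple_function lebesgue (s i)"
    "\<And>x. (\<lambda>i. s i x) \<longlonglongrightarrow> rep_l2 f x" "\<And>i x. cmod (s i x) \<le> 2 * cmod (rep_l2 f x)"
    using borel_measurable_implies_sequence_metric[OF measurable_rep[of f], of 0] by auto
  define v where "v i = (\<Sum>c\<in>range (s i). c *\<^sub>C ind (s i -` {c} \<inter> window i))" for i
  have fin: "finite (range (s i))" for i using simple_functionD(1)[OF s(1)[of i]] by simp
  have vim: "s i -` {c} \<in> sets lebesgue" for i c
    using simple_functionD(2)[OF s(1)[of i], of "{c}"] by simp
  have Prv: "Pr (v i)" for i
    unfolding v_def using fin vim by (intro sum scale leb)
  have rep_sum: "AE x in lebesgue. rep_l2 (\<Sum>c\<in>C. c *\<^sub>C ind (s i -` {c} \<inter> window i)) x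
      = (\<Sum>c\<in>C. c * indicator (s i -` {c} \<inter> window i) x)" if "finite C" for C i
    using that
  proof (induction C rule: finite_induct)
    case empty
    then show ?case using rep_abs[OF square_integrable_zero] by (auto simp: zero_l2_def)
  next
    case (insert c C)
    show ?case
      using insert(3) rep_add[of "c *\<^sub>C ind (s i -` {c} \<inter> window i)" "\<Sum>c\<in>C. c *\<^sub>C ind (s i -` {c} \<inter> window i)"]
        rep_scaleC[of c "ind (s i -` {c} \<inter> window i)"] rep_ind[OF lmeasurable_Int_window[OF vim], of i c i]
      by eventually_elim (simp only: sum.insert[OF insert(1,2)])
  qed
  have rep_v: "AE x in lebesgue. rep_l2 (v i) x = indicator (window i) x * s i x" for i
    using rep_sum[OF fin, of i i]
  proof eventually_elim
    case (elim x)
    have "(\<Sum>c\<in>range (s i). c * indicator (s i -` {c} \<inter> window i) x)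
        = (\<Sum>c\<in>range (s i). if c = s i x then c * indicator (window i) x else 0)"
      by (intro sum.cong) (auto simp: indicator_def)
    also have "\<dots> = indicator (window i) x * s i x"
      using fin[of i] by (simp add: sum.delta)
    finally show ?case using elim by (simp add: v_def)
  qed
  have "v \<longlonglongrightarrow> f"
  proof (rule l2_dominated_convergence[where h = "2 *\<^sub>C f"])
    have "AE x in lebesgue. \<forall>i. rep_l2 (v i) x = indicator (window i) x * s i x"
      unfolding AE_all_countable using rep_v by blast
    then show "AE x in lebesgue. (\<lambda>i. rep_l2 (v i) x) \<longlonglongrightarrow> rep_l2 f x"
    proof eventually_elim
      case (elim x)
      have "\<forall>\<^sub>F i in sequentially. s i x = rep_l2 (v i) x"
        using eventually_in_window[of x] by eventually_elim (use elim in simp)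
      with s(2)[of x] show ?case by (rule Lim_transform_eventually)
    qed
    show "AE x in lebesgue. cmod (rep_l2 (v i) x) \<le> cmod (rep_l2 (2 *\<^sub>C f) x)" for i
      using rep_v[of i] rep_scaleC[of 2 f]
      by eventually_elim (use s(3) in \<open>auto simp: indicator_def norm_mult\<close>)
  qed
  with Prv show ?thesis by (rule limit)
qed

section \<open>Reflection\<close>

lemma lebesgue_distr_uminus: "distr lebesgue lebesgue uminus = (lebesgue :: real measure)"
  using lebesgue_real_affine[of "-1" 0] by (simp add: density_1 fun_Compl_def)

lemma measurable_uminus_lebesgue [measurable]: "uminus \<in> lebesgue \<rightarrow>\<^sub>M (lebesgue :: real measure)"
  using lebesgue_affine_measurable[where c = "\<lambda>_::real. -1" and t = 0] by (simp add: fun_Compl_def)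

lemma AE_reflect:
  assumes "AE x in lebesgue. Q x"
  shows "AE x in lebesgue. Q (- x :: real)"
  by (rule AE_distrD[OF measurable_uminus_lebesgue]) (unfold lebesgue_distr_uminus, rule assms)

lemma measurable_reflect:
  fixes f :: "real \<Rightarrow> 'a::topological_space"
  assumes "f \<in> borel_measurable lebesgue"
  shows "(\<lambda>x. f (- x)) \<in> borel_measurable lebesgue"
  by (rule measurable_compose[OF measurable_uminus_lebesgue assms])

lemma integrable_reflect:
  fixes f :: "real \<Rightarrow> 'a::{banach, second_countable_topology}"
  assumes "integrable lebesgue f"
  shows "integrable lebesgue (\<lambda>x. f (- x))"
  by (rule integrable_distr[OF measurable_uminus_lebesgue]) (simp add: lebesgue_distr_uminus assms)

lemma integral_reflect_lebesgue:
  fixes f :: "real \<Rightarrow> 'a::{banach, second_countable_topology}"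
  assumes "f \<in> borel_measurable lebesgue"
  shows "(LINT x|lebesgue. f (- x)) = integral\<^sup>L lebesgue f"
  using integral_distr[OF measurable_uminus_lebesgue assms] by (simp add: lebesgue_distr_uminus)

lemma square_integrable_reflect: "square_integrable f \<Longrightarrow> square_integrable (\<lambda>x. f (- x))"
  using integrable_reflect[of "\<lambda>x. (cmod (f x))\<^sup>2"] by (auto simp: square_integrable_def measurable_reflect)

definition reflect :: "l2 \<Rightarrow> l2" where
  "reflect f = abs_l2 (\<lambda>x. rep_l2 f (- x))"

lemma rep_reflect: "AE x in lebesgue. rep_l2 (reflect f) x = rep_l2 f (- x)"
  unfolding reflect_def by (rule rep_abs[OF square_integrable_reflect[OF square_integrable_rep]])

lemma reflect_reflect [simp]: "reflect (reflect f) = f"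
proof (rule l2_eqI)
  show "AE x in lebesgue. rep_l2 (reflect (reflect f)) x = rep_l2 f x"
    using rep_reflect[of "reflect f"] AE_reflect[OF rep_reflect[of f]] by eventually_elim simp
qed

lemma norm_reflect [simp]: "norm (reflect f) = norm f"
proof -
  have "(norm (reflect f))\<^sup>2 = (LINT x|lebesgue. (cmod (rep_l2 f (- x)))\<^sup>2)"
    unfolding reflect_def by (rule norm_abs[OF square_integrable_reflect[OF square_integrable_rep]])
  also have "\<dots> = (norm f)\<^sup>2"
    unfolding norm_rep by (rule integral_reflect_lebesgue) measurable
  finally show ?thesis by simp
qed

lemma bounded_clinear_reflect: "bounded_clinear reflect"
proof (rule bounded_clinearI[where K = 1])
  show "reflect (f + g) = reflect f + reflect g" for f g
  proof (rule l2_eqI)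
    show "AE x in lebesgue. rep_l2 (reflect (f + g)) x = rep_l2 (reflect f + reflect g) x"
      using rep_reflect[of "f + g"] rep_reflect[of f] rep_reflect[of g]
        AE_reflect[OF rep_add[of f g]] rep_add[of "reflect f" "reflect g"]
      by eventually_elim simp
  qed
  show "reflect (c *\<^sub>C f) = c *\<^sub>C reflect f" for c f
  proof (rule l2_eqI)
    show "AE x in lebesgue. rep_l2 (reflect (c *\<^sub>C f)) x = rep_l2 (c *\<^sub>C reflect f) x"
      using rep_reflect[of "c *\<^sub>C f"] rep_reflect[of f] AE_reflect[OF rep_scaleC[of c f]]
        rep_scaleC[of c "reflect f"]
      by eventually_elim simp
  qed
qed simp

section \<open>The Fourier integral\<close>

lemma cmod_fourier_kernel [simp]: "cmod (exp (- \<i> * complex_of_real r)) = 1"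
  using norm_exp_i_times[of "- r"] by simp

lemma continuous_imp_measurable_lebesgue:
  fixes f :: "real \<Rightarrow> 'a::topological_space"
  shows "continuous_on UNIV f \<Longrightarrow> f \<in> borel_measurable lebesgue"
  by (intro measurable_completion) (simp add: borel_measurable_continuous_onI)

lemma measurable_fourier_integrand [measurable]:
  assumes [measurable]: "f \<in> borel_measurable lebesgue"
  shows "(\<lambda>x. f x * exp (- \<i> * complex_of_real (x * \<xi>))) \<in> borel_measurable lebesgue"
proof -
  have [measurable]: "(\<lambda>x. exp (- \<i> * complex_of_real (x * \<xi>))) \<in> borel_measurable lebesgue"
    by (intro continuous_imp_measurable_lebesgue continuous_intros)
  show ?thesis by measurable
qed

lemma integrable_fourier_integrand:
  assumes "integrable lebesgue f"
  shows "integrable lebesgue (\<lambda>x. f x * exp (- \<i> * complex_of_real (x * \<xi>)))"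
proof (rule Bochner_Integration.integrable_bound[OF assms])
  show "AE x in lebesgue. norm (f x * exp (- \<i> * complex_of_real (x * \<xi>))) \<le> norm (f x)"
    by (rule AE_I2) (simp only: norm_mult cmod_fourier_kernel mult_1_right order_refl)
qed (use assms in measurable)

lemma fourier_integral_cong:
  assumes "f \<in> borel_measurable lebesgue" "g \<in> borel_measurable lebesgue"
    "AE x in lebesgue. f x = g x"
  shows "fourier_integral f \<xi> = fourier_integral g \<xi>"
  unfolding fourier_integral_def
  by (intro arg_cong2[where f = "(*)"] refl integral_cong_AE measurable_fourier_integrand)
    (use assms in auto)

lemma fourier_integral_add:
  assumes "integrable lebesgue f" "integrable lebesgue g"
  shows "fourier_integral (\<lambda>x. f x + g x) \<xi> = fourier_integral f \<xi> + fourier_integral g \<xi>"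
  unfolding fourier_integral_def
  using assms[THEN integrable_fourier_integrand, of \<xi>]
  by (simp add: distrib_right distrib_left)

lemma fourier_integral_cmult:
  "fourier_integral (\<lambda>x. c * f x) \<xi> = c * fourier_integral f \<xi>"
  unfolding fourier_integral_def by (simp add: mult.assoc mult.left_commute)

lemma norm_fourier_integral_le:
  "cmod (fourier_integral f \<xi>) \<le> 1 / sqrt (2 * pi) * (LINT x|lebesgue. cmod (f x))"
proof -
  have "cmod (LINT x|lebesgue. f x * exp (- \<i> * complex_of_real (x * \<xi>)))
      \<le> (LINT x|lebesgue. cmod (f x * exp (- \<i> * complex_of_real (x * \<xi>))))"
    by (rule integral_norm_bound)
  also have "\<dots> = (LINT x|lebesgue. cmod (f x))"
    by (simp only: norm_mult cmod_fourier_kernel mult_1_right)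
  finally have *: "cmod (LINT x|lebesgue. f x * exp (- \<i> * complex_of_real (x * \<xi>)))
      \<le> (LINT x|lebesgue. cmod (f x))" .
  have "cmod (complex_of_real (1 / sqrt (2 * pi))) = 1 / sqrt (2 * pi)"
    unfolding norm_of_real by simp
  then show ?thesis
    unfolding fourier_integral_def norm_mult by (simp only:) (rule mult_left_mono[OF *], simp)
qed

lemma continuous_fourier_integral:
  assumes f: "integrable lebesgue f"
  shows "continuous_on UNIV (fourier_integral f)"
proof -
  have [measurable]: "f \<in> borel_measurable lebesgue" using f by simp
  have "isCont (\<lambda>\<xi>. LINT x|lebesgue. f x * exp (- \<i> * complex_of_real (x * \<xi>))) \<xi>" for \<xi>
    unfolding continuous_at_sequentially o_def
  proof (intro allI impI)
    fix u :: "nat \<Rightarrow> real" assume u: "u \<longlonglongrightarrow> \<xi>"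
    show "(\<lambda>n. LINT x|lebesgue. f x * exp (- \<i> * complex_of_real (x * u n)))
        \<longlonglongrightarrow> (LINT x|lebesgue. f x * exp (- \<i> * complex_of_real (x * \<xi>)))"
    proof (rule integral_dominated_convergence[where w = "\<lambda>x. cmod (f x)"])
      show "AE x in lebesgue. (\<lambda>n. f x * exp (- \<i> * complex_of_real (x * u n)))
          \<longlonglongrightarrow> f x * exp (- \<i> * complex_of_real (x * \<xi>))"
        by (intro AE_I2 tendsto_intros u)
      show "AE x in lebesgue. norm (f x * exp (- \<i> * complex_of_real (x * u n))) \<le> cmod (f x)" for n
        by (rule AE_I2) (simp only: norm_mult cmod_fourier_kernel mult_1_right order_refl)
    qed (rule measurable_fourier_integrand[OF borel_measurable_integrable[OF f]]
        integrable_norm[OF f])+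
  qed
  then show ?thesis
    unfolding fourier_integral_def
    by (intro continuous_on_mult continuous_on_const continuous_at_imp_continuous_on ballI)
qed

lemma measurable_fourier_integral:
  "integrable lebesgue f \<Longrightarrow> fourier_integral f \<in> borel_measurable lebesgue"
  by (intro continuous_imp_measurable_lebesgue continuous_fourier_integral)

lemma fourier_integral_reflect:
  assumes "f \<in> borel_measurable lebesgue"
  shows "fourier_integral (\<lambda>x. f (- x)) \<xi> = fourier_integral f (- \<xi>)"
proof -
  have "(LINT x|lebesgue. f (- x) * exp (- \<i> * complex_of_real (x * \<xi>)))
      = (LINT x|lebesgue. f x * exp (- \<i> * complex_of_real (x * (- \<xi>))))"
    using integral_reflect_lebesgue[OF measurable_fourier_integrand[OF assms, of "- \<xi>"]] by simp
  then show ?thesis unfolding fourier_integral_def by simp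
qed

lemma sigma_finite_lebesgue: "sigma_finite_measure (lebesgue :: real measure)"
proof
  obtain A :: "real set set" where A: "countable A" "A \<subseteq> sets lborel" "\<Union>A = space lborel"
    "\<forall>a\<in>A. emeasure lborel a \<noteq> \<infinity>"
    using lborel.sigma_finite_countable by blast
  then show "\<exists>A :: real set set. countable A \<and> A \<subseteq> sets lebesgue \<and> \<Union>A = space lebesgue \<and>
      (\<forall>a\<in>A. emeasure lebesgue a \<noteq> \<infinity>)"
    by (intro exI[of _ A]) (auto dest: subsetD)
qed

text \<open>The multiplication formula: by Fubini the adjoint of the Fourier integral is the reflected
  Fourier integral.\<close>

lemma fourier_integral_adjoint:
  assumes f: "integrable lebesgue f" and g: "integrable lebesgue g"
  shows "(LINT \<xi>|lebesgue. fourier_integral f \<xi> * cnj (g \<xi>))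
    = (LINT x|lebesgue. f x * cnj (fourier_integral g (- x)))"
proof -
  interpret sigma_finite_measure "lebesgue :: real measure" by (rule sigma_finite_lebesgue)
  interpret pair_sigma_finite "lebesgue :: real measure" "lebesgue :: real measure" ..
  define h where "h x \<xi> = f x * cnj (g \<xi>) * exp (- \<i> * complex_of_real (x * \<xi>))" for x \<xi>
  have [measurable]: "f \<in> borel_measurable lebesgue" "g \<in> borel_measurable lebesgue" using f g by auto
  have id [measurable]: "(\<lambda>x. x) \<in> borel_measurable (lebesgue :: real measure)"
    by (rule measurable_completion) simp
  have cnj [measurable]: "cnj \<in> borel_measurable borel"
    by (intro borel_measurable_continuous_onI continuous_intros)
  have ex [measurable]: "(\<lambda>r. exp (- \<i> * complex_of_real r)) \<in> borel_measurable borel"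
    by (intro borel_measurable_continuous_onI continuous_intros)
  have [measurable]: "fst \<in> borel_measurable ((lebesgue :: real measure) \<Otimes>\<^sub>M (lebesgue :: real measure))"
    using measurable_compose[OF measurable_fst id] by simp
  have [measurable]: "snd \<in> borel_measurable ((lebesgue :: real measure) \<Otimes>\<^sub>M (lebesgue :: real measure))"
    using measurable_compose[OF measurable_snd id] by simp
  have "(\<lambda>p. fst p * snd p) \<in> borel_measurable ((lebesgue :: real measure) \<Otimes>\<^sub>M (lebesgue :: real measure))"
    by measurable
  then have [measurable]: "(\<lambda>p. exp (- \<i> * complex_of_real (fst p * snd p)))
      \<in> borel_measurable ((lebesgue :: real measure) \<Otimes>\<^sub>M (lebesgue :: real measure))"
    by (rule measurable_compose[OF _ ex])
  have hm: "case_prod h \<in> borel_measurable (lebesgue \<Otimes>\<^sub>M lebesgue)"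
    unfolding h_def case_prod_beta by measurable
  have norm_h: "norm (h x \<xi>) = cmod (f x) * cmod (g \<xi>)" for x \<xi>
    unfolding h_def norm_mult cmod_fourier_kernel by simp
  have "integrable (lebesgue \<Otimes>\<^sub>M lebesgue) (case_prod h)"
  proof (rule Fubini_integrable[OF hm])
    have "(\<lambda>x. LINT \<xi>|lebesgue. norm (case_prod h (x, \<xi>)))
        = (\<lambda>x. cmod (f x) * (LINT \<xi>|lebesgue. cmod (g \<xi>)))"
      by (simp add: norm_h)
    then show "integrable lebesgue (\<lambda>x. LINT \<xi>|lebesgue. norm (case_prod h (x, \<xi>)))"
      using f by simp
    show "AE x in lebesgue. integrable lebesgue (\<lambda>\<xi>. case_prod h (x, \<xi>))"
    proof (rule AE_I2)
      fix x
      have "integrable lebesgue (\<lambda>\<xi>. cnj (g \<xi>) * exp (- \<i> * complex_of_real (\<xi> * x)))"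
        using g by (intro integrable_fourier_integrand) simp
      then show "integrable lebesgue (\<lambda>\<xi>. case_prod h (x, \<xi>))"
        by (simp add: h_def mult.assoc mult.commute[of x])
    qed
  qed
  then have fub: "(LINT \<xi>|lebesgue. LINT x|lebesgue. h x \<xi>) = (LINT x|lebesgue. LINT \<xi>|lebesgue. h x \<xi>)"
    by (rule Fubini_integral)
  let ?c = "complex_of_real (1 / sqrt (2 * pi))"
  have left: "fourier_integral f \<xi> * cnj (g \<xi>) = ?c * (LINT x|lebesgue. h x \<xi>)" for \<xi>
  proof -
    have "(LINT x|lebesgue. h x \<xi>) = (LINT x|lebesgue. f x * exp (- \<i> * complex_of_real (x * \<xi>)) * cnj (g \<xi>))"
      by (simp add: h_def mult_ac)
    also have "\<dots> = (LINT x|lebesgue. f x * exp (- \<i> * complex_of_real (x * \<xi>))) * cnj (g \<xi>)"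
      by (rule integral_mult_left_zero)
    finally show ?thesis unfolding fourier_integral_def by (simp add: mult.assoc)
  qed
  have right: "f x * cnj (fourier_integral g (- x)) = ?c * (LINT \<xi>|lebesgue. h x \<xi>)" for x
  proof -
    have "cnj (LINT \<xi>|lebesgue. g \<xi> * exp (- \<i> * complex_of_real (\<xi> * - x)))
        = (LINT \<xi>|lebesgue. cnj (g \<xi> * exp (- \<i> * complex_of_real (\<xi> * - x))))"
      by (rule Bochner_Integration.integral_cnj[symmetric])
    also have "\<dots> = (LINT \<xi>|lebesgue. cnj (g \<xi>) * exp (- \<i> * complex_of_real (x * \<xi>)))"
      by (simp add: exp_cnj mult_ac)
    finally have "f x * cnj (LINT \<xi>|lebesgue. g \<xi> * exp (- \<i> * complex_of_real (\<xi> * - x)))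
        = (LINT \<xi>|lebesgue. h x \<xi>)"
      by (simp add: h_def mult.assoc)
    then show ?thesis unfolding fourier_integral_def by (simp add: mult_ac)
  qed
  show ?thesis unfolding left right by (simp add: fub)
qed

section \<open>Plancherel for step functions\<close>

lemma integrable_indicator_Ioc: "integrable lebesgue (indicator {a<..b::real} :: real \<Rightarrow> complex)"
proof -
  have "integrable lebesgue (\<lambda>x. complex_of_real (indicator {a<..b} x))"
    using lmeasurable_Ioc[of a b]
    by (intro integrable_of_real integrable_real_indicator) (auto simp: fmeasurable_def)
  then show ?thesis by (simp add: of_real_indicator)
qed

lemma integral_kernel_Ioc:
  assumes "a \<le> b" "t \<noteq> 0"
  shows "(LINT x|lebesgue. indicator {a<..b} x * exp (- \<i> * complex_of_real (x * t)))
    = (iexp (- (t * a)) - iexp (- (t * b))) / (\<i> * t)"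
proof -
  define G where "G x = iexp (- (t * x)) / (- \<i> * t)" for x
  have "(G has_vector_derivative iexp (- (t * x))) (at x within A)" for x A
    unfolding G_def using \<open>t \<noteq> 0\<close>
    by (auto intro!: derivative_eq_intros has_vector_derivative_real_field simp: field_simps)
  then have "(LBINT x=a..b. iexp (- (t * x))) = G b - G a"
    using \<open>a \<le> b\<close> by (intro interval_integral_FTC_finite) (auto intro!: continuous_intros)
  moreover have "(LBINT x=a..b. iexp (- (t * x))) = (LINT x|lborel. indicator {a<..b} x *\<^sub>R iexp (- (t * x)))"
    using \<open>a \<le> b\<close> by (simp add: interval_integral_Ioc set_lebesgue_integral_def)
  moreover have "(LINT x|lborel. indicator {a<..b} x *\<^sub>R iexp (- (t * x)))
      = (LINT x|lebesgue. indicator {a<..b} x * exp (- \<i> * complex_of_real (x * t)))"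
  proof (subst integral_completion[symmetric])
    show "(\<lambda>x. indicator {a<..b} x *\<^sub>R iexp (- (t * x))) \<in> borel_measurable lborel"
      by simp
  qed (auto intro!: Bochner_Integration.integral_cong simp: indicator_def mult.commute)
  ultimately show ?thesis using \<open>t \<noteq> 0\<close> by (simp add: G_def field_simps)
qed

abbreviation ft_Ioc :: "real \<Rightarrow> real \<Rightarrow> real \<Rightarrow> complex" where
  "ft_Ioc a b \<equiv> fourier_integral (indicator {a<..b})"

lemma ft_Ioc_eq:
  assumes "a \<le> b" "t \<noteq> 0"
  shows "ft_Ioc a b t = complex_of_real (1 / sqrt (2 * pi)) * ((iexp (- (t * a)) - iexp (- (t * b))) / (\<i> * t))"
  unfolding fourier_integral_def integral_kernel_Ioc[OF assms] ..

lemma continuous_ft_Ioc: "continuous_on UNIV (ft_Ioc a b)"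
  by (rule continuous_fourier_integral[OF integrable_indicator_Ioc])

lemma ft_Ioc_empty: "b \<le> a \<Longrightarrow> ft_Ioc a b = (\<lambda>\<xi>. 0)"
  by (simp add: fourier_integral_def fun_eq_iff)

text \<open>The transform is bounded near the origin and decays like \<open>1 / \<bar>t\<bar>\<close>, hence its square is
  dominated by a multiple of \<open>1 / (1 + t\<^sup>2)\<close>.\<close>

lemma square_integrable_ft_Ioc: "square_integrable (ft_Ioc a b)"
proof (cases "a \<le> b")
  case False
  then have "ft_Ioc a b = (\<lambda>\<xi>. 0)" by (intro ft_Ioc_empty) simp
  then show ?thesis by (simp only: square_integrable_zero)
next
  case ab: True
  define C where "C = ((b - a)\<^sup>2 + 4) / (2 * pi)"
  have [measurable]: "ft_Ioc a b \<in> borel_measurable lebesgue"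
    by (rule measurable_fourier_integral[OF integrable_indicator_Ioc])
  have int: "integrable lebesgue (\<lambda>t. C * inverse (1 + t\<^sup>2))"
    using integrable_inverse_one_plus_square by simp
  have bound: "(cmod (ft_Ioc a b t))\<^sup>2 * (1 + t\<^sup>2) \<le> C" for t
  proof -
    have "(\<lambda>x. cmod (indicator {a<..b} x)) = indicator {a<..b}"
      by (auto simp: indicator_def)
    then have "(LINT x|lebesgue. cmod (indicator {a<..b} x)) = b - a"
      using ab by simp
    then have "cmod (ft_Ioc a b t) \<le> (b - a) / sqrt (2 * pi)"
      using norm_fourier_integral_le[of "indicator {a<..b}" t] by simp
    then have "(cmod (ft_Ioc a b t))\<^sup>2 \<le> ((b - a) / sqrt (2 * pi))\<^sup>2"
      by (intro power_mono) auto
    then have 1: "(cmod (ft_Ioc a b t))\<^sup>2 \<le> (b - a)\<^sup>2 / (2 * pi)"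
      by (simp add: power_divide)
    have 2: "(cmod (ft_Ioc a b t))\<^sup>2 * t\<^sup>2 \<le> 4 / (2 * pi)"
    proof (cases "t = 0")
      case False
      have "cmod (ft_Ioc a b t) * \<bar>t\<bar> = cmod (iexp (- (t * a)) - iexp (- (t * b))) / sqrt (2 * pi)"
        unfolding ft_Ioc_eq[OF ab False] norm_mult norm_divide norm_of_real
        using False by simp
      also have "\<dots> \<le> (1 + 1) / sqrt (2 * pi)"
      proof (intro divide_right_mono)
        show "cmod (iexp (- (t * a)) - iexp (- (t * b))) \<le> 1 + 1"
          using norm_triangle_ineq4[of "iexp (- (t * a))" "iexp (- (t * b))"]
          unfolding norm_exp_i_times by simp
      qed simp
      finally have "(cmod (ft_Ioc a b t) * \<bar>t\<bar>)\<^sup>2 \<le> (2 / sqrt (2 * pi))\<^sup>2"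
        by (intro power_mono) auto
      then show ?thesis by (simp add: power_mult_distrib power_divide)
    qed simp
    show ?thesis using 1 2 by (simp add: C_def add_divide_distrib distrib_left)
  qed
  have "integrable lebesgue (\<lambda>t. (cmod (ft_Ioc a b t))\<^sup>2)"
  proof (rule Bochner_Integration.integrable_bound[OF int])
    show "AE t in lebesgue. norm ((cmod (ft_Ioc a b t))\<^sup>2) \<le> norm (C * inverse (1 + t\<^sup>2))"
    proof (rule AE_I2)
      fix t :: real
      have pos: "0 < 1 + t\<^sup>2" by (rule add_pos_nonneg) simp_all
      then have "(cmod (ft_Ioc a b t))\<^sup>2 \<le> C * inverse (1 + t\<^sup>2)"
        using bound[of t] by (simp add: divide_inverse[symmetric] pos_le_divide_eq)
      also have "\<dots> \<le> norm (C * inverse (1 + t\<^sup>2))" by simp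
      finally show "norm ((cmod (ft_Ioc a b t))\<^sup>2) \<le> norm (C * inverse (1 + t\<^sup>2))" by simp
    qed
  qed measurable
  then show ?thesis by (simp add: square_integrable_def)
qed

lemma char_uniform_Ioc:
  assumes "c < d"
  shows "cnj (ft_Ioc c d t)
    = complex_of_real ((d - c) / sqrt (2 * pi)) * char (uniform_measure lborel {c<..d}) t"
proof -
  have "uniform_measure lborel {c<..d} = density lborel (\<lambda>x. ennreal (indicator {c<..d} x / (d - c)))"
    unfolding uniform_measure_def using assms divide_ennreal[of 1 "d - c"]
    by (intro density_cong) (auto simp: indicator_def)
  then have "char (uniform_measure lborel {c<..d}) t
      = (LINT x|lborel. (indicator {c<..d} x / (d - c)) *\<^sub>R iexp (t * x))"
    unfolding char_def using assms by (simp add: integral_density)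
  also have "\<dots> = (LINT x|lborel. complex_of_real (1 / (d - c)) * (indicator {c<..d} x *\<^sub>R iexp (t * x)))"
    by (intro Bochner_Integration.integral_cong) (auto simp: indicator_def scaleR_conv_of_real)
  also have "\<dots> = complex_of_real (1 / (d - c)) * (LINT x|lborel. indicator {c<..d} x *\<^sub>R iexp (t * x))"
    by (rule integral_mult_right_zero)
  also have "(LINT x|lborel. indicator {c<..d} x *\<^sub>R iexp (t * x))
      = (LINT x|lebesgue. indicator {c<..d} x *\<^sub>R iexp (t * x))"
    by (rule integral_completion[symmetric]) simp
  finally have char: "complex_of_real (d - c) * char (uniform_measure lborel {c<..d}) t
      = (LINT x|lebesgue. indicator {c<..d} x *\<^sub>R iexp (t * x))"
    using assms by simp
  have "cnj (LINT x|lebesgue. indicator {c<..d} x * exp (- \<i> * complex_of_real (x * t)))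
      = (LINT x|lebesgue. cnj (indicator {c<..d} x * exp (- \<i> * complex_of_real (x * t))))"
    by (rule Bochner_Integration.integral_cnj[symmetric])
  also have "\<dots> = (LINT x|lebesgue. indicator {c<..d} x *\<^sub>R iexp (t * x))"
    by (intro Bochner_Integration.integral_cong) (auto simp: indicator_def exp_cnj mult.commute)
  finally show ?thesis
    unfolding fourier_integral_def complex_cnj_mult char[symmetric] by simp
qed

text \<open>The Fourier integral of an interval indicator is, up to a factor, the kernel of Levy's inversion
  formula, and its conjugate is a multiple of the characteristic function of a uniform
  distribution. The inversion formula for the probability of \<open>{a<..b}\<close> under the uniform
  distribution on \<open>{c<..d}\<close> is therefore Plancherel's identity for two interval indicators.\<close>

lemma ft_Ioc_inner:
  assumes "a \<le> b" "c < d"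
  shows "(LINT t|lebesgue. ft_Ioc a b t * cnj (ft_Ioc c d t))
    = complex_of_real (measure lebesgue ({a<..b} \<inter> {c<..d}))"
proof -
  define h where "h t = ft_Ioc a b t * cnj (ft_Ioc c d t)" for t
  let ?M = "uniform_measure lborel {c<..d}"
  let ?F = "\<lambda>t. (iexp (- (t * a)) - iexp (- (t * b))) / (\<i> * t)"
  have em: "emeasure lborel {c<..d} \<noteq> 0" "emeasure lborel {c<..d} \<noteq> \<infinity>" using assms by auto
  interpret M: real_distribution ?M
    using prob_space_uniform_measure[OF em] by (simp add: real_distribution_def real_distribution_axioms_def)
  have hc: "continuous_on UNIV h"
    unfolding h_def by (intro continuous_intros continuous_ft_Ioc)
  have h_int: "integrable lebesgue h"
    unfolding h_def by (intro square_integrable_mult_cnj square_integrable_ft_Ioc)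
  have hF: "?F t * char ?M t = complex_of_real (2 * pi / (d - c)) * (if t = 0 then 0 else h t)" for t
  proof (cases "t = 0")
    case False
    have "h t = complex_of_real ((d - c) / (2 * pi)) * (?F t * char ?M t)"
      unfolding h_def ft_Ioc_eq[OF assms(1) False] char_uniform_Ioc[OF assms(2)]
      by (simp add: field_simps flip: of_real_mult)
    then show ?thesis using False assms by (simp add: field_simps)
  qed simp
  have "(CLBINT t=-T..T. ?F t * char ?M t)
      = complex_of_real (2 * pi / (d - c)) * (LINT t|lebesgue. indicator (window T) t * h t)" for T :: nat
  proof -
    have "(CLBINT t=-T..T. ?F t * char ?M t) = (LINT t|lborel. indicator {- real T<..real T} t *\<^sub>R
        (complex_of_real (2 * pi / (d - c)) * (if t = 0 then 0 else h t)))"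
    proof -
      have le: "real_of_int (- int T) \<le> real T" by simp
      show ?thesis
        unfolding hF interval_integral_Ioc[OF le] set_lebesgue_integral_def
        by (simp only: of_int_minus of_int_of_nat_eq)
    qed
    also have "\<dots> = (LINT t|lebesgue. indicator {- real T<..real T} t *\<^sub>R
        (complex_of_real (2 * pi / (d - c)) * (if t = 0 then 0 else h t)))"
    proof (rule integral_completion[symmetric])
      have [measurable]: "h \<in> borel_measurable borel" by (rule borel_measurable_continuous_onI[OF hc])
      show "(\<lambda>t. indicator {- real T<..real T} t *\<^sub>R
          (complex_of_real (2 * pi / (d - c)) * (if t = 0 then 0 else h t))) \<in> borel_measurable lborel"
        by measurable
    qed
    also have "\<dots> = (LINT t|lebesgue. complex_of_real (2 * pi / (d - c)) * (indicator (window T) t * h t))"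
    proof (rule integral_cong_AE)
      have [measurable]: "h \<in> borel_measurable lebesgue" using h_int by simp
      have [measurable]: "(\<lambda>x. x) \<in> borel_measurable (lebesgue :: real measure)"
        by (rule measurable_completion) simp
      show "(\<lambda>t. complex_of_real (2 * pi / (d - c)) * (indicator (window T) t * h t)) \<in> borel_measurable lebesgue"
        by measurable
      show "(\<lambda>t. indicator {- real T<..real T} t *\<^sub>R
          (complex_of_real (2 * pi / (d - c)) * (if t = 0 then 0 else h t))) \<in> borel_measurable lebesgue"
        by measurable
      \<comment> \<open>The kernel of the inversion formula has the default value \<open>0\<close> at \<open>t = 0\<close>.\<close>
      have "AE t in lebesgue. t \<noteq> (0::real)" by (rule AE_completion[OF AE_lborel_singleton])
      then show "AE t in lebesgue. indicator {- real T<..real T} t *\<^sub>R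
          (complex_of_real (2 * pi / (d - c)) * (if t = 0 then 0 else h t))
          = complex_of_real (2 * pi / (d - c)) * (indicator (window T) t * h t)"
        by eventually_elim (simp add: window_def indicator_def)
    qed
    finally show ?thesis by simp
  qed
  moreover have "(\<lambda>T::nat. 1 / (2 * pi) * (CLBINT t=-T..T. ?F t * char ?M t))
      \<longlonglongrightarrow> complex_of_real (measure ?M {a<..b})"
  proof (rule M.Levy_Inversion[OF assms(1)])
    have "emeasure lborel ({c<..d} \<inter> {x}) = 0" for x
      by (cases "x \<in> {c<..d}") auto
    then show "measure ?M {a} = 0" "measure ?M {b} = 0"
      by (simp_all add: measure_def)
  qed
  ultimately have "(\<lambda>T. complex_of_real (1 / (d - c)) * (LINT t|lebesgue. indicator (window T) t * h t))
      \<longlonglongrightarrow> complex_of_real (measure ?M {a<..b})"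
    by simp
  from tendsto_mult_left[OF this, of "complex_of_real (d - c)"]
  have "(\<lambda>T. LINT t|lebesgue. indicator (window T) t * h t)
      \<longlonglongrightarrow> complex_of_real (d - c) * complex_of_real (measure ?M {a<..b})"
    using assms by simp
  also have "complex_of_real (d - c) * complex_of_real (measure ?M {a<..b})
      = complex_of_real (measure lebesgue ({a<..b} \<inter> {c<..d}))"
    using assms em by (simp add: measure_uniform_measure Int_commute)
  finally have 1: "(\<lambda>T. LINT t|lebesgue. indicator (window T) t * h t)
      \<longlonglongrightarrow> complex_of_real (measure lebesgue ({a<..b} \<inter> {c<..d}))" .
  have 2: "(\<lambda>T. LINT t|lebesgue. indicator (window T) t * h t) \<longlonglongrightarrow> integral\<^sup>L lebesgue h"
  proof (rule integral_dominated_convergence[where w = "\<lambda>t. cmod (h t)"])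
    have [measurable]: "h \<in> borel_measurable lebesgue" using h_int by simp
    show "(\<lambda>t. indicator (window T) t * h t) \<in> borel_measurable lebesgue" for T
      by measurable
    show "AE t in lebesgue. (\<lambda>T. indicator (window T) t * h t) \<longlonglongrightarrow> h t"
    proof (intro AE_I2 tendsto_eventually)
      show "\<forall>\<^sub>F T in sequentially. indicator (window T) t * h t = h t" for t
        using eventually_in_window[of t] by eventually_elim simp
    qed
    show "AE t in lebesgue. norm (indicator (window T) t * h t) \<le> cmod (h t)" for T
      by (auto simp: indicator_def)
  qed (use h_int in auto)
  show ?thesis
    using LIMSEQ_unique[OF 2 1] unfolding h_def .
qed

lemma cinner_ind:
  assumes "A \<in> lmeasurable" "B \<in> lmeasurable"
  shows "cinner (ind A) (ind B) = complex_of_real (measure lebesgue (A \<inter> B))"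
proof -
  have "cinner (ind A) (ind B) = (LINT x|lebesgue. indicator A x * cnj (indicator B x))"
    unfolding ind_def by (rule cinner_abs) (use assms square_integrable_indicator in auto)
  also have "\<dots> = (LINT x|lebesgue. complex_of_real (indicator (A \<inter> B) x))"
    by (intro Bochner_Integration.integral_cong) (auto simp: indicator_def)
  also have "\<dots> = complex_of_real (LINT x|lebesgue. indicator (A \<inter> B) x)"
    by (rule integral_complex_of_real)
  finally show ?thesis using assms by (simp add: fmeasurable_def)
qed

section \<open>Plancherel's theorem\<close>

text \<open>The Fourier integral as an element of \<open>L\<^sub>2\<close>; for an integrable \<open>f\<close>, its square integrability is
  established in \<open>fourier_integral_square_integrable\<close>.\<close>

definition fourier_L1 :: "l2 \<Rightarrow> l2" where
  "fourier_L1 f = abs_l2 (fourier_integral (rep_l2 f))"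

definition in_L1 :: "l2 \<Rightarrow> bool" where
  "in_L1 f \<longleftrightarrow> integrable lebesgue (rep_l2 f)"

lemma in_L1_cong:
  assumes "integrable lebesgue g" "AE x in lebesgue. rep_l2 f x = g x"
  shows "in_L1 f"
  unfolding in_L1_def using assms
  by (subst integrable_cong_AE[where g = g]) auto

lemma in_L1_add: "in_L1 f \<Longrightarrow> in_L1 g \<Longrightarrow> in_L1 (f + g)"
  by (rule in_L1_cong[OF _ rep_add]) (simp add: in_L1_def)

lemma in_L1_scaleC: "in_L1 f \<Longrightarrow> in_L1 (c *\<^sub>C f)"
  by (rule in_L1_cong[OF _ rep_scaleC]) (simp add: in_L1_def)

lemma in_L1_reflect: "in_L1 f \<Longrightarrow> in_L1 (reflect f)"
  by (rule in_L1_cong[OF _ rep_reflect]) (simp add: in_L1_def integrable_reflect)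

lemma in_L1_truncation: "in_L1 (time_proj (window n) f)"
proof (rule in_L1_cong[OF _ rep_time_proj[OF window_sets]])
  have "UNIV \<inter> window n \<in> lmeasurable" by (rule lmeasurable_Int_window) simp
  then have "integrable lebesgue (\<lambda>x. rep_l2 f x * cnj (indicator (window n) x))"
    by (intro square_integrable_mult_cnj square_integrable_rep square_integrable_indicator) simp
  then show "integrable lebesgue (\<lambda>x. indicator (window n) x * rep_l2 f x)"
    by (rule Bochner_Integration.integrable_cong[THEN iffD1, rotated 2]) (auto simp: indicator_def)
qed

lemma fourier_integral_rep_add:
  assumes "in_L1 f" "in_L1 g"
  shows "fourier_integral (rep_l2 (f + g)) = (\<lambda>\<xi>. fourier_integral (rep_l2 f) \<xi> + fourier_integral (rep_l2 g) \<xi>)"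
proof
  fix \<xi>
  have "fourier_integral (rep_l2 (f + g)) \<xi> = fourier_integral (\<lambda>x. rep_l2 f x + rep_l2 g x) \<xi>"
    by (rule fourier_integral_cong[OF _ _ rep_add]) measurable
  then show "fourier_integral (rep_l2 (f + g)) \<xi> = fourier_integral (rep_l2 f) \<xi> + fourier_integral (rep_l2 g) \<xi>"
    using assms by (simp add: in_L1_def fourier_integral_add)
qed

lemma fourier_integral_rep_scaleC:
  "fourier_integral (rep_l2 (c *\<^sub>C f)) = (\<lambda>\<xi>. c * fourier_integral (rep_l2 f) \<xi>)"
proof
  fix \<xi>
  have "fourier_integral (rep_l2 (c *\<^sub>C f)) \<xi> = fourier_integral (\<lambda>x. c * rep_l2 f x) \<xi>"
    by (rule fourier_integral_cong[OF _ _ rep_scaleC]) measurable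
  then show "fourier_integral (rep_l2 (c *\<^sub>C f)) \<xi> = c * fourier_integral (rep_l2 f) \<xi>"
    by (simp add: fourier_integral_cmult)
qed

lemma fourier_integral_rep_reflect:
  "fourier_integral (rep_l2 (reflect f)) \<xi> = fourier_integral (rep_l2 f) (- \<xi>)"
  using fourier_integral_cong[OF _ _ rep_reflect[of f], of \<xi>]
  by (simp add: measurable_reflect fourier_integral_reflect)

inductive step_function :: "l2 \<Rightarrow> bool" where
  "step_function (ind {a<..b})"
| "step_function f \<Longrightarrow> step_function g \<Longrightarrow> step_function (f + g)"
| "step_function f \<Longrightarrow> step_function (c *\<^sub>C f)"

lemma step_function_in_L1: "step_function f \<Longrightarrow> in_L1 f"
proof (induction rule: step_function.induct)
  case (1 a b)
  show ?case by (rule in_L1_cong[OF integrable_indicator_Ioc rep_ind]) simp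
qed (auto intro: in_L1_add in_L1_scaleC)

lemma fourier_integral_rep_ind: "fourier_integral (rep_l2 (ind {a<..b})) = ft_Ioc a b"
proof
  show "fourier_integral (rep_l2 (ind {a<..b})) \<xi> = ft_Ioc a b \<xi>" for \<xi>
    by (rule fourier_integral_cong[OF _ _ rep_ind])
      (auto intro: borel_measurable_integrable integrable_indicator_Ioc)
qed

lemma step_function_fourier:
  assumes "step_function f"
  shows "square_integrable (fourier_integral (rep_l2 f))"
  using assms
proof (induction rule: step_function.induct)
  case (1 a b)
  show ?case
    by (simp add: fourier_integral_rep_ind square_integrable_ft_Ioc)
next
  case (2 f g)
  then show ?case
    by (simp add: fourier_integral_rep_add step_function_in_L1 square_integrable_add)
next
  case (3 f c)
  then show ?case by (simp add: fourier_integral_rep_scaleC square_integrable_mult_const)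
qed

lemma fourier_L1_add:
  assumes "in_L1 f" "in_L1 g" "square_integrable (fourier_integral (rep_l2 f))"
    "square_integrable (fourier_integral (rep_l2 g))"
  shows "fourier_L1 (f + g) = fourier_L1 f + fourier_L1 g"
  using assms by (simp add: fourier_L1_def fourier_integral_rep_add abs_l2_add)

lemma fourier_L1_scaleC:
  assumes "square_integrable (fourier_integral (rep_l2 f))"
  shows "fourier_L1 (c *\<^sub>C f) = c *\<^sub>C fourier_L1 f"
  using assms by (simp add: fourier_L1_def fourier_integral_rep_scaleC abs_l2_scaleC)

lemma cinner_fourier_L1_ind:
  "cinner (fourier_L1 (ind {a<..b})) (fourier_L1 (ind {c<..d})) = cinner (ind {a<..b}) (ind {c<..d})"
proof -
  have "(LINT t|lebesgue. ft_Ioc a b t * cnj (ft_Ioc c d t))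
      = complex_of_real (measure lebesgue ({a<..b} \<inter> {c<..d}))"
  proof (cases "a \<le> b \<and> c < d")
    case True
    then show ?thesis by (intro ft_Ioc_inner) auto
  next
    case False
    then have "b \<le> a \<or> d \<le> c" by auto
    then show ?thesis by (auto simp: fourier_integral_def)
  qed
  then show ?thesis
    unfolding fourier_L1_def fourier_integral_rep_ind cinner_abs[OF square_integrable_ft_Ioc square_integrable_ft_Ioc]
    by (simp add: cinner_ind)
qed

lemma cinner_fourier_L1_step:
  assumes "step_function f" "step_function g"
  shows "cinner (fourier_L1 f) (fourier_L1 g) = cinner f g"
  using assms(1)
proof (induction rule: step_function.induct)
  case (1 a b)
  from assms(2) show ?case
    by (induction rule: step_function.induct)
      (simp_all add: cinner_fourier_L1_ind fourier_L1_add fourier_L1_scaleC step_function_in_L1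
        step_function_fourier cinner_add_right cinner_scaleC_right)
qed (simp_all add: fourier_L1_add fourier_L1_scaleC step_function_in_L1 step_function_fourier
    cinner_add_left cinner_scaleC_left)

lemma norm_fourier_L1_step:
  assumes "step_function f"
  shows "norm (fourier_L1 f) = norm f"
proof -
  have "complex_of_real ((norm (fourier_L1 f))\<^sup>2) = complex_of_real ((norm f)\<^sup>2)"
    using cinner_fourier_L1_step[OF assms assms] by (simp only: cinner_self)
  then show ?thesis by (simp only: of_real_eq_iff power2_eq_iff_nonneg norm_ge_zero)
qed

lemma step_function_approx:
  assumes "0 < e"
  shows "\<exists>s. step_function s \<and> norm (f - s) < e"
proof -
  have "\<forall>e>0. \<exists>s. step_function s \<and> norm (f - s) < e"
  proof (induction f rule: l2_induct)
    case (ind a b)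
    show ?case by (auto intro!: exI[of _ "ind {a<..b}"] step_function.intros(1))
  next
    case (add f g)
    show ?case
    proof (intro allI impI)
      fix e :: real assume "0 < e"
      then obtain s t where st: "step_function s" "norm (f - s) < e / 2" "step_function t" "norm (g - t) < e / 2"
        using add by (meson half_gt_zero)
      have "norm (f + g - (s + t)) \<le> norm (f - s) + norm (g - t)"
        by (rule norm_diff_triangle_ineq)
      then have "norm (f + g - (s + t)) < e" using st by linarith
      then show "\<exists>s. step_function s \<and> norm (f + g - s) < e"
        using st step_function.intros(2) by blast
    qed
  next
    case (scale c f)
    show ?case
    proof (intro allI impI)
      fix e :: real assume "0 < e"
      have pos: "0 < cmod c + 1" by (simp add: add_nonneg_pos)
      with \<open>0 < e\<close> have "0 < e / (cmod c + 1)" by simp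
      then obtain s where s: "step_function s" "norm (f - s) < e / (cmod c + 1)" using scale by blast
      have "cmod c * norm (f - s) \<le> (cmod c + 1) * norm (f - s)" by (intro mult_right_mono) auto
      also have "\<dots> < e" using s(2) pos_less_divide_eq[OF pos] by (simp add: mult.commute)
      finally have "norm (c *\<^sub>C f - c *\<^sub>C s) < e" by (simp flip: scaleC_diff_right)
      then show "\<exists>s. step_function s \<and> norm (c *\<^sub>C f - s) < e"
        using s(1) step_function.intros(3) by blast
    qed
  next
    case (limit u f)
    show ?case
    proof (intro allI impI)
      fix e :: real assume "0 < e"
      then obtain n where "norm (u n - f) < e / 2"
        using LIMSEQ_D[OF limit(2), of "e / 2"] by auto
      moreover obtain s where "step_function s" "norm (u n - s) < e / 2"
        using limit(1)[of n] \<open>0 < e\<close> by (meson half_gt_zero)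
      moreover have "f - s = (f - u n) + (u n - s)" by simp
      ultimately show "\<exists>s. step_function s \<and> norm (f - s) < e"
        using norm_triangle_ineq[of "f - u n" "u n - s"]
        by (intro exI[of _ s]) (auto simp: norm_minus_commute)
    qed
  qed
  then show ?thesis using assms by blast
qed

lemma step_function_sequence:
  obtains s where "\<And>n::nat. step_function (s n)" "s \<longlonglongrightarrow> f"
proof -
  have "\<forall>n::nat. \<exists>s. step_function s \<and> norm (f - s) < inverse (real (Suc n))"
    using step_function_approx by simp
  then obtain s where s: "\<And>n. step_function (s n)" "\<And>n. norm (f - s n) < inverse (real (Suc n))"
    by metis
  have "(\<lambda>n. s n - f) \<longlonglongrightarrow> 0"
    by (rule Lim_null_comparison[OF always_eventually LIMSEQ_inverse_real_of_nat])
      (use s(2) in \<open>auto simp: norm_minus_commute intro: less_imp_le\<close>)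
  then show thesis using s(1) by (intro that[of s]) (auto intro: LIM_zero_cancel)
qed

lemma step_function_truncation:
  "step_function f \<Longrightarrow> step_function (time_proj (window n) f)"
proof (induction rule: step_function.induct)
  case (1 a b)
  have "time_proj (window n) (ind {a<..b}) = ind {max a (- real n)<..min b (real n)}"
  proof (rule l2_eqI)
    show "AE x in lebesgue. rep_l2 (time_proj (window n) (ind {a<..b})) x
        = rep_l2 (ind {max a (- real n)<..min b (real n)}) x"
      using rep_time_proj[OF window_sets[of n], of "ind {a<..b}"] rep_ind[OF lmeasurable_Ioc, of a b]
        rep_ind[OF lmeasurable_Ioc, of "max a (- real n)" "min b (real n)"]
      by eventually_elim (auto simp: indicator_def window_def)
  qed
  then show ?case by (simp add: step_function.intros)
next
  case (2 f g)
  then show ?case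
    by (simp add: orthogonal_projection.add[OF orthogonal_projection_time_proj] step_function.intros)
next
  case (3 f c)
  then show ?case
    by (simp add: orthogonal_projection.scaleC[OF orthogonal_projection_time_proj] step_function.intros)
qed

text \<open>The Fourier integral of \<open>f\<close> is paired with step functions through the adjoint, where
  the isometry is already known. By density its truncations are bounded in \<open>L\<^sub>2\<close> by the norm
  of \<open>f\<close>, and Fatou's lemma removes the truncation.\<close>

lemma fourier_integral_square_integrable:
  assumes f: "in_L1 f"
  shows "square_integrable (fourier_integral (rep_l2 f)) \<and> norm (fourier_L1 f) \<le> norm f"
proof -
  define F where "F = fourier_integral (rep_l2 f)"
  have [measurable]: "F \<in> borel_measurable lebesgue"
    unfolding F_def using f by (simp add: in_L1_def measurable_fourier_integral)
  obtain B where B: "\<And>\<xi>. cmod (F \<xi>) \<le> B"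
    using norm_fourier_integral_le unfolding F_def by blast
  define \<phi> where "\<phi> n = (\<lambda>\<xi>. indicator (window n) \<xi> * F \<xi>)" for n
  have \<phi>: "square_integrable (\<phi> n)" for n
  proof -
    have [measurable]: "\<phi> n \<in> borel_measurable lebesgue" unfolding \<phi>_def by measurable
    have w: "UNIV \<inter> window n \<in> lmeasurable" by (rule lmeasurable_Int_window) simp
    have "integrable lebesgue (\<lambda>\<xi>. B\<^sup>2 * indicator (window n) \<xi>)"
      using w by (intro integrable_mult_right integrable_real_indicator) (auto simp: fmeasurable_def)
    then have "integrable lebesgue (\<lambda>\<xi>. (cmod (\<phi> n \<xi>))\<^sup>2)"
    proof (rule Bochner_Integration.integrable_bound)
      show "AE \<xi> in lebesgue. norm ((cmod (\<phi> n \<xi>))\<^sup>2) \<le> norm (B\<^sup>2 * indicator (window n) \<xi>)"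
        by (rule AE_I2) (auto simp: \<phi>_def indicator_def intro!: power_mono B)
    qed measurable
    then show ?thesis by (simp add: square_integrable_def)
  qed
  define u where "u n = abs_l2 (\<phi> n)" for n
  have rep_u: "AE \<xi> in lebesgue. rep_l2 (u n) \<xi> = \<phi> n \<xi>" for n
    unfolding u_def by (rule rep_abs[OF \<phi>])
  have step: "cmod (cinner (u n) g) \<le> norm f * norm g" if g: "step_function g" for n g
  proof -
    let ?g = "time_proj (window n) g"
    have sg: "step_function ?g" by (rule step_function_truncation[OF g])
    have gL: "integrable lebesgue (rep_l2 ?g)" using step_function_in_L1[OF sg] by (simp add: in_L1_def)
    have "cinner (u n) g = (LINT \<xi>|lebesgue. F \<xi> * cnj (rep_l2 ?g \<xi>))"
      unfolding cinner_rep
    proof (rule integral_cong_AE)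
      have cnj [measurable]: "cnj \<in> borel_measurable borel"
        by (intro borel_measurable_continuous_onI continuous_intros)
      show "(\<lambda>x. rep_l2 (u n) x * cnj (rep_l2 g x)) \<in> borel_measurable lebesgue"
        "(\<lambda>\<xi>. F \<xi> * cnj (rep_l2 ?g \<xi>)) \<in> borel_measurable lebesgue"
        by measurable
      show "AE \<xi> in lebesgue. rep_l2 (u n) \<xi> * cnj (rep_l2 g \<xi>) = F \<xi> * cnj (rep_l2 ?g \<xi>)"
        using rep_u[of n] rep_time_proj[OF window_sets[of n], of g]
        by eventually_elim (auto simp: \<phi>_def indicator_def)
    qed
    also have "\<dots> = (LINT x|lebesgue. rep_l2 f x * cnj (fourier_integral (rep_l2 ?g) (- x)))"
      unfolding F_def using f gL by (intro fourier_integral_adjoint) (simp_all add: in_L1_def)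
    also have "\<dots> = cinner (abs_l2 (rep_l2 f)) (abs_l2 (\<lambda>x. fourier_integral (rep_l2 ?g) (- x)))"
      by (rule cinner_abs[symmetric])
        (intro square_integrable_rep square_integrable_reflect step_function_fourier sg)+
    also have "abs_l2 (\<lambda>x. fourier_integral (rep_l2 ?g) (- x)) = reflect (fourier_L1 ?g)"
    proof -
      have sq: "square_integrable (fourier_integral (rep_l2 ?g))" by (rule step_function_fourier[OF sg])
      show ?thesis
        unfolding reflect_def fourier_L1_def
        by (rule abs_l2_eqI)
          (use AE_reflect[OF rep_abs[OF sq]] in \<open>auto intro!: square_integrable_reflect sq square_integrable_rep\<close>)
    qed
    finally have "cmod (cinner (u n) g) \<le> norm f * norm (fourier_L1 ?g)"
      using cinner_Cauchy_Schwarz[of f "reflect (fourier_L1 ?g)"] by simp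
    also have "\<dots> \<le> norm f * norm g"
      using orthogonal_projection.norm_le[OF orthogonal_projection_time_proj[OF window_sets]]
      by (intro mult_left_mono) (auto simp: norm_fourier_L1_step[OF sg])
    finally show ?thesis .
  qed
  have all: "cmod (cinner (u n) g) \<le> norm f * norm g" for n g
  proof -
    obtain s where s: "\<And>k::nat. step_function (s k)" "s \<longlonglongrightarrow> g" using step_function_sequence[of g] by blast
    show ?thesis
      by (rule LIMSEQ_le[of "\<lambda>k. cmod (cinner (u n) (s k))" _ "\<lambda>k. norm f * norm (s k)"])
        (use s step in \<open>auto intro!: tendsto_intros tendsto_cinner_right\<close>)
  qed
  have "norm (u n) \<le> norm f" for n
  proof (cases "u n = 0")
    case False
    have "(norm (u n))\<^sup>2 \<le> norm f * norm (u n)"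
      using all[of n "u n"] unfolding cinner_self norm_of_real by simp
    then show ?thesis using False by (simp add: power2_eq_square)
  qed simp
  moreover have "AE \<xi> in lebesgue. (\<lambda>n. rep_l2 (u n) \<xi>) \<longlonglongrightarrow> F \<xi>"
  proof -
    have "AE \<xi> in lebesgue. \<forall>n. rep_l2 (u n) \<xi> = \<phi> n \<xi>"
      unfolding AE_all_countable using rep_u by blast
    then show ?thesis
    proof eventually_elim
      case (elim \<xi>)
      have "\<forall>\<^sub>F n in sequentially. rep_l2 (u n) \<xi> = F \<xi>"
        using eventually_in_window[of \<xi>] by eventually_elim (use elim in \<open>simp add: \<phi>_def\<close>)
      then show ?case by (rule tendsto_eventually)
    qed
  qed
  ultimately show ?thesis
    unfolding fourier_L1_def F_def[symmetric] by (intro square_integrable_limit[where u = u]) auto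
qed

text \<open>Truncations of an element of \<open>L\<^sub>2\<close> are integrable and converge to it, and the Fourier integral
  is a contraction on \<open>L\<^sub>1 \<inter> L\<^sub>2\<close>; so the limit exists and extends the Fourier integral.\<close>

definition plancherel :: "l2 \<Rightarrow> l2" where
  "plancherel f = lim (\<lambda>n. fourier_L1 (time_proj (window n) f))"

lemma fourier_L1_add_L1:
  "in_L1 f \<Longrightarrow> in_L1 g \<Longrightarrow> fourier_L1 (f + g) = fourier_L1 f + fourier_L1 g"
  using fourier_integral_square_integrable by (intro fourier_L1_add) blast+

lemma fourier_L1_scaleC_L1: "in_L1 f \<Longrightarrow> fourier_L1 (c *\<^sub>C f) = c *\<^sub>C fourier_L1 f"
  using fourier_integral_square_integrable by (intro fourier_L1_scaleC) blast

lemma dist_fourier_L1: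
  assumes "in_L1 f" "in_L1 g"
  shows "norm (fourier_L1 f - fourier_L1 g) \<le> norm (f - g)"
proof -
  have g: "in_L1 ((-1) *\<^sub>C g)" by (rule in_L1_scaleC[OF assms(2)])
  have "fourier_L1 (f + (-1) *\<^sub>C g) = fourier_L1 f + (-1) *\<^sub>C fourier_L1 g"
    by (simp only: fourier_L1_add_L1[OF assms(1) g] fourier_L1_scaleC_L1[OF assms(2)])
  moreover have "norm (fourier_L1 (f + (-1) *\<^sub>C g)) \<le> norm (f + (-1) *\<^sub>C g)"
    using fourier_integral_square_integrable[OF in_L1_add[OF assms(1) g]] by blast
  ultimately show ?thesis by (simp add: scaleC_minus_one)
qed

lemma plancherel_tendsto: "(\<lambda>n. fourier_L1 (time_proj (window n) f)) \<longlonglongrightarrow> plancherel f"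
proof -
  have "Cauchy (\<lambda>n. time_proj (window n) f)"
    using truncation_tendsto by (rule LIMSEQ_imp_Cauchy)
  then have "Cauchy (\<lambda>n. fourier_L1 (time_proj (window n) f))"
    unfolding Cauchy_iff using dist_fourier_L1[OF in_L1_truncation in_L1_truncation]
    by (meson le_less_trans)
  then show ?thesis
    unfolding plancherel_def by (simp add: Cauchy_convergent convergent_LIMSEQ_iff[symmetric])
qed

lemma plancherel_L1:
  assumes "in_L1 f"
  shows "plancherel f = fourier_L1 f"
proof -
  have "(\<lambda>n. fourier_L1 (time_proj (window n) f) - fourier_L1 f) \<longlonglongrightarrow> 0"
    by (rule Lim_null_comparison[OF always_eventually tendsto_norm_zero[OF LIM_zero[OF truncation_tendsto]]])
      (use dist_fourier_L1[OF in_L1_truncation assms] in blast)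
  then have "(\<lambda>n. fourier_L1 (time_proj (window n) f)) \<longlonglongrightarrow> fourier_L1 f"
    by (rule LIM_zero_cancel)
  then show ?thesis by (rule LIMSEQ_unique[OF plancherel_tendsto])
qed

lemma bounded_clinear_plancherel: "bounded_clinear plancherel"
proof (rule bounded_clinearI[where K = 1])
  have T: "orthogonal_projection (time_proj (window n))" for n
    by (rule orthogonal_projection_time_proj[OF window_sets])
  show "plancherel (f + g) = plancherel f + plancherel g" for f g
  proof (rule LIMSEQ_unique[OF plancherel_tendsto])
    show "(\<lambda>n. fourier_L1 (time_proj (window n) (f + g))) \<longlonglongrightarrow> plancherel f + plancherel g"
      unfolding orthogonal_projection.add[OF T] fourier_L1_add_L1[OF in_L1_truncation in_L1_truncation]
      by (intro tendsto_add plancherel_tendsto)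
  qed
  show "plancherel (c *\<^sub>C f) = c *\<^sub>C plancherel f" for c f
  proof (rule LIMSEQ_unique[OF plancherel_tendsto])
    show "(\<lambda>n. fourier_L1 (time_proj (window n) (c *\<^sub>C f))) \<longlonglongrightarrow> c *\<^sub>C plancherel f"
      unfolding orthogonal_projection.scaleC[OF T] fourier_L1_scaleC_L1[OF in_L1_truncation]
      by (intro bounded_linear.tendsto[OF bounded_clinear_linear[OF bounded_clinear_cscale]]
          plancherel_tendsto)
  qed
  show "norm (plancherel f) \<le> 1 * norm f" for f
  proof -
    have "norm (fourier_L1 (time_proj (window n) f)) \<le> norm f" for n
      using fourier_integral_square_integrable[OF in_L1_truncation[of n f]]
        orthogonal_projection.norm_le[OF T[of n], of f] by linarith
    then show ?thesis
      by (simp add: Lim_bounded[OF tendsto_norm[OF plancherel_tendsto]])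
  qed
qed

lemmas plancherel_continuous =
  bounded_linear.tendsto[OF bounded_clinear_linear[OF bounded_clinear_plancherel]]
lemmas reflect_continuous =
  bounded_linear.tendsto[OF bounded_clinear_linear[OF bounded_clinear_reflect]]

lemma rep_fourier_L1:
  "in_L1 f \<Longrightarrow> AE \<xi> in lebesgue. rep_l2 (fourier_L1 f) \<xi> = fourier_integral (rep_l2 f) \<xi>"
  unfolding fourier_L1_def using fourier_integral_square_integrable by (intro rep_abs) blast

text \<open>Two bounded operators that agree on \<open>L\<^sub>1 \<inter> L\<^sub>2\<close> agree on the limits of truncations, that is,
  everywhere.\<close>

lemma fourier_eq_plancherel: "fourier = plancherel"
  unfolding fourier_def
proof (rule the_equality)
  let ?spec = "\<lambda>F. bounded_clinear F \<and> (\<forall>f. integrable lebesgue (rep_l2 f) \<longrightarrow>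
    (AE \<xi> in lebesgue. rep_l2 (F f) \<xi> = fourier_integral (rep_l2 f) \<xi>))"
  show spec: "?spec plancherel"
    using bounded_clinear_plancherel plancherel_L1 rep_fourier_L1 by (auto simp: in_L1_def)
  fix F assume F: "?spec F"
  have eq: "F f = plancherel f" if "in_L1 f" for f
  proof (rule l2_eqI)
    have "AE x in lebesgue. rep_l2 (F f) x = fourier_integral (rep_l2 f) x"
      using F that by (simp add: in_L1_def)
    moreover have "AE x in lebesgue. rep_l2 (plancherel f) x = fourier_integral (rep_l2 f) x"
      using spec that by (simp add: in_L1_def)
    ultimately show "AE x in lebesgue. rep_l2 (F f) x = rep_l2 (plancherel f) x"
      by eventually_elim simp
  qed
  show "F = plancherel"
  proof
    fix f
    have "bounded_linear F" using F bounded_clinear_linear by blast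
    then have "(\<lambda>n. F (time_proj (window n) f)) \<longlonglongrightarrow> F f"
      by (rule bounded_linear.tendsto[OF _ truncation_tendsto])
    then have "(\<lambda>n. plancherel (time_proj (window n) f)) \<longlonglongrightarrow> F f"
      by (simp add: eq in_L1_truncation)
    then show "F f = plancherel f"
      using plancherel_continuous[OF truncation_tendsto] LIMSEQ_unique by blast
  qed
qed

lemma fourier_L1_reflect:
  assumes "in_L1 f"
  shows "fourier_L1 (reflect f) = reflect (fourier_L1 f)"
proof (rule l2_eqI)
  show "AE x in lebesgue. rep_l2 (fourier_L1 (reflect f)) x = rep_l2 (reflect (fourier_L1 f)) x"
    using rep_fourier_L1[OF in_L1_reflect[OF assms]] rep_reflect[of "fourier_L1 f"]
      AE_reflect[OF rep_fourier_L1[OF assms]]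
    by eventually_elim (simp add: fourier_integral_rep_reflect)
qed

lemma plancherel_reflect: "plancherel (reflect f) = reflect (plancherel f)"
proof (rule LIMSEQ_unique)
  show "(\<lambda>n. plancherel (reflect (time_proj (window n) f))) \<longlonglongrightarrow> plancherel (reflect f)"
    by (intro plancherel_continuous reflect_continuous truncation_tendsto)
  have "plancherel (reflect (time_proj (window n) f)) = reflect (plancherel (time_proj (window n) f))" for n
    by (simp add: plancherel_L1 in_L1_reflect in_L1_truncation fourier_L1_reflect)
  then show "(\<lambda>n. plancherel (reflect (time_proj (window n) f))) \<longlonglongrightarrow> reflect (plancherel f)"
    by (simp add: reflect_continuous plancherel_continuous truncation_tendsto)
qed

lemma cinner_fourier_L1:
  assumes "in_L1 f" "in_L1 g"
  shows "cinner (fourier_L1 f) g = cinner f (reflect (fourier_L1 g))"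
proof -
  have cnj [measurable]: "cnj \<in> borel_measurable borel"
    by (intro borel_measurable_continuous_onI continuous_intros)
  have fm: "fourier_integral (rep_l2 h) \<in> borel_measurable lebesgue" if "in_L1 h" for h
    using that by (simp add: in_L1_def measurable_fourier_integral)
  note [measurable] = fm[OF assms(1)] measurable_reflect[OF fm[OF assms(2)]]
  have "cinner (fourier_L1 f) g = (LINT \<xi>|lebesgue. fourier_integral (rep_l2 f) \<xi> * cnj (rep_l2 g \<xi>))"
    unfolding cinner_rep
  proof (rule integral_cong_AE)
    show "AE \<xi> in lebesgue. rep_l2 (fourier_L1 f) \<xi> * cnj (rep_l2 g \<xi>)
        = fourier_integral (rep_l2 f) \<xi> * cnj (rep_l2 g \<xi>)"
      using rep_fourier_L1[OF assms(1)] by eventually_elim simp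
  qed measurable
  also have "\<dots> = (LINT x|lebesgue. rep_l2 f x * cnj (fourier_integral (rep_l2 g) (- x)))"
    using assms by (intro fourier_integral_adjoint) (simp_all add: in_L1_def)
  also have "\<dots> = cinner f (reflect (fourier_L1 g))"
    unfolding cinner_rep
  proof (rule integral_cong_AE)
    show "AE x in lebesgue. rep_l2 f x * cnj (fourier_integral (rep_l2 g) (- x))
        = rep_l2 f x * cnj (rep_l2 (reflect (fourier_L1 g)) x)"
      using rep_reflect[of "fourier_L1 g"] AE_reflect[OF rep_fourier_L1[OF assms(2)]]
      by eventually_elim simp
  qed measurable
  finally show ?thesis .
qed

text \<open>The adjoint relation passes from truncations to the limit in one argument at a time.\<close>

lemma cinner_plancherel: "cinner (plancherel f) g = cinner f (reflect (plancherel g))"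
proof -
  let ?T = "\<lambda>n. time_proj (window n)"
  have 1: "cinner (plancherel f) (?T m g) = cinner f (reflect (plancherel (?T m g)))" for m
  proof (rule LIMSEQ_unique)
    show "(\<lambda>n. cinner (plancherel (?T n f)) (?T m g)) \<longlonglongrightarrow> cinner (plancherel f) (?T m g)"
      by (intro tendsto_cinner_left plancherel_continuous truncation_tendsto)
    have "cinner (plancherel (?T n f)) (?T m g) = cinner (?T n f) (reflect (plancherel (?T m g)))" for n
      by (simp add: plancherel_L1 in_L1_truncation cinner_fourier_L1)
    then show "(\<lambda>n. cinner (plancherel (?T n f)) (?T m g)) \<longlonglongrightarrow> cinner f (reflect (plancherel (?T m g)))"
      by (simp add: tendsto_cinner_left truncation_tendsto)
  qed
  show ?thesis
  proof (rule LIMSEQ_unique)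
    show "(\<lambda>m. cinner (plancherel f) (?T m g)) \<longlonglongrightarrow> cinner (plancherel f) g"
      by (intro tendsto_cinner_right truncation_tendsto)
    show "(\<lambda>m. cinner (plancherel f) (?T m g)) \<longlonglongrightarrow> cinner f (reflect (plancherel g))"
      unfolding 1 by (intro tendsto_cinner_right reflect_continuous plancherel_continuous truncation_tendsto)
  qed
qed

lemma cinner_reflect: "cinner (reflect f) g = cinner f (reflect g)"
proof -
  have m: "(\<lambda>x. rep_l2 f x * cnj (rep_l2 g (- x))) \<in> borel_measurable lebesgue"
    using square_integrable_mult_cnj[OF square_integrable_rep square_integrable_reflect[OF square_integrable_rep]]
    by (rule borel_measurable_integrable)
  have "cinner (reflect f) g = (LINT x|lebesgue. rep_l2 f (- x) * cnj (rep_l2 g x))"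
    using cinner_abs[OF square_integrable_reflect[OF square_integrable_rep] square_integrable_rep, of f g]
    by (simp add: reflect_def)
  also have "\<dots> = (LINT x|lebesgue. rep_l2 f x * cnj (rep_l2 g (- x)))"
    using integral_reflect_lebesgue[OF m] by simp
  also have "\<dots> = cinner f (reflect g)"
    using cinner_abs[OF square_integrable_rep square_integrable_reflect[OF square_integrable_rep], of f g]
    by (simp add: reflect_def)
  finally show ?thesis .
qed

text \<open>Since the reflected transform is the adjoint, this says that the transform is an isometry. On
  interval indicators the identity is known, and it extends by density, first in the test vector
  and then in \<open>f\<close>.\<close>

lemma reflect_plancherel_plancherel: "reflect (plancherel (plancherel f)) = f"
proof -
  let ?G = "\<lambda>f. reflect (plancherel (plancherel f))"
  have G: "bounded_clinear ?G"
    using bounded_clinear_compose[OF bounded_clinear_reflect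
        bounded_clinear_compose[OF bounded_clinear_plancherel bounded_clinear_plancherel]]
    by (simp add: o_def)
  note lin = bounded_linear.linear[OF bounded_clinear_linear[OF G]]
  have ind_fixed: "?G (ind {a<..b}) = ind {a<..b}" for a b
  proof (rule cinner_nondegenerate)
    fix g
    show "cinner g (?G (ind {a<..b})) = cinner g (ind {a<..b})"
    proof (induction g rule: l2_induct)
      case (ind c d)
      have "plancherel (ind {u<..v}) = fourier_L1 (ind {u<..v})" for u v
        by (intro plancherel_L1 step_function_in_L1 step_function.intros)
      then show ?case
        by (simp add: cinner_fourier_L1_ind flip: cinner_plancherel)
    next
      case (limit u f)
      have "(\<lambda>n. cinner (u n) (ind {a<..b})) \<longlonglongrightarrow> cinner f (?G (ind {a<..b}))"
        using tendsto_cinner_left[OF limit(2), of "?G (ind {a<..b})"] limit(1) by simp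
      then show ?case
        by (rule LIMSEQ_unique) (rule tendsto_cinner_left[OF limit(2)])
    qed (simp_all add: cinner_add_left cinner_scaleC_left)
  qed
  show ?thesis
  proof (induction f rule: l2_induct)
    case (ind a b)
    show ?case by (rule ind_fixed)
  next
    case (add f g)
    then show ?case by (simp add: linear_add[OF lin])
  next
    case (scale c f)
    then show ?case using bounded_clinear_scaleC[OF G, of c f] by simp
  next
    case (limit u f)
    have "(\<lambda>n. ?G (u n)) \<longlonglongrightarrow> ?G f"
      by (intro reflect_continuous plancherel_continuous limit)
    then show ?case using limit LIMSEQ_unique by simp
  qed
qed

lemma cadjoint_fourier: "cadjoint fourier = (\<lambda>f. reflect (plancherel f))"
  unfolding fourier_eq_plancherel by (rule cadjoint_eqI) (rule cinner_plancherel)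

text \<open>The transform commutes with reflection, so its adjoint is also a right inverse: the transform is
  unitary, and conjugation by it preserves orthogonal projections.\<close>

lemma orthogonal_projection_freq_proj:
  assumes "A \<in> sets lebesgue"
  shows "orthogonal_projection (freq_proj A)"
proof -
  interpret T: orthogonal_projection "time_proj A"
    by (rule orthogonal_projection_time_proj[OF assms])
  have eq: "freq_proj A f = reflect (plancherel (time_proj A (plancherel f)))" for f
    unfolding freq_proj_def cadjoint_fourier by (simp add: fourier_eq_plancherel time_proj_def)
  have inv: "plancherel (reflect (plancherel f)) = f" for f
    by (simp add: plancherel_reflect reflect_plancherel_plancherel)
  have adj: "cinner (reflect (plancherel f)) g = cinner f (plancherel g)" for f g
    by (simp add: cinner_reflect cinner_plancherel plancherel_reflect)
  show ?thesis
  proof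
    have "freq_proj A = reflect \<circ> (plancherel \<circ> (time_proj A \<circ> plancherel))"
      by (simp add: fun_eq_iff eq)
    then show "bounded_clinear (freq_proj A)"
      by (simp add: bounded_clinear_compose bounded_clinear_reflect bounded_clinear_plancherel T.bounded)
    show "freq_proj A (freq_proj A f) = freq_proj A f" for f
      by (simp add: eq inv)
    show "cinner (freq_proj A f) g = cinner f (freq_proj A g)" for f g
      by (simp add: eq adj T.selfadjoint cinner_plancherel)
  qed
qed

section \<open>The equivalence\<close>

lemma all_equivalentI:
  assumes "list_all (\<lambda>A. A \<longleftrightarrow> B) As"
  shows "all_equivalent As"
  using assms unfolding all_equivalent_def list_all_iff by blast

theorem proposition5p10:
  fixes S \<Sigma> :: "real set"
  assumes "S \<in> sets lebesgue" and "\<Sigma> \<in> sets lebesgue"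
  shows "all_equivalent
    [strong_annihilating_pair S \<Sigma>,
     1 + \<i> \<notin> closure (numerical_range (\<lambda>f. time_proj S f + \<i> *\<^sub>C freq_proj \<Sigma> f)),
     range (time_proj S) \<inter> range (freq_proj \<Sigma>) = {0} \<and>
       cos_angle (range (time_proj S)) (range (freq_proj \<Sigma>)) < 1,
     onorm (time_proj S \<circ> freq_proj \<Sigma>) < 1,
     spectral_radius (time_proj S \<circ> freq_proj \<Sigma>) < 1,
     1 \<notin> spectrum (time_proj S \<circ> freq_proj \<Sigma>),
     1 \<notin> closure (numerical_range (time_proj S \<circ> freq_proj \<Sigma>)),
     numerical_radius (time_proj S \<circ> freq_proj \<Sigma>) < 1,
     \<forall>\<alpha>\<in>{0..pi/3}.
       numerical_radius
         (re_op (\<lambda>f. exp (- \<i> * complex_of_real \<alpha>) *\<^sub>C (time_proj S \<circ> freq_proj \<Sigma>) f)) < cos \<alpha>,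
     \<exists>\<alpha>\<in>{0..pi/3}.
       numerical_radius
         (re_op (\<lambda>f. exp (- \<i> * complex_of_real \<alpha>) *\<^sub>C (time_proj S \<circ> freq_proj \<Sigma>) f)) < cos \<alpha>,
     \<exists>\<theta><pi/6. numerical_range (time_proj S \<circ> freq_proj \<Sigma>)
       \<subseteq> {z. \<bar>Arg (1 - z)\<bar> \<le> \<theta>} - {1}]"
    (is "all_equivalent [?a, ?b, ?c, ?d, ?e, ?f, ?g, ?h, ?i, ?j, ?k]")
proof -
  interpret projection_pair "time_proj S" "freq_proj \<Sigma>"
    using assms by (intro projection_pair.intro orthogonal_projection_time_proj
        orthogonal_projection_freq_proj)
  have a: "?a \<longleftrightarrow> ?d"
    unfolding strong_annihilating_pair_def by (rule norm_less_one_iff_annihilating)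
  have b: "?b \<longleftrightarrow> ?d" by (rule norm_less_one_iff_numerical_range_sum)
  have c: "?c \<longleftrightarrow> ?d" by (rule norm_less_one_iff_cos_angle)
  have e: "?e \<longleftrightarrow> ?d" and f: "?f \<longleftrightarrow> ?d"
    using spectral_radius_less_one one_notin_spectrum norm_less_one_if_one_notin_spectrum by blast+
  have g: "?g \<longleftrightarrow> ?d" and h: "?h \<longleftrightarrow> ?d"
    using numerical_radius_less_one one_notin_closure_numerical_range
      norm_less_one_if_one_notin_closure by blast+
  have "?d \<Longrightarrow> ?i" using numerical_radius_re_op_less by blast
  moreover have "?i \<Longrightarrow> ?j"
    by (erule bspec[of _ _ 0, THEN bexI[of _ 0]]) (simp_all add: pi_ge_zero)
  moreover have "?j \<Longrightarrow> ?d" using norm_less_one_if_numerical_radius_re_op_less by blast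
  ultimately have i: "?i \<longleftrightarrow> ?d" and j: "?j \<longleftrightarrow> ?d" by argo+
  have k: "?k \<longleftrightarrow> ?d"
    using numerical_range_subset_sector norm_less_one_if_subset_sector by blast
  show ?thesis
    by (rule all_equivalentI[where B = ?d], unfold list.pred_inject)
      (intro conjI list.pred_inject(1) refl a b c e f g h i j k)
qed

end
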